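(* Let $m\ge 0$ be an integer and let $\lambda$ be a partition. Then the equality $$\dim F^{(n)}_{\lambda}=\dim F^{(m+n)}_{\lambda'}$$ holds for every integer $n\ge 1$ with $n\ge \ell(\lambda)$ if and only if $\lambda'$ is $m$-asymmetric.
   Context: A partition is a weakly decreasing finite sequence of nonnegative integers $\lambda=(\lambda_1,\lambda_2,\dots)$ (trailing zeros are ignored); its length $\ell(\lambda)$ is the number of nonzero parts, and $\lambda'$ is the conjugate partition. The Frobenius rank $r=\mathrm{rk}(\lambda)$ is the largest integer $k$ with $\lambda_k\ge k$ ($r=0$ for the empty partition). The Frobenius coordinates of $\lambda$ are $(\alpha|\beta)$, where $\alpha_i=\lambda_i-i$ and $\beta_i=\lambda'_i-i$ for $1\le i\le r$; thus $\alpha_1>\dots>\alpha_r\ge 0$ and $\beta_1>\dots>\beta_r\ge 0$. For an integer $z$, a partition with Frobenius coordinates $(\alpha|\beta)$ is called $z$-asymmetric if $\beta_i=\alpha_i+z$ for all $1\le i\le r$. The empty partition is $z$-asymmetric for every $z$. For a partition $\pi$ with $\ell(\pi)\le n$, $F^{(n)}_\pi$ denotes the finite-dimensional simple $\mathfrak{gl}_n$-module (over $\mathbb{C}$) with highest weight $\pi$. Its dimension equals the number of semistandard Young tableaux of shape $\pi$ with entries in $\{1,\dots,n\}$ (rows weakly increasing, columns strictly increasing), and is given by the hook content formula $\dim F^{(n)}_\pi=\prod_{u\in\pi}\frac{n+c(u)}{h(u)}$, where for a cell $u=(i,j)$ of the Young diagram of $\pi$, $c(u)=j-i$ is its content and $h(u)=\pi_i-i+\pi'_j-j+1$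 is its hook length. If $\ell(\pi)>n$, $\dim F^{(n)}_\pi$ is read as $0$ (in agreement with both the tableau count and the formula). *)

theory Defs
  imports Complex_Main "Jordan_Normal_Form.VS_Connect"
begin

text \<open>A partition is a weakly decreasing list of natural numbers. Trailing zeros are allowed and
  have no effect on any of the notions below.\<close>

definition is_partition :: "nat list \<Rightarrow> bool" where
  "is_partition lam \<longleftrightarrow> sorted_wrt (\<ge>) lam"

text \<open>Parts are indexed from 1, and the sequence is continued by zeros. Index 0 is not used; its
  value is 0.\<close>

definition part :: "nat list \<Rightarrow> nat \<Rightarrow> nat" where
  "part lam i = (if 1 \<le> i \<and> i \<le> length lam then lam ! (i - 1) else 0)"

definition part_length :: "nat list \<Rightarrow> nat" where
  "part_length lam = card {i. part lam i \<noteq> 0}"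

definition conjugate_part :: "nat list \<Rightarrow> nat list" where
  "conjugate_part lam = map (\<lambda>j. card {i. 1 \<le> i \<and> j \<le> part lam i}) [1..<part lam 1 + 1]"

definition frobenius_rank :: "nat list \<Rightarrow> nat" where
  "frobenius_rank lam = Max ({0} \<union> {k. 1 \<le> k \<and> k \<le> part lam k})"

definition frobenius_alpha :: "nat list \<Rightarrow> nat \<Rightarrow> int" where
  "frobenius_alpha lam i = int (part lam i) - int i"

definition frobenius_beta :: "nat list \<Rightarrow> nat \<Rightarrow> int" where
  "frobenius_beta lam i = int (part (conjugate_part lam) i) - int i"

definition asymmetric_part :: "int \<Rightarrow> nat list \<Rightarrow> bool" where
  "asymmetric_part z lam \<longleftrightarrow>
     (\<forall>i\<in>{1..frobenius_rank lam}. frobenius_beta lam i = frobenius_alpha lam i + z)"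

text \<open>A \<open>d\<close>-dimensional module over the Lie algebra of complex \<open>n \<times> n\<close> matrices, with a basis
  chosen so that the underlying space is the space of complex vectors of length \<open>d\<close>:
  the action of \<open>X\<close> is multiplication by \<open>\<rho> X\<close>.\<close>

definition gl_rep :: "nat \<Rightarrow> nat \<Rightarrow> (complex mat \<Rightarrow> complex mat) \<Rightarrow> bool" where
  "gl_rep n d \<rho> \<longleftrightarrow>
     (\<forall>X \<in> carrier_mat n n. \<rho> X \<in> carrier_mat d d) \<and>
     (\<forall>X \<in> carrier_mat n n. \<forall>Y \<in> carrier_mat n n. \<rho> (X + Y) = \<rho> X + \<rho> Y) \<and>
     (\<forall>c. \<forall>X \<in> carrier_mat n n. \<rho> (c \<cdot>\<^sub>m X) = c \<cdot>\<^sub>m \<rho> X) \<and>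
     (\<forall>X \<in> carrier_mat n n. \<forall>Y \<in> carrier_mat n n.
        \<rho> (X * Y - Y * X) = \<rho> X * \<rho> Y - \<rho> Y * \<rho> X)"

definition simple_gl_rep :: "nat \<Rightarrow> nat \<Rightarrow> (complex mat \<Rightarrow> complex mat) \<Rightarrow> bool" where
  "simple_gl_rep n d \<rho> \<longleftrightarrow> gl_rep n d \<rho> \<and> d > 0 \<and>
     (\<forall>W. VectorSpace.subspace class_ring W (module_vec TYPE(complex) d) \<longrightarrow>
          (\<forall>X \<in> carrier_mat n n. \<forall>w \<in> W. \<rho> X *\<^sub>v w \<in> W) \<longrightarrow>
          W = {0\<^sub>v d} \<or> W = carrier_vec d)"

definition matrix_unit :: "nat \<Rightarrow> nat \<Rightarrow> nat \<Rightarrow> complex mat" where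
  "matrix_unit n i j = mat n n (\<lambda>(a, b). if a = i \<and> b = j then 1 else 0)"

text \<open>The Borel subalgebra is that of the upper triangular matrices, and the Cartan subalgebra that
  of the diagonal ones. Matrix indices start at 0, parts at 1.\<close>

definition has_highest_weight ::
  "nat \<Rightarrow> nat \<Rightarrow> (complex mat \<Rightarrow> complex mat) \<Rightarrow> nat list \<Rightarrow> bool" where
  "has_highest_weight n d \<rho> p \<longleftrightarrow>
     (\<exists>v \<in> carrier_vec d. v \<noteq> 0\<^sub>v d \<and>
        (\<forall>i j. i < j \<and> j < n \<longrightarrow> \<rho> (matrix_unit n i j) *\<^sub>v v = 0\<^sub>v d) \<and>
        (\<forall>i < n. \<rho> (matrix_unit n i i) *\<^sub>v v = of_nat (part p (i + 1)) \<cdot>\<^sub>v v))"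

text \<open>The dimension of the finite-dimensional simple module with highest weight \<open>p\<close>. That module
  exists and is unique up to isomorphism when \<open>p\<close> is a partition with at most \<open>n\<close> nonzero parts,
  so the description below is then proper; if \<open>p\<close> has more than \<open>n\<close> nonzero parts, the dimension
  is read as 0.\<close>

definition dim_F :: "nat \<Rightarrow> nat list \<Rightarrow> nat" where
  "dim_F n p =
     (if part_length p \<le> n
      then (THE d. \<exists>\<rho>. simple_gl_rep n d \<rho> \<and> has_highest_weight n d \<rho> p)
      else 0)"

end

theory Submission
  imports Defs "HOL-Library.Poly_Mapping" "HOL-Library.Function_Algebras" "HOL-Combinatorics.Permutations"
begin

text \<open>The dimension of the simple \<open>gl\<^sub>n\<close>-module with highest weight \<open>\<lambda>\<close> is the product of \<open>(n + c(u)) / h(u)\<close>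
over the cells \<open>u\<close> of the diagram (\<open>hook_content_formula\<close>). Transposing the diagram keeps the hook
lengths and negates the contents. So the two dimensions agree for all large \<open>n\<close> if and only if the
polynomials \<open>\<Prod>(n + c(u))\<close> and \<open>\<Prod>(n + m - c(u))\<close> coincide, that is, if and only if the multiset of
contents is symmetric under \<open>c \<mapsto> m - c\<close>. The number of cells of content \<open>k \<ge> 0\<close> is the number of
indices with \<open>\<alpha>\<^sub>i \<ge> k\<close>, and that of content \<open>- k\<close> is the number with \<open>\<beta>\<^sub>i \<ge> k\<close>. Symmetry therefore says
\<open>\<alpha>\<^sub>i = \<beta>\<^sub>i + m\<close> for all \<open>i\<close> up to the Frobenius rank (\<open>content_symmetric_iff\<close>).

Dimensions are those of actual simple modules, so existence, uniqueness of the dimension and the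
formula for it have to be established for modules.

\<^item> Existence: \<open>gl\<^sub>n\<close> acts on the exterior algebra of \<open>\<complex>\<^sup>n \<otimes> \<complex>\<^sup>N\<close>, where the basis vector indexed by the
  Young diagram of \<open>\<lambda>\<close> is a highest weight vector of weight \<open>\<lambda>\<close> (\<open>highest_weight_rep_exists\<close>). A module of
  least dimension with such a vector is simple (\<open>simple_highest_weight_rep_exists\<close>).

\<^item> Dimension: a simple module is spanned by weight vectors obtained by lowering operators, on which
  the Casimir element is a scalar. Its traces on the weight spaces give a differential equation for
  the character \<open>\<chi>\<close>. Multiplied by \<open>P = \<Prod>(x\<^sub>i - x\<^sub>j)\<close>, the equation says that \<open>P \<chi>\<close> is an eigenvector of the
  Laplace operator \<open>\<Sum>(x\<^sub>i \<partial>/\<partial>x\<^sub>i)\<^sup>2\<close>, so its exponents lie on the sphere through \<open>\<lambda> + \<rho>\<close>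
  (\<open>laplace_denominator_times_character\<close>). Divisibility by \<open>x\<^sub>i - x\<^sub>j\<close> makes the coefficients along each
  line in direction \<open>e\<^sub>i - e\<^sub>j\<close> sum to zero, and the line meets the sphere in two points exchanged by
  a transposition; thus \<open>P \<chi>\<close> is antisymmetric (\<open>antisymmetric_if_divisible_on_sphere\<close>). As \<open>\<lambda> + \<rho>\<close> is the
  only strictly decreasing exponent on the sphere that it dominates, \<open>P \<chi>\<close> is the alternating sum of
  the permutations of \<open>x\<^bsup>\<lambda> + \<rho>\<^esup>\<close> (\<open>weyl_character_formula\<close>). Letting all variables tend to \<open>1\<close> along a curve
  gives the dimension (\<open>weyl_dimension_formula\<close>), so it depends on \<open>\<lambda>\<close> alone, and a row-wise count turns
  the resulting product into hooks and contents (\<open>weyl_product_eq_content_product\<close>).\<close>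

section \<open>The Vandermonde determinant\<close>

lemma prod_pairs_Suc:
  fixes f :: "nat \<Rightarrow> nat \<Rightarrow> 'a :: comm_monoid_mult"
  shows "(\<Prod>i<Suc n. \<Prod>j\<in>{i<..<Suc n}. f i j) =
    (\<Prod>j<n. f 0 (Suc j)) * (\<Prod>i<n. \<Prod>j\<in>{i<..<n}. f (Suc i) (Suc j))"
proof -
  have 0: "{0<..<Suc n} = Suc ` {..<n}" by (auto simp: image_iff gr0_conv_Suc)
  have S: "{Suc i<..<Suc n} = Suc ` {i<..<n}" for i
  proof -
    have "x \<in> Suc ` {i<..<n}" if "Suc i < x" "x < Suc n" for x using that by (cases x) auto
    then show ?thesis by auto
  qed
  show ?thesis
    by (simp add: prod.lessThan_Suc_shift 0 S prod.reindex del: prod.lessThan_Suc)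
qed

text \<open>Subtracting from each column \<open>y 0\<close> times the next one clears row \<open>0\<close> except for its last entry and leaves
the factor \<open>y (i + 1) - y 0\<close> in every other row. The column operation is right multiplication by
the unipotent matrix \<open>U\<close>; expansion along row \<open>0\<close> then leaves the determinant for one variable less.\<close>

lemma det_vandermonde:
  fixes y :: "nat \<Rightarrow> 'a :: comm_ring_1"
  shows "det (mat n n (\<lambda>(i, j). y i ^ (n - 1 - j))) = (\<Prod>i<n. \<Prod>j\<in>{i<..<n}. y i - y j)"
proof (induction n arbitrary: y)
  case 0
  show ?case by (simp add: det_def)
next
  case (Suc n)
  let ?M = "mat (Suc n) (Suc n) (\<lambda>(i, j). y i ^ (n - j))"
  define U where "U = mat (Suc n) (Suc n) (\<lambda>(i, j). if i = j then 1 else if i = Suc j then - y 0 else 0)"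
  define R where "R = ?M * U"
  have M: "?M \<in> carrier_mat (Suc n) (Suc n)" and U: "U \<in> carrier_mat (Suc n) (Suc n)"
    and R: "R \<in> carrier_mat (Suc n) (Suc n)" by (auto simp: U_def R_def)
  have dU: "det U = 1"
  proof -
    have "det U = prod_list (diag_mat U)"
      by (rule det_lower_triangular[OF _ U]) (auto simp: U_def)
    also have "diag_mat U = map (\<lambda>i. 1) [0..<Suc n]"
      unfolding diag_mat_def by (rule map_cong) (auto simp: U_def)
    also have "prod_list \<dots> = 1" by (simp add: map_replicate_const prod_list_replicate)
    finally show ?thesis .
  qed
  have R_entry: "R $$ (i, j) = (if j < n then y i ^ (n - 1 - j) * (y i - y 0) else 1)"
    if "i < Suc n" "j < Suc n" for i j
  proof -
    have "R $$ (i, j) = (\<Sum>k<Suc n. y i ^ (n - k) * U $$ (k, j))"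
      using that by (simp add: R_def U_def scalar_prod_def atLeast0LessThan)
    also have "\<dots> = (\<Sum>k<Suc n. (if k = j then y i ^ (n - j) else 0)
        + (if k = Suc j then - (y i ^ (n - Suc j)) * y 0 else 0))"
      using that by (intro sum.cong) (auto simp: U_def)
    also have "\<dots> = y i ^ (n - j) + (if j < n then - (y i ^ (n - Suc j)) * y 0 else 0)"
      using that unfolding sum.distrib by (simp add: sum.delta del: sum.lessThan_Suc)
    finally show ?thesis using that
      by (auto simp: algebra_simps Suc_diff_Suc simp flip: power_Suc)
  qed
  have "det ?M = det R" using det_mult[OF M U] dU by (simp add: R_def)
  also have "\<dots> = (\<Sum>j<Suc n. R $$ (0, j) * cofactor R 0 j)"
    by (rule laplace_expansion_row[OF R]) simp
  also have "\<dots> = (\<Sum>j<Suc n. if j = n then cofactor R 0 n else 0)"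
    by (intro sum.cong) (auto simp: R_entry)
  also have "\<dots> = cofactor R 0 n" by (simp add: R_entry sum.delta)
  also have "\<dots> = (-1) ^ n * det (mat_delete R 0 n)" by (simp add: cofactor_def)
  also have "mat_delete R 0 n =
      mat\<^sub>r n n (\<lambda>i. (y (Suc i) - y 0) \<cdot>\<^sub>v row (mat n n (\<lambda>(i, j). y (Suc i) ^ (n - 1 - j))) i)"
    by (rule eq_matI) (use R in \<open>auto simp: mat_delete_def R_entry mult.commute\<close>)
  also have "det \<dots> = (\<Prod>i = 0..<n. y (Suc i) - y 0) * det (mat n n (\<lambda>(i, j). y (Suc i) ^ (n - 1 - j)))"
  proof -
    have e: "mat\<^sub>r n n (row (mat n n (\<lambda>(i, j). y (Suc i) ^ (n - 1 - j)))) =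
        mat n n (\<lambda>(i, j). y (Suc i) ^ (n - 1 - j))"
      by (rule eq_matI) auto
    show ?thesis by (subst det_rows_mul, force) (simp only: e)
  qed
  also have "(-1) ^ n * \<dots> = (\<Prod>i<n. y 0 - y (Suc i)) * (\<Prod>i<n. \<Prod>j\<in>{i<..<n}. y (Suc i) - y (Suc j))"
  proof -
    have "(-1) ^ n * (\<Prod>i = 0..<n. y (Suc i) - y 0) = (\<Prod>i<n. (-1) * (y (Suc i) - y 0))"
      by (simp only: prod.distrib atLeast0LessThan) simp
    also have "\<dots> = (\<Prod>i<n. y 0 - y (Suc i))" by simp
    finally show ?thesis by (simp only: Suc.IH[of "\<lambda>i. y (Suc i)"] mult.assoc[symmetric])
  qed
  finally show ?case by (simp add: prod_pairs_Suc del: prod.lessThan_Suc)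
qed

lemma vandermonde_permutation_sum:
  fixes y :: "nat \<Rightarrow> 'a :: comm_ring_1"
  shows "(\<Sum>w | w permutes {..<n}. of_int (sign w) * (\<Prod>i<n. y i ^ (n - 1 - w i))) =
    (\<Prod>i<n. \<Prod>j\<in>{i<..<n}. y i - y j)"
proof -
  have "w i < n" if "w permutes {..<n}" "i < n" for w :: "nat \<Rightarrow> nat" and i
    using permutes_in_image[OF that(1), of i] that(2) by simp
  then show ?thesis
    unfolding det_vandermonde[symmetric]
    by (subst det_def'[of _ n]) (auto simp: atLeast0LessThan intro!: sum.cong prod.cong)
qed

section \<open>Laurent polynomials and the Laplace operator\<close>

text \<open>Exponents are functions on all natural numbers rather than vectors of length \<open>n\<close>, so that they form
an abelian group and Laurent polynomials become its group algebra; only the first \<open>n\<close> coordinates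
are ever nonzero.\<close>

type_synonym laurent = "(nat \<Rightarrow> int) \<Rightarrow>\<^sub>0 complex"

abbreviation "coeff_at \<equiv> Poly_Mapping.lookup"
abbreviation "monomial \<equiv> Poly_Mapping.single"

lemma poly_mapping_eq_sum_single:
  "p = (\<Sum>\<mu>\<in>Poly_Mapping.keys p. monomial \<mu> (coeff_at p \<mu>))"
  by (rule poly_mapping_eqI)
    (auto simp: lookup_sum lookup_single when_def in_keys_iff sum.delta if_distrib cong: if_cong)

lemma lookup_single_mult:
  fixes p :: "'a :: ab_group_add \<Rightarrow>\<^sub>0 'b :: semiring_0"
  shows "coeff_at (monomial \<alpha> c * p) \<mu> = c * coeff_at p (\<mu> - \<alpha>)"
proof -
  have "coeff_at (monomial \<alpha> c * p) \<mu> =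
      (\<Sum>\<kappa>\<in>Poly_Mapping.keys p. c * coeff_at p \<kappa> when \<alpha> + \<kappa> = \<mu>)"
    by (subst (1) poly_mapping_eq_sum_single[of p])
      (simp add: sum_distrib_left mult_single lookup_sum lookup_single)
  also have "\<dots> = (\<Sum>\<kappa>\<in>Poly_Mapping.keys p. if \<kappa> = \<mu> - \<alpha> then c * coeff_at p \<kappa> else 0)"
    by (intro sum.cong) (auto simp: when_def algebra_simps)
  also have "\<dots> = c * coeff_at p (\<mu> - \<alpha>)"
    by (auto simp: sum.delta in_keys_iff)
  finally show ?thesis .
qed

text \<open>The Euler operator \<open>x\<^sub>k \<partial>/\<partial>x\<^sub>k\<close>, which acts diagonally on monomials.\<close>

definition euler :: "nat \<Rightarrow> laurent \<Rightarrow> laurent" where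
  "euler k p = Poly_Mapping.mapp (\<lambda>\<mu> c. of_int (\<mu> k) * c) p"

lemma lookup_euler: "coeff_at (euler k p) \<mu> = of_int (\<mu> k) * coeff_at p \<mu>"
  by (auto simp: euler_def lookup_mapp when_def in_keys_iff)

lemma euler_add: "euler k (p + q) = euler k p + euler k q"
  and euler_diff: "euler k (p - q) = euler k p - euler k q"
  and euler_zero [simp]: "euler k 0 = 0"
  by (rule poly_mapping_eqI; simp add: lookup_euler lookup_add lookup_minus algebra_simps)+

lemma euler_sum: "euler k (sum f A) = (\<Sum>a\<in>A. euler k (f a))"
  by (induction A rule: infinite_finite_induct) (auto simp: euler_add)

lemma euler_single: "euler k (monomial \<mu> c) = monomial \<mu> (of_int (\<mu> k) * c)"
  by (rule poly_mapping_eqI) (auto simp: lookup_euler lookup_single when_def)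

lemma euler_mult: "euler k (p * q) = euler k p * q + p * euler k q"
proof -
  have single: "euler k (monomial \<mu> a * monomial \<nu> b) =
      euler k (monomial \<mu> a) * monomial \<nu> b +
      monomial \<mu> a * euler k (monomial \<nu> b)" for \<mu> \<nu> a b
    by (simp add: euler_single mult_single algebra_simps flip: single_add)
  have right: "euler k (monomial \<mu> a * q) =
      euler k (monomial \<mu> a) * q + monomial \<mu> a * euler k q" for \<mu> a
    by (subst (1 2 3) poly_mapping_eq_sum_single[of q])
      (simp add: sum_distrib_left euler_sum single sum.distrib)
  show ?thesis
    by (subst (1 2 3) poly_mapping_eq_sum_single[of p])
      (simp add: sum_distrib_right euler_sum right sum.distrib)
qed

lemma euler_prod:
  assumes "finite Q"
  shows "euler k (\<Prod>q\<in>Q. f q) = (\<Sum>q\<in>Q. euler k (f q) * (\<Prod>r\<in>Q - {q}. f r))"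
  using assms
proof (induction Q rule: finite_induct)
  case empty
  show ?case by (simp add: euler_single flip: single_one)
next
  case (insert x Q)
  have "(\<Prod>r\<in>insert x Q - {q}. f r) = f x * (\<Prod>r\<in>Q - {q}. f r)" if "q \<in> Q" for q
  proof -
    have "insert x Q - {q} = insert x (Q - {q})" using that insert.hyps by auto
    then show ?thesis using insert.hyps by simp
  qed
  then show ?case using insert
    by (simp add: euler_mult sum_distrib_left mult_ac)
qed

definition laplace :: "nat \<Rightarrow> laurent \<Rightarrow> laurent" where
  "laplace n p = (\<Sum>k<n. euler k (euler k p))"

lemma lookup_laplace:
  "coeff_at (laplace n p) \<mu> = of_int (\<Sum>k<n. (\<mu> k)\<^sup>2) * coeff_at p \<mu>"
  by (simp add: laplace_def lookup_sum lookup_euler sum_distrib_right power2_eq_square mult.assoc)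

lemma laplace_mult:
  "laplace n (p * q) = laplace n p * q + 2 * (\<Sum>k<n. euler k p * euler k q) + p * laplace n q"
  by (simp add: laplace_def euler_mult euler_add sum.distrib sum_distrib_left sum_distrib_right
      algebra_simps)

definition unit_weight :: "nat \<Rightarrow> nat \<Rightarrow> int" where
  "unit_weight i k = (if k = i then 1 else 0)"

abbreviation X :: "nat \<Rightarrow> laurent" where
  "X i \<equiv> monomial (unit_weight i) 1"

definition pairs :: "nat \<Rightarrow> (nat \<times> nat) set" where
  "pairs n = {(i, j). i < j \<and> j < n}"

lemma finite_pairs [simp]: "finite (pairs n)"
  by (rule finite_subset[of _ "{..<n} \<times> {..<n}"]) (auto simp: pairs_def)

lemma pairs_Sigma: "pairs n = Sigma {..<n} (\<lambda>i. {i<..<n})"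
  by (auto simp: pairs_def)

definition weyl_denominator :: "nat \<Rightarrow> laurent" where
  "weyl_denominator n = (\<Prod>(i, j)\<in>pairs n. X i - X j)"

definition alternant :: "nat \<Rightarrow> (nat \<Rightarrow> int) \<Rightarrow> laurent" where
  "alternant n l = (\<Sum>w | w permutes {..<n}. monomial (l \<circ> w) (of_int (sign w)))"

text \<open>The vector \<open>\<rho> = (n - 1, \<dots>, 1, 0)\<close>. It differs from half the sum of the positive roots by a constant
vector, and has the advantage of integral entries.\<close>

definition staircase :: "nat \<Rightarrow> nat \<Rightarrow> int" where
  "staircase n i = (if i < n then int (n - 1 - i) else 0)"

lemma prod_X_power:
  "(\<Prod>i<n. X i ^ a i) = monomial (\<lambda>i. if i < n then int (a i) else 0) 1"
proof -
  have pow: "X i ^ k = monomial (\<lambda>j. if j = i then int k else 0) 1" for i k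
    by (induction k) (auto simp: mult_single unit_weight_def fun_eq_iff simp flip: single_one
        intro!: arg_cong[of _ _ "\<lambda>\<mu>. monomial \<mu> 1"])
  show ?thesis
    by (induction n) (auto simp: pow mult_single fun_eq_iff simp flip: single_one
        intro!: arg_cong[of _ _ "\<lambda>\<mu>. monomial \<mu> 1"])
qed

lemma weyl_denominator_eq_alternant: "weyl_denominator n = alternant n (staircase n)"
proof -
  have "alternant n (staircase n) =
      (\<Sum>w | w permutes {..<n}. of_int (sign w) * (\<Prod>i<n. X i ^ (n - 1 - w i)))"
    unfolding alternant_def
  proof (rule sum.cong[OF refl])
    fix w assume "w \<in> {w. w permutes {..<n}}"
    then have w: "w permutes {..<n}" by simp
    have "(\<lambda>i. if i < n then int (n - 1 - w i) else 0) = staircase n \<circ> w"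
      using permutes_in_image[OF w] by (auto simp: staircase_def fun_eq_iff)
    then show "monomial (staircase n \<circ> w) (of_int (sign w)) =
        of_int (sign w) * (\<Prod>i<n. X i ^ (n - 1 - w i))"
      by (simp only: prod_X_power) (simp add: mult_single flip: single_of_int)
  qed
  also have "\<dots> = weyl_denominator n"
    unfolding vandermonde_permutation_sum weyl_denominator_def pairs_Sigma
    by (subst prod.Sigma) auto
  finally show ?thesis by simp
qed

lemma laplace_alternant:
  "laplace n (alternant n l) = monomial 0 (of_int (\<Sum>k<n. (l k)\<^sup>2)) * alternant n l"
proof -
  have single: "laplace n (monomial \<mu> c) = monomial \<mu> (of_int (\<Sum>k<n. (\<mu> k)\<^sup>2) * c)" for \<mu> c
    by (rule poly_mapping_eqI)
      (auto simp: lookup_laplace lookup_single when_def simp del: of_int_sum)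
  have perm: "(\<Sum>k<n. (l (w k))\<^sup>2) = (\<Sum>k<n. (l k)\<^sup>2)" if "w permutes {..<n}" for w
    using sum.permute[OF that, of "\<lambda>k. (l k)\<^sup>2"] by (simp add: comp_def)
  have "laplace n (alternant n l) =
      (\<Sum>w | w permutes {..<n}. laplace n (monomial (l \<circ> w) (of_int (sign w))))"
    unfolding laplace_def alternant_def euler_sum by (rule sum.swap)
  also have "\<dots> = monomial 0 (of_int (\<Sum>k<n. (l k)\<^sup>2)) * alternant n l"
    unfolding single alternant_def sum_distrib_left mult_single
    by (intro sum.cong) (simp_all add: perm del: of_int_sum)
  finally show ?thesis .
qed

lemma sum_pairs_Suc:
  fixes f :: "nat \<Rightarrow> nat \<Rightarrow> 'a :: comm_monoid_add"
  shows "(\<Sum>(i, j)\<in>pairs (Suc n). f i j) = (\<Sum>(i, j)\<in>pairs n. f i j) + (\<Sum>i<n. f i n)"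
proof -
  have "pairs (Suc n) = pairs n \<union> (\<lambda>i. (i, n)) ` {..<n}"
    by (auto simp: pairs_def less_Suc_eq)
  moreover have "pairs n \<inter> (\<lambda>i. (i, n)) ` {..<n} = {}" by (auto simp: pairs_def)
  ultimately show ?thesis
    by (simp add: sum.union_disjoint sum.reindex inj_on_def)
qed

lemma sum_pairs_add:
  fixes a :: "nat \<Rightarrow> 'a :: comm_ring_1"
  shows "(\<Sum>(i, j)\<in>pairs n. a i + a j) = (of_nat n - 1) * (\<Sum>k<n. a k)"
proof (induction n)
  case 0
  show ?case by (simp add: pairs_def)
next
  case (Suc n)
  then show ?case by (simp add: sum_pairs_Suc sum.distrib algebra_simps)
qed

text \<open>Write \<open>P = \<Prod>(X i - X j)\<close>, so that \<open>D\<^sub>k P = \<Sum> \<plusminus> X k P / (X i - X j)\<close> over the factors involving \<open>X k\<close>. In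
\<open>\<Delta>(P \<chi>) = \<Delta>P \<chi> + 2 \<Sum> D\<^sub>k P D\<^sub>k \<chi> + P \<Delta>\<chi>\<close> the mixed term and the first-order part of the Casimir
equation for \<open>\<chi>\<close> cancel factor by factor, up to \<open>\<Sum> P (D\<^sub>i + D\<^sub>j) \<chi>\<close>, a multiple of the total degree
operator. Hence \<open>P \<chi>\<close> is an eigenvector of \<open>\<Delta>\<close>, that is, its exponents lie on one sphere. The series
\<open>T i j\<close> stands for \<open>\<Sum> tr(E\<^sub>j\<^sub>i E\<^sub>i\<^sub>j | V\<^sub>\<mu>) x\<^sup>\<mu>\<close>.\<close>

lemma laplace_denominator_times_character:
  fixes \<chi> :: laurent and T :: "nat \<Rightarrow> nat \<Rightarrow> laurent" and c s :: laurent
  assumes T: "\<And>i j. (i, j) \<in> pairs n \<Longrightarrow> (X i - X j) * T i j = X j * (euler i \<chi> - euler j \<chi>)"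
    and casimir: "c * \<chi> = laplace n \<chi> + (\<Sum>(i, j)\<in>pairs n. euler i \<chi> - euler j \<chi> + 2 * T i j)"
    and degree: "(\<Sum>k<n. euler k \<chi>) = s * \<chi>"
  shows "laplace n (weyl_denominator n * \<chi>) =
    (monomial 0 (of_int (\<Sum>k<n. (staircase n k)\<^sup>2)) + c + (of_nat n - 1) * s)
      * (weyl_denominator n * \<chi>)"
proof -
  let ?P = "weyl_denominator n"
  define Pq where "Pq q = (\<Prod>(i, j)\<in>pairs n - {q}. X i - X j)" for q
  have P: "?P = (X i - X j) * Pq (i, j)" if "(i, j) \<in> pairs n" for i j
    unfolding weyl_denominator_def Pq_def
    by (subst prod.remove[OF _ that]) auto
  have euler_X: "euler k (X i - X j) = (if k = i then X i else 0) - (if k = j then X j else 0)" for i j k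
    by (simp add: euler_diff euler_single unit_weight_def)
  have euler_P: "euler k ?P = (\<Sum>(i, j)\<in>pairs n. euler k (X i - X j) * Pq (i, j))" for k
    unfolding weyl_denominator_def Pq_def
    by (subst euler_prod) (auto simp: case_prod_unfold)
  have gradient: "(\<Sum>k<n. euler k ?P * euler k \<chi>) =
      (\<Sum>(i, j)\<in>pairs n. Pq (i, j) * (X i * euler i \<chi> - X j * euler j \<chi>))"
  proof -
    have "(\<Sum>k<n. euler k ?P * euler k \<chi>) =
        (\<Sum>(i, j)\<in>pairs n. \<Sum>k<n. euler k (X i - X j) * Pq (i, j) * euler k \<chi>)"
      unfolding euler_P sum_distrib_right
      by (subst sum.swap) (simp add: case_prod_unfold)
    also have "\<dots> = (\<Sum>(i, j)\<in>pairs n. Pq (i, j) * (X i * euler i \<chi> - X j * euler j \<chi>))"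
    proof (rule sum.cong[OF refl], clarify)
      fix i j assume "(i, j) \<in> pairs n"
      then have ij: "i < n" "j < n" by (auto simp: pairs_def)
      have "(\<Sum>k<n. euler k (X i - X j) * Pq (i, j) * euler k \<chi>) =
          (\<Sum>k<n. (if k = i then Pq (i, j) * (X i * euler i \<chi>) else 0) -
            (if k = j then Pq (i, j) * (X j * euler j \<chi>) else 0))"
        unfolding euler_X by (intro sum.cong) (auto simp: algebra_simps)
      also have "\<dots> = Pq (i, j) * (X i * euler i \<chi> - X j * euler j \<chi>)"
        using ij unfolding sum_subtractf by (simp add: sum.delta right_diff_distrib)
      finally show "(\<Sum>k<n. euler k (X i - X j) * Pq (i, j) * euler k \<chi>) =
        Pq (i, j) * (X i * euler i \<chi> - X j * euler j \<chi>)" .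
    qed
    finally show ?thesis .
  qed
  have "?P * laplace n \<chi> = c * (?P * \<chi>) - (\<Sum>(i, j)\<in>pairs n. ?P * (euler i \<chi> - euler j \<chi> + 2 * T i j))"
    using arg_cong[OF casimir, of "\<lambda>u. ?P * u"]
    by (simp add: algebra_simps sum_distrib_left case_prod_unfold)
  then have "2 * (\<Sum>k<n. euler k ?P * euler k \<chi>) + ?P * laplace n \<chi> = c * (?P * \<chi>) +
      (\<Sum>(i, j)\<in>pairs n. 2 * (Pq (i, j) * (X i * euler i \<chi> - X j * euler j \<chi>)) -
        ?P * (euler i \<chi> - euler j \<chi> + 2 * T i j))"
    unfolding gradient by (simp add: sum_subtractf sum_distrib_left case_prod_unfold)
  also have "(\<Sum>(i, j)\<in>pairs n. 2 * (Pq (i, j) * (X i * euler i \<chi> - X j * euler j \<chi>)) -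
        ?P * (euler i \<chi> - euler j \<chi> + 2 * T i j)) =
      (\<Sum>(i, j)\<in>pairs n. ?P * (euler i \<chi> + euler j \<chi>))"
  proof (rule sum.cong[OF refl], clarify)
    fix i j assume ij: "(i, j) \<in> pairs n"
    have "?P * T i j = Pq (i, j) * (X j * (euler i \<chi> - euler j \<chi>))"
      unfolding T[OF ij, symmetric] P[OF ij] by (simp only: mult_ac)
    note PT = this
    have "2 * (Pq (i, j) * (X i * euler i \<chi> - X j * euler j \<chi>)) -
        ?P * (euler i \<chi> - euler j \<chi> + 2 * T i j) =
        2 * (Pq (i, j) * (X i * euler i \<chi> - X j * euler j \<chi>)) -
        (?P * (euler i \<chi> - euler j \<chi>) + 2 * (?P * T i j))"
      by (simp only: distrib_left mult.left_commute)
    also have "\<dots> = 2 * (Pq (i, j) * (X i * euler i \<chi> - X j * euler j \<chi>)) -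
        ((X i - X j) * Pq (i, j) * (euler i \<chi> - euler j \<chi>)
        + 2 * (Pq (i, j) * (X j * (euler i \<chi> - euler j \<chi>))))"
      unfolding PT unfolding P[OF ij] ..
    also have "\<dots> = (X i - X j) * Pq (i, j) * (euler i \<chi> + euler j \<chi>)"
      by (simp add: algebra_simps)
    finally show "2 * (Pq (i, j) * (X i * euler i \<chi> - X j * euler j \<chi>)) -
        ?P * (euler i \<chi> - euler j \<chi> + 2 * T i j) = ?P * (euler i \<chi> + euler j \<chi>)"
      by (simp add: P[OF ij])
  qed
  also have "\<dots> = ?P * (\<Sum>(i, j)\<in>pairs n. euler i \<chi> + euler j \<chi>)"
    by (simp only: sum_distrib_left case_prod_unfold)
  also have "\<dots> = (of_nat n - 1) * s * (?P * \<chi>)"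
    unfolding sum_pairs_add degree by (simp add: mult_ac)
  finally show ?thesis
    unfolding laplace_mult weyl_denominator_eq_alternant laplace_alternant
    by (simp add: algebra_simps)
qed

section \<open>Antisymmetry and dominance\<close>

lemma sum_int_telescope:
  fixes g :: "int \<Rightarrow> 'a :: ab_group_add"
  assumes "a \<le> b"
  shows "(\<Sum>t\<in>{a..<b}. g t - g (t + 1)) = g a - g b"
  using assms
proof (induction b rule: int_ge_induct)
  case (step b)
  have "{a..<b + 1} = insert b {a..<b}" using step.hyps by auto
  then show ?case using step by simp
qed simp

text \<open>A reflection moves \<open>\<nu>\<close> along the root direction. This is the second point in which that line meets
the sphere through \<open>\<nu>\<close>.\<close>

lemma transpose_eq_line:
  fixes \<nu> :: "nat \<Rightarrow> int"
  assumes "i \<noteq> j"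
  shows "\<nu> \<circ> Transposition.transpose i j =
    (\<lambda>k. \<nu> k + (\<nu> j - \<nu> i) * (unit_weight i k - unit_weight j k))"
  using assms by (auto simp: fun_eq_iff unit_weight_def Transposition.transpose_def)

text \<open>Divisibility by \<open>X i - X j\<close> makes the coefficients along every line in direction \<open>e\<^sub>i - e\<^sub>j\<close> sum to
zero, since they telescope. A line meets the sphere in at most two points, \<open>\<nu>\<close> and its reflection,
so their coefficients are opposite. In this way the antisymmetry of \<open>P \<chi>\<close>, and with it the Weyl
symmetry of the character, is obtained without any representation theory of \<open>sl\<^sub>2\<close>.\<close>

lemma antisymmetric_if_divisible_on_sphere:
  fixes \<phi> \<psi> :: laurent
  assumes ij: "i < n" "j < n" "i \<noteq> j"
    and divisible: "\<psi> = (X i - X j) * \<phi>"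
    and sphere: "\<And>\<nu>. coeff_at \<psi> \<nu> \<noteq> 0 \<Longrightarrow> (\<Sum>k<n. (\<nu> k)\<^sup>2) = R"
  shows "coeff_at \<psi> (\<nu> \<circ> Transposition.transpose i j) = - coeff_at \<psi> \<nu>"
proof -
  define \<alpha> where "\<alpha> k = unit_weight i k - unit_weight j k" for k
  define line where "line t = (\<lambda>k. \<nu> k + t * \<alpha> k)" for t
  define g where "g t = coeff_at \<phi> (line t - unit_weight i)" for t
  define t0 where "t0 = \<nu> j - \<nu> i"
  have line0: "line 0 = \<nu>" by (simp add: line_def)
  have line_t0: "line t0 = \<nu> \<circ> Transposition.transpose i j"
    unfolding transpose_eq_line[OF ij(3)] line_def \<alpha>_def t0_def ..
  have \<psi>_line: "coeff_at \<psi> (line t) = g t - g (t + 1)" for t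
  proof -
    have "line t - unit_weight j = line (t + 1) - unit_weight i"
      by (simp add: line_def \<alpha>_def fun_eq_iff algebra_simps)
    then show ?thesis
      by (simp add: divisible g_def left_diff_distrib lookup_minus lookup_single_mult)
  qed
  have norm_line: "(\<Sum>k<n. (line t k)\<^sup>2) = (\<Sum>k<n. (\<nu> k)\<^sup>2) + 2 * t * (t - t0)" for t
  proof -
    have s: "(\<Sum>k<n. f k * unit_weight m k) = f m" if "m < n" for f m
      using that by (simp add: unit_weight_def if_distrib sum.delta cong: if_cong)
    have "(\<Sum>k<n. \<nu> k * \<alpha> k) = - t0"
      using ij by (simp add: \<alpha>_def right_diff_distrib sum_subtractf s t0_def)
    moreover have "(\<Sum>k<n. \<alpha> k * \<alpha> k) = 2"
      using ij s[of i \<alpha>] s[of j \<alpha>]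
      by (subst (2) \<alpha>_def) (simp add: right_diff_distrib sum_subtractf \<alpha>_def unit_weight_def)
    moreover have "(\<Sum>k<n. (line t k)\<^sup>2) =
        (\<Sum>k<n. (\<nu> k)\<^sup>2) + 2 * t * (\<Sum>k<n. \<nu> k * \<alpha> k) + t\<^sup>2 * (\<Sum>k<n. \<alpha> k * \<alpha> k)"
      by (simp add: line_def power2_eq_square sum.distrib sum_distrib_left algebra_simps)
    ultimately show ?thesis by (simp add: algebra_simps power2_eq_square)
  qed
  show ?thesis
  proof (cases "(\<Sum>k<n. (\<nu> k)\<^sup>2) = R")
    case False
    then have "coeff_at \<psi> (line 0) = 0" "coeff_at \<psi> (line t0) = 0"
      using sphere[of "line 0"] sphere[of "line t0"] by (auto simp: norm_line)
    then show ?thesis by (simp add: line0 flip: line_t0)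
  next
    case True
    have off: "coeff_at \<psi> (line t) = 0" if "t \<notin> {0, t0}" for t
      using sphere[of "line t"] that True by (auto simp: norm_line)
    have "finite {t. g t \<noteq> 0}"
    proof -
      have "inj (\<lambda>t. line t - unit_weight i)"
      proof (rule injI)
        fix s t assume "line s - unit_weight i = line t - unit_weight i"
        then have "(line s - unit_weight i) i = (line t - unit_weight i) i" by simp
        then show "s = t" using ij by (simp add: line_def \<alpha>_def unit_weight_def)
      qed
      then have "finite ((\<lambda>t. line t - unit_weight i) -` Poly_Mapping.keys \<phi>)"
        by (rule finite_vimageI[rotated]) simp
      then show ?thesis by (rule finite_subset[rotated]) (auto simp: g_def in_keys_iff)
    qed
    then have "finite (abs ` (insert t0 {t. g t \<noteq> 0}))" by simp
    \<comment> \<open>A bound beyond which g vanishes, so that the telescoping sum has no boundary terms.\<close>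
    then obtain N where N: "\<And>x. x \<in> abs ` (insert t0 {t. g t \<noteq> 0}) \<Longrightarrow> x < N"
      by (metis Max_ge zle_add1_eq_le)
    have "\<bar>t0\<bar> < N" using N by auto
    moreover have "g t = 0" if "\<bar>t\<bar> \<ge> N" for t using N[of "\<bar>t\<bar>"] that by auto
    ultimately have gN: "g (- N) = 0" "g N = 0" and in_range: "{0, t0} \<subseteq> {-N..<N}" by auto
    have "0 = (\<Sum>t\<in>{-N..<N}. coeff_at \<psi> (line t))"
      using sum_int_telescope[of "-N" N g] \<open>\<bar>t0\<bar> < N\<close> by (simp add: \<psi>_line gN)
    also have "\<dots> = (\<Sum>t\<in>{0, t0}. coeff_at \<psi> (line t))"
      by (rule sum.mono_neutral_right) (use in_range off in auto)
    finally show ?thesis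
      by (cases "t0 = 0") (auto simp: line0 eq_neg_iff_add_eq_0 add.commute simp flip: line_t0)
  qed
qed

lemma permuted_partial_sum_le:
  fixes l :: "nat \<Rightarrow> int"
  assumes decr: "\<And>i j. i < j \<Longrightarrow> j < n \<Longrightarrow> l j \<le> l i"
    and w: "w permutes {..<n}" and k: "k \<le> n"
  shows "(\<Sum>i<k. l (w i)) \<le> (\<Sum>i<k. l i)"
proof (cases k)
  case 0
  then show ?thesis by simp
next
  case (Suc m)
  define S where "S = w ` {..<k}"
  have inj: "inj_on w {..<k}" using permutes_inj[OF w] by (rule inj_on_subset) simp
  have fin: "finite S" and card: "card S = k" by (simp_all add: S_def card_image inj)
  have S_sub: "S \<subseteq> {..<n}"
    using image_mono[of "{..<k}" "{..<n}" w] permutes_image[OF w] k by (simp add: S_def)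
  have c: "card (S - {..<k}) = card ({..<k} - S)"
  proof -
    have "card S = card (S \<inter> {..<k}) + card (S - {..<k})"
      "card {..<k} = card (S \<inter> {..<k}) + card ({..<k} - S)"
      using card_Int_Diff[of S "{..<k}"] card_Int_Diff[of "{..<k}" S] fin by (simp_all add: Int_commute)
    then show ?thesis using card by simp
  qed
  have le: "l i \<le> l m" if "m \<le> i" "i < n" for i using decr[of m i] that by (cases "m = i") auto
  have ge: "l m \<le> l i" if "i \<le> m" for i using decr[of i m] that k Suc by (cases "m = i") auto
  have "(\<Sum>i\<in>S - {..<k}. l i) \<le> of_nat (card (S - {..<k})) * l m"
    by (rule sum_bounded_above) (use S_sub Suc in \<open>auto intro!: le\<close>)
  moreover have "of_nat (card ({..<k} - S)) * l m \<le> (\<Sum>i\<in>{..<k} - S. l i)"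
    by (rule sum_bounded_below) (use Suc in \<open>auto intro!: ge\<close>)
  moreover have "(\<Sum>i<k. l (w i)) = (\<Sum>i\<in>S. l i)"
    unfolding S_def by (simp add: sum.reindex inj)
  moreover have "(\<Sum>i\<in>S. l i) = (\<Sum>i\<in>S \<inter> {..<k}. l i) + (\<Sum>i\<in>S - {..<k}. l i)"
    using fin by (rule sum.Int_Diff)
  moreover have "(\<Sum>i<k. l i) = (\<Sum>i\<in>S \<inter> {..<k}. l i) + (\<Sum>i\<in>{..<k} - S. l i)"
    using sum.Int_Diff[of "{..<k}" l S] by (simp add: Int_commute)
  ultimately show ?thesis using c by simp
qed

text \<open>By Abel summation \<open>0 = \<Sum>(l i - \<nu> i)(l i + \<nu> i)\<close> is a combination of the nonnegative partial sums of
\<open>l - \<nu>\<close> with the strictly positive weights \<open>g i - g (i + 1)\<close>, where \<open>g = l + \<nu>\<close>. Hence the partial sums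
vanish.\<close>

lemma equal_if_dominated_on_sphere:
  fixes l \<nu> :: "nat \<Rightarrow> int"
  assumes decr: "\<And>i j. i < j \<Longrightarrow> j < n \<Longrightarrow> l j \<le> l i"
    and strict: "\<And>i j. i < j \<Longrightarrow> j < n \<Longrightarrow> \<nu> j < \<nu> i"
    and dominated: "\<And>k. k \<le> n \<Longrightarrow> (\<Sum>i<k. \<nu> i) \<le> (\<Sum>i<k. l i)"
    and total: "(\<Sum>i<n. \<nu> i) = (\<Sum>i<n. l i)"
    and sphere: "(\<Sum>i<n. (\<nu> i)\<^sup>2) = (\<Sum>i<n. (l i)\<^sup>2)"
    and "i < n"
  shows "\<nu> i = l i"
proof -
  define \<delta> where "\<delta> k = (\<Sum>i<k. l i - \<nu> i)" for k
  define g where "g i = l i + \<nu> i" for i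
  obtain m where m: "n = Suc m" using \<open>i < n\<close> by (cases n) auto
  have \<delta>_nonneg: "0 \<le> \<delta> k" if "k \<le> n" for k
    using dominated[OF that] by (simp add: \<delta>_def sum_subtractf)
  have \<delta>n: "\<delta> n = 0" using total by (simp add: \<delta>_def sum_subtractf)
  have abel: "(\<Sum>i<Suc m. (l i - \<nu> i) * g i) = \<delta> (Suc m) * g m + (\<Sum>i<m. \<delta> (Suc i) * (g i - g (Suc i)))" for m
    by (induction m) (simp_all add: \<delta>_def algebra_simps)
  have "(\<Sum>i<n. (l i - \<nu> i) * g i) = 0"
    using sphere by (simp add: g_def algebra_simps power2_eq_square sum.distrib sum_subtractf)
  then have "(\<Sum>i<m. \<delta> (Suc i) * (g i - g (Suc i))) = 0"
    using abel[of m] \<delta>n by (simp add: m)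
  moreover have g: "g (Suc i) < g i" if "i < m" for i
    using decr[of i "Suc i"] strict[of i "Suc i"] that by (simp add: g_def m)
  ultimately have "\<forall>i\<in>{..<m}. \<delta> (Suc i) * (g i - g (Suc i)) = 0"
    by (subst (asm) sum_nonneg_eq_0_iff) (use \<delta>_nonneg in \<open>auto simp: m less_imp_le[OF g] intro!: mult_nonneg_nonneg\<close>)
  then have "\<delta> (Suc i) = 0" if "i < m" for i using g[OF that] that by auto
  note inner = this
  have zero: "\<delta> k = 0" if "k \<le> n" for k
  proof (cases k)
    case 0
    then show ?thesis by (simp add: \<delta>_def)
  next
    case (Suc k')
    then show ?thesis using inner[of k'] \<delta>n that m by (cases "k' < m") auto
  qed
  show ?thesis using zero[of i] zero[of "Suc i"] \<open>i < n\<close> by (simp add: \<delta>_def)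
qed

section \<open>The Weyl character formula\<close>

lemma transpose_permutes: "i < n \<Longrightarrow> j < n \<Longrightarrow> Transposition.transpose i j permutes {..<(n::nat)}"
  by (rule permutes_swap_id) auto

lemma lookup_alternant_transpose:
  assumes ij: "i < n" "j < n" "i \<noteq> j"
  shows "coeff_at (alternant n l) (\<nu> \<circ> Transposition.transpose i j) =
    - coeff_at (alternant n l) \<nu>"
proof -
  let ?t = "Transposition.transpose i j"
  have t: "?t permutes {..<n}" using ij by (simp add: transpose_permutes)
  let ?f = "\<lambda>w. of_int (sign w) when l \<circ> w = \<nu> \<circ> ?t"
  have "coeff_at (alternant n l) (\<nu> \<circ> ?t) = (\<Sum>w | w permutes {..<n}. ?f w)"
    by (simp add: alternant_def lookup_sum lookup_single)
  also have "\<dots> = (\<Sum>w | w permutes {..<n}. ?f (w \<circ> ?t))"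
    by (rule sum_permutations_compose_right[OF t])
  also have "\<dots> = (\<Sum>w | w permutes {..<n}. - (of_int (sign w) when l \<circ> w = \<nu>))"
  proof (rule sum.cong[OF refl])
    fix w assume "w \<in> {w. w permutes {..<n}}"
    then have w: "permutation w" by (auto intro: permutation_permutes[THEN iffD2])
    have "sign (w \<circ> ?t) = - sign w"
      using sign_compose[OF w permutation_swap_id[of i j]] ij by (simp add: sign_swap_id)
    moreover have "l \<circ> (w \<circ> ?t) = \<nu> \<circ> ?t \<longleftrightarrow> l \<circ> w = \<nu>"
      by (metis comp_assoc comp_id transpose_comp_involutory)
    ultimately show "?f (w \<circ> ?t) = - (of_int (sign w) when l \<circ> w = \<nu>)"
      by (simp add: when_def)
  qed
  also have "\<dots> = - coeff_at (alternant n l) \<nu>"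
    by (simp add: alternant_def lookup_sum lookup_single sum_negf)
  finally show ?thesis .
qed

lemma strictly_decreasing_permutes_id:
  fixes l :: "nat \<Rightarrow> int"
  assumes strict: "\<And>i j. i < j \<Longrightarrow> j < n \<Longrightarrow> l j < l i"
    and w: "w permutes {..<n}" and eq: "\<And>i. i < n \<Longrightarrow> l (w i) = l i"
  shows "w = id"
proof (rule ext)
  fix i
  show "w i = id i"
  proof (cases "i < n")
    case True
    then have "w i < n" using permutes_in_image[OF w, of i] by simp
    then show ?thesis using strict[of i "w i"] strict[of "w i" i] eq[OF True] True
      by (cases "w i" i rule: linorder_cases) auto
  next
    case False
    then show ?thesis using permutes_not_in[OF w, of i] by simp
  qed
qed

lemma partial_sums_determine:
  fixes f g :: "nat \<Rightarrow> int"
  assumes "\<And>k. k \<le> n \<Longrightarrow> (\<Sum>i<k. f i) = (\<Sum>i<k. g i)" and "i < n"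
  shows "f i = g i"
  using assms(1)[of i] assms(1)[of "Suc i"] assms(2) by simp

lemma lookup_alternant_self:
  assumes strict: "\<And>i j. i < j \<Longrightarrow> j < n \<Longrightarrow> l j < l i"
  shows "coeff_at (alternant n l) l = 1"
proof -
  have "coeff_at (alternant n l) l =
      (\<Sum>w | w permutes {..<n}. of_int (sign w) when l \<circ> w = l)"
    by (simp add: alternant_def lookup_sum lookup_single)
  also have "\<dots> = (\<Sum>w | w permutes {..<n}. if w = id then 1 else 0)"
  proof (rule sum.cong[OF refl])
    fix w assume "w \<in> {w. w permutes {..<n}}"
    moreover have "w = id" if "l \<circ> w = l" "w permutes {..<n}"
      by (rule strictly_decreasing_permutes_id[of n l w, OF strict that(2)])
        (use fun_cong[OF that(1)] in simp_all)
    ultimately show "(of_int (sign w) when l \<circ> w = l) = (if w = id then 1 else 0)"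
      by (auto simp: when_def sign_id)
  qed
  also have "\<dots> = 1" by (simp add: sum.delta finite_permutations permutes_id)
  finally show ?thesis .
qed

text \<open>A functional with strictly decreasing coefficients: it grows when two entries are exchanged into
decreasing order, and drops under every lowering operator.\<close>

definition height :: "nat \<Rightarrow> (nat \<Rightarrow> int) \<Rightarrow> int" where
  "height n \<mu> = (\<Sum>i<n. (int n - int i) * \<mu> i)"

lemma height_transpose:
  assumes "i < n" "j < n" "i \<noteq> j"
  shows "height n (\<nu> \<circ> Transposition.transpose i j) = height n \<nu> + (\<nu> j - \<nu> i) * (int j - int i)"
proof -
  have s: "(\<Sum>k<n. f k * unit_weight m k) = f m" if "m < n" for f m
    using that by (simp add: unit_weight_def if_distrib sum.delta cong: if_cong)
  have "height n (\<nu> \<circ> Transposition.transpose i j) = height n \<nu> + (\<nu> j - \<nu> i) *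
      ((\<Sum>k<n. (int n - int k) * unit_weight i k) - (\<Sum>k<n. (int n - int k) * unit_weight j k))"
    unfolding transpose_eq_line[OF assms(3)] height_def
    by (simp add: algebra_simps sum.distrib sum_distrib_left sum_subtractf)
  then show ?thesis using assms by (simp add: s)
qed

text \<open>The difference \<open>\<phi>\<close> of the two sides is antisymmetric, lives on the sphere through \<open>l\<close>, and all its
exponents are dominated by \<open>l\<close>. If it were nonzero, an exponent of maximal height would be strictly
decreasing by antisymmetry, hence equal to \<open>l\<close>. But the coefficient of \<open>l\<close> is \<open>1\<close> on both sides,
because the highest weight has multiplicity one.\<close>

theorem weyl_character_formula:
  fixes wt :: "'a \<Rightarrow> nat \<Rightarrow> int"
  assumes I: "finite I" and a0: "a0 \<in> I"
    and wt_support: "\<And>a k. a \<in> I \<Longrightarrow> n \<le> k \<Longrightarrow> wt a k = 0"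
    and strict: "\<And>i j. i < j \<Longrightarrow> j < n \<Longrightarrow> l j < l i"
    and l_support: "\<And>k. n \<le> k \<Longrightarrow> l k = 0"
    and top: "wt a0 = l - staircase n" and top_unique: "\<And>a. a \<in> I \<Longrightarrow> wt a = l - staircase n \<Longrightarrow> a = a0"
    and dominated: "\<And>a k. a \<in> I \<Longrightarrow> k \<le> n \<Longrightarrow> (\<Sum>i<k. wt a i) \<le> (\<Sum>i<k. l i - staircase n i)"
    and total: "\<And>a. a \<in> I \<Longrightarrow> (\<Sum>i<n. wt a i) = (\<Sum>i<n. l i - staircase n i)"
    and sphere: "laplace n (weyl_denominator n * (\<Sum>a\<in>I. monomial (wt a) 1)) =
      monomial 0 (of_int (\<Sum>k<n. (l k)\<^sup>2)) * (weyl_denominator n * (\<Sum>a\<in>I. monomial (wt a) 1))"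
  shows "weyl_denominator n * (\<Sum>a\<in>I. monomial (wt a) 1) = alternant n l"
proof (rule ccontr)
  define \<chi> :: laurent where "\<chi> = (\<Sum>a\<in>I. monomial (wt a) 1)"
  define \<psi> where "\<psi> = weyl_denominator n * \<chi>"
  define \<phi> where "\<phi> = \<psi> - alternant n l"
  assume "weyl_denominator n * (\<Sum>a\<in>I. monomial (wt a) 1) \<noteq> alternant n l"
  then have "\<phi> \<noteq> 0" by (simp add: \<phi>_def \<psi>_def \<chi>_def)
  have \<psi>_sum: "\<psi> = (\<Sum>w | w permutes {..<n}. \<Sum>a\<in>I.
      monomial ((staircase n \<circ> w) + wt a) (of_int (sign w)))"
    unfolding \<psi>_def \<chi>_def weyl_denominator_eq_alternant alternant_def
    by (simp add: sum_distrib_left sum_distrib_right mult_single) (rule sum.swap)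
  have stair_decr: "staircase n j \<le> staircase n i" if "i < j" "j < n" for i j
    using that by (simp add: staircase_def)
  have l_decr: "l j \<le> l i" if "i < j" "j < n" for i j
    using strict[OF that] by simp
  have stair_partial: "(\<Sum>i<k. staircase n (w i)) \<le> (\<Sum>i<k. staircase n i)" if "w permutes {..<n}" "k \<le> n" for w k
    by (rule permuted_partial_sum_le[OF _ that]) (rule stair_decr)
  have l_partial: "(\<Sum>i<k. l (w i)) \<le> (\<Sum>i<k. l i)" if "w permutes {..<n}" "k \<le> n" for w k
    by (rule permuted_partial_sum_le[OF _ that]) (rule l_decr)
  \<comment> \<open>The eigenvalue equation confines the exponents of \<psi> to the sphere; antisymmetry then follows
    from divisibility by each linear factor.\<close>
  have \<psi>_sphere: "(\<Sum>k<n. (\<nu> k)\<^sup>2) = (\<Sum>k<n. (l k)\<^sup>2)" if "coeff_at \<psi> \<nu> \<noteq> 0" for \<nu>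
  proof -
    have "of_int (\<Sum>k<n. (\<nu> k)\<^sup>2) * coeff_at \<psi> \<nu> = of_int (\<Sum>k<n. (l k)\<^sup>2) * coeff_at \<psi> \<nu>"
      using arg_cong[OF sphere, of "\<lambda>p. coeff_at p \<nu>"]
      unfolding \<chi>_def[symmetric] \<psi>_def[symmetric] lookup_laplace lookup_single_mult by simp
    then show ?thesis using that by (simp del: of_int_sum)
  qed
  have \<psi>_antisym: "coeff_at \<psi> (\<nu> \<circ> Transposition.transpose i j) = - coeff_at \<psi> \<nu>"
    if "i < j" "j < n" for i j \<nu>
  proof (rule antisymmetric_if_divisible_on_sphere[OF _ _ _ _ \<psi>_sphere])
    have "(i, j) \<in> pairs n" using that by (simp add: pairs_def)
    then show "\<psi> = (X i - X j) * ((\<Prod>(i, j)\<in>pairs n - {(i, j)}. X i - X j) * \<chi>)"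
      unfolding \<psi>_def weyl_denominator_def by (subst prod.remove) (auto simp: mult.assoc)
  qed (use that in auto)
  have \<phi>_antisym: "coeff_at \<phi> (\<nu> \<circ> Transposition.transpose i j) = - coeff_at \<phi> \<nu>"
    if "i < j" "j < n" for i j \<nu>
    using \<psi>_antisym[OF that] lookup_alternant_transpose[of i n j l] that
    by (simp add: \<phi>_def lookup_minus)
  have perm_total: "(\<Sum>i<n. f (w i)) = (\<Sum>i<n. f i)" if "w permutes {..<n}" for w and f :: "nat \<Rightarrow> int"
    using sum.permute[OF that, of f] by (simp add: comp_def)
  \<comment> \<open>An exponent of \<psi> is a weight plus a permuted staircase, and both are dominated by their
    decreasing representatives.\<close>
  have \<phi>_keys: "(\<Sum>k<n. (\<nu> k)\<^sup>2) = (\<Sum>k<n. (l k)\<^sup>2) \<and> (\<forall>k\<le>n. (\<Sum>i<k. \<nu> i) \<le> (\<Sum>i<k. l i)) \<and>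
      (\<Sum>i<n. \<nu> i) = (\<Sum>i<n. l i) \<and> (\<forall>k\<ge>n. \<nu> k = 0)" if "coeff_at \<phi> \<nu> \<noteq> 0" for \<nu>
  proof (cases "coeff_at \<psi> \<nu> = 0")
    case False
    have "(\<Sum>w | w permutes {..<n}. \<Sum>a\<in>I. of_int (sign w) when (staircase n \<circ> w) + wt a = \<nu>) \<noteq> (0::complex)"
      using False by (simp add: \<psi>_sum lookup_sum lookup_single)
    then obtain w where w': "w \<in> {w. w permutes {..<n}}"
      and "(\<Sum>a\<in>I. of_int (sign w) when (staircase n \<circ> w) + wt a = \<nu>) \<noteq> (0::complex)"
      by (rule sum.not_neutral_contains_not_neutral)
    from this(2) obtain a where a: "a \<in> I" and "(of_int (sign w) when (staircase n \<circ> w) + wt a = \<nu>) \<noteq> (0::complex)"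
      by (rule sum.not_neutral_contains_not_neutral)
    then have \<nu>: "\<nu> = (staircase n \<circ> w) + wt a" by (auto simp: when_def split: if_splits)
    from w' have w: "w permutes {..<n}" by simp
    have "(\<Sum>i<k. \<nu> i) \<le> (\<Sum>i<k. l i)" if "k \<le> n" for k
      using stair_partial[OF w that] dominated[OF a that]
      by (simp add: \<nu> sum.distrib sum_subtractf)
    moreover have "(\<Sum>i<n. \<nu> i) = (\<Sum>i<n. l i)"
      using total[OF a] perm_total[OF w] by (simp add: \<nu> sum.distrib sum_subtractf)
    moreover have "\<nu> k = 0" if "n \<le> k" for k
      using that wt_support[OF a that] permutes_not_in[OF w, of k] by (simp add: \<nu> staircase_def)
    ultimately show ?thesis using \<psi>_sphere[OF False] by blast
  next
    case True
    then have "(\<Sum>w | w permutes {..<n}. of_int (sign w) when l \<circ> w = \<nu>) \<noteq> (0::complex)"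
      using that by (simp add: \<phi>_def lookup_minus alternant_def lookup_sum lookup_single)
    then obtain w where w': "w \<in> {w. w permutes {..<n}}"
      and "(of_int (sign w) when l \<circ> w = \<nu>) \<noteq> (0::complex)"
      by (rule sum.not_neutral_contains_not_neutral)
    then have \<nu>: "\<nu> = l \<circ> w" by (auto simp: when_def split: if_splits)
    from w' have w: "w permutes {..<n}" by simp
    show ?thesis
      using l_partial[OF w] perm_total[OF w, of l] perm_total[OF w, of "\<lambda>k. (l k)\<^sup>2"]
        permutes_not_in[OF w] l_support
      by (simp add: \<nu>)
  qed
  have "Poly_Mapping.keys \<phi> \<noteq> {}" using \<open>\<phi> \<noteq> 0\<close> by simp
  then obtain \<nu> where \<nu>: "\<nu> \<in> Poly_Mapping.keys \<phi>"
    and \<nu>_max: "\<And>\<mu>. \<mu> \<in> Poly_Mapping.keys \<phi> \<Longrightarrow> height n \<mu> \<le> height n \<nu>"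
    using obtains_MAX[of "Poly_Mapping.keys \<phi>" "height n"] finite_keys
    by (metis Max_ge finite_imageI imageI)
  have \<nu>0: "coeff_at \<phi> \<nu> \<noteq> 0" using \<nu> by (simp add: in_keys_iff)
  have \<nu>_strict: "\<nu> j < \<nu> i" if ij: "i < j" "j < n" for i j
  proof (rule ccontr)
    assume "\<not> \<nu> j < \<nu> i"
    moreover have "\<nu> i \<noteq> \<nu> j"
    proof
      assume "\<nu> i = \<nu> j"
      then have "\<nu> \<circ> Transposition.transpose i j = \<nu>"
        by (auto simp: fun_eq_iff Transposition.transpose_def)
      then show False using \<phi>_antisym[OF ij, of \<nu>] \<nu>0 by simp
    qed
    moreover have "\<nu> \<circ> Transposition.transpose i j \<in> Poly_Mapping.keys \<phi>"
      using \<phi>_antisym[OF ij, of \<nu>] \<nu>0 by (simp add: in_keys_iff)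
    ultimately have "\<nu> i < \<nu> j" and "height n (\<nu> \<circ> Transposition.transpose i j) \<le> height n \<nu>"
      using \<nu>_max by auto
    moreover from this(1) have "0 < (\<nu> j - \<nu> i) * (int j - int i)"
      using ij by (intro mult_pos_pos) auto
    ultimately show False using height_transpose[of i n j \<nu>] ij by simp
  qed
  have "\<nu> = l"
  proof
    fix k
    show "\<nu> k = l k"
    proof (cases "k < n")
      case True
      then show ?thesis
        using equal_if_dominated_on_sphere[of n l \<nu> k] l_decr \<nu>_strict \<phi>_keys[OF \<nu>0] by blast
    qed (use \<phi>_keys[OF \<nu>0] l_support in auto)
  qed
  moreover have "coeff_at \<psi> l = 1"
  proof -
    have only: "w = id \<and> a = a0"
      if w: "w permutes {..<n}" and a: "a \<in> I" and eq: "(staircase n \<circ> w) + wt a = l" for w a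
    proof -
      have e: "(\<Sum>i<k. staircase n (w i)) + (\<Sum>i<k. wt a i) = (\<Sum>i<k. l i)" for k
        by (subst eq[symmetric]) (simp add: sum.distrib)
      have "(\<Sum>i<k. staircase n (w i)) = (\<Sum>i<k. staircase n i)" if "k \<le> n" for k
        using e[of k] stair_partial[OF w that] dominated[OF a that]
        by (simp add: sum_subtractf)
      then have "staircase n (w i) = staircase n i" if "i < n" for i
        using partial_sums_determine[of n "\<lambda>i. staircase n (w i)" "staircase n" i] that by blast
      then have w_id: "w = id"
        by (intro strictly_decreasing_permutes_id[of n "staircase n", OF _ w]) (auto simp: staircase_def)
      then have "wt a = l - staircase n" using eq by (simp flip: eq)
      then show ?thesis using w_id top_unique[OF a] by simp
    qed
    have "coeff_at \<psi> l =
        (\<Sum>w | w permutes {..<n}. \<Sum>a\<in>I. of_int (sign w) when (staircase n \<circ> w) + wt a = l)"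
      by (simp add: \<psi>_sum lookup_sum lookup_single)
    also have "\<dots> = (\<Sum>w | w permutes {..<n}. \<Sum>a\<in>I. if w = id \<and> a = a0 then 1 else 0)"
    proof (intro sum.cong refl)
      fix w a assume "w \<in> {w. w permutes {..<n}}" and "a \<in> I"
      then have "(staircase n \<circ> w) + wt a = l \<longleftrightarrow> w = id \<and> a = a0"
        using only[of w a] by (auto simp: top)
      then show "(of_int (sign w) when (staircase n \<circ> w) + wt a = l) = (if w = id \<and> a = a0 then 1 else (0::complex))"
        by (auto simp: when_def sign_id)
    qed
    also have "\<dots> = (\<Sum>w | w permutes {..<n}. if w = id then 1 else 0)"
      using I a0 by (intro sum.cong) (auto simp: sum.delta)
    also have "\<dots> = 1" by (simp add: sum.delta finite_permutations permutes_id)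
    finally show ?thesis .
  qed
  ultimately have "coeff_at \<phi> \<nu> = 0"
    using lookup_alternant_self[OF strict] by (simp add: \<phi>_def lookup_minus)
  then show False using \<nu>0 by simp
qed

section \<open>The Weyl dimension formula\<close>

lemma single_sum: "monomial k (sum f A) = (\<Sum>a\<in>A. monomial k (f a))"
  by (induction A rule: infinite_finite_induct) (auto simp: single_add)

text \<open>An identity of Laurent polynomials may be evaluated under any assignment \<open>h\<close> of values to monomials.\<close>

lemma sum_single_eq_imp_sum_eq:
  fixes c :: "'a \<Rightarrow> 'r :: comm_ring_1" and h :: "'m \<Rightarrow> 'r"
  assumes fin: "finite A" "finite B"
    and eq: "(\<Sum>a\<in>A. monomial (\<mu> a) (c a)) = (\<Sum>b\<in>B. monomial (\<nu> b) (d b))"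
  shows "(\<Sum>a\<in>A. c a * h (\<mu> a)) = (\<Sum>b\<in>B. d b * h (\<nu> b))"
proof -
  define K where "K = \<mu> ` A \<union> \<nu> ` B"
  have K: "finite K" using fin by (simp add: K_def)
  have expand: "(\<Sum>a\<in>C. e a * h (\<kappa> a)) =
      (\<Sum>k\<in>K. coeff_at (\<Sum>a\<in>C. monomial (\<kappa> a) (e a)) k * h k)"
    if "\<kappa> ` C \<subseteq> K" for C :: "'c set" and e :: "'c \<Rightarrow> 'r" and \<kappa>
  proof -
    have "(\<Sum>k\<in>K. coeff_at (\<Sum>a\<in>C. monomial (\<kappa> a) (e a)) k * h k) =
        (\<Sum>a\<in>C. \<Sum>k\<in>K. (if k = \<kappa> a then e a * h k else 0))"
      unfolding lookup_sum lookup_single sum_distrib_right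
      by (subst sum.swap) (auto simp: when_def intro!: sum.cong)
    also have "\<dots> = (\<Sum>a\<in>C. e a * h (\<kappa> a))"
      using that by (intro sum.cong) (auto simp: K sum.delta)
    finally show ?thesis by simp
  qed
  show ?thesis
    using expand[of \<mu> A c] expand[of \<nu> B d] by (simp add: K_def eq)
qed

text \<open>This is the Vandermonde identity at \<open>y i = exp (t x\<^sub>i)\<close>; passing to inverse permutations moves the
permutation from \<open>x\<close> to the staircase.\<close>

lemma alternating_exponential_sum:
  fixes x :: "nat \<Rightarrow> int" and t :: complex
  shows "(\<Sum>w | w permutes {..<n}. of_int (sign w) * exp (t * of_int (\<Sum>i<n. x (w i) * staircase n i))) =
    (\<Prod>(i, j)\<in>pairs n. exp (t * of_int (x i)) - exp (t * of_int (x j)))"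
proof -
  have "(\<Sum>w | w permutes {..<n}. of_int (sign w) * exp (t * of_int (\<Sum>i<n. x (w i) * staircase n i))) =
      (\<Sum>w | w permutes {..<n}. of_int (sign (inv_into UNIV w)) * exp (t * of_int (\<Sum>i<n. x (inv_into UNIV w i) * staircase n i)))"
    by (rule sum_permutations_inverse)
  also have "\<dots> = (\<Sum>w | w permutes {..<n}. of_int (sign w) * (\<Prod>i<n. exp (t * of_int (x i)) ^ (n - 1 - w i)))"
  proof (rule sum.cong[OF refl])
    fix w assume "w \<in> {w. w permutes {..<n}}"
    then have w: "w permutes {..<n}" by simp
    have "(\<Sum>i<n. x (inv_into UNIV w i) * staircase n i) = (\<Sum>i<n. x i * staircase n (w i))"
      using sum.permute[OF w, of "\<lambda>i. x (inv_into UNIV w i) * staircase n i"]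
      by (simp add: comp_def permutes_inverses[OF w])
    also have "\<dots> = (\<Sum>i<n. x i * int (n - 1 - w i))"
      using permutes_in_image[OF w] by (intro sum.cong) (auto simp: staircase_def)
    finally have "exp (t * of_int (\<Sum>i<n. x (inv_into UNIV w i) * staircase n i)) =
        exp (\<Sum>i<n. of_nat (n - 1 - w i) * (t * of_int (x i)))"
      by (simp add: sum_distrib_left mult_ac del: of_nat_diff)
    also have "\<dots> = (\<Prod>i<n. exp (t * of_int (x i)) ^ (n - 1 - w i))"
      by (simp add: exp_sum exp_of_nat_mult)
    finally show "of_int (sign (inv_into UNIV w)) * exp (t * of_int (\<Sum>i<n. x (inv_into UNIV w i) * staircase n i)) =
        of_int (sign w) * (\<Prod>i<n. exp (t * of_int (x i)) ^ (n - 1 - w i))"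
      using w by (simp add: sign_inverse permutation_permutes[THEN iffD2, OF exI[of _ "{..<n}"]])
  qed
  also have "\<dots> = (\<Prod>(i, j)\<in>pairs n. exp (t * of_int (x i)) - exp (t * of_int (x j)))"
    unfolding vandermonde_permutation_sum pairs_Sigma by (subst prod.Sigma) auto
  finally show ?thesis .
qed

lemma exp_difference_quotient:
  fixes a b :: complex
  shows "((\<lambda>t. (exp (t * a) - exp (t * b)) / t) \<longlongrightarrow> a - b) (at 0)"
proof -
  have "((\<lambda>t. exp (t * a) - exp (t * b)) has_field_derivative (a - b)) (at 0)"
    by (auto intro!: derivative_eq_intros)
  then show ?thesis by (simp add: DERIV_def)
qed

text \<open>Specialize the character formula to \<open>X i = exp (t (n - 1 - i))\<close>. Both alternating sums become
products of differences of exponentials; dividing by one \<open>t\<close> for each pair and letting \<open>t\<close> tend to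
\<open>0\<close> turns these into differences of exponents and the character into the dimension.\<close>

theorem weyl_dimension_formula:
  assumes I: "finite I"
    and char: "weyl_denominator n * (\<Sum>a\<in>I. monomial (wt a) 1) = alternant n l"
  shows "of_nat (card I) * (\<Prod>(i, j)\<in>pairs n. of_int (staircase n i - staircase n j)) =
    (\<Prod>(i, j)\<in>pairs n. of_int (l i - l j) :: complex)"
proof -
  define W where "W = {w. w permutes {..<n}}"
  have W: "finite W" by (simp add: W_def finite_permutations)
  define h :: "complex \<Rightarrow> (nat \<Rightarrow> int) \<Rightarrow> complex"
    where "h t \<mu> = exp (t * of_int (\<Sum>i<n. \<mu> i * staircase n i))" for t \<mu>
  define quot :: "(nat \<Rightarrow> int) \<Rightarrow> complex \<Rightarrow> complex"
    where "quot x t = (\<Prod>(i, j)\<in>pairs n. (exp (t * of_int (x i)) - exp (t * of_int (x j))) / t)" for x t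
  have quot_lim: "(quot x \<longlongrightarrow> (\<Prod>(i, j)\<in>pairs n. of_int (x i - x j))) (at 0)" for x
    unfolding quot_def case_prod_unfold of_int_diff
    by (intro tendsto_prod exp_difference_quotient)
  have specialized: "(\<Prod>(i, j)\<in>pairs n. exp (t * of_int (staircase n i)) - exp (t * of_int (staircase n j))) *
      (\<Sum>a\<in>I. h t (wt a)) = (\<Prod>(i, j)\<in>pairs n. exp (t * of_int (l i)) - exp (t * of_int (l j)))" for t
  proof -
    have "(\<Sum>(w, a)\<in>W \<times> I. monomial ((staircase n \<circ> w) + wt a) (of_int (sign w))) =
        (\<Sum>w\<in>W. monomial (l \<circ> w) (of_int (sign w) :: complex))"
      using char unfolding weyl_denominator_eq_alternant alternant_def W_def[symmetric]
      by (simp add: sum_product mult_single sum.cartesian_product)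
    then have "(\<Sum>p\<in>W \<times> I. of_int (sign (fst p)) * h t ((staircase n \<circ> fst p) + wt (snd p))) =
        (\<Sum>w\<in>W. of_int (sign w) * h t (l \<circ> w))"
      unfolding case_prod_unfold by (rule sum_single_eq_imp_sum_eq[rotated 2]) (simp_all add: W I)
    moreover have "h t ((staircase n \<circ> w) + wt a) = h t (staircase n \<circ> w) * h t (wt a)" for w a
      by (simp add: h_def algebra_simps sum.distrib flip: exp_add)
    ultimately have "(\<Sum>w\<in>W. of_int (sign w) * h t (staircase n \<circ> w)) * (\<Sum>a\<in>I. h t (wt a)) =
        (\<Sum>w\<in>W. of_int (sign w) * h t (l \<circ> w))"
      by (simp add: sum_product sum.cartesian_product case_prod_unfold mult.assoc)
    then show ?thesis
      unfolding h_def W_def using alternating_exponential_sum[where n = n and t = t] by (simp add: comp_def)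
  qed
  have "quot (staircase n) t * (\<Sum>a\<in>I. h t (wt a)) = quot l t" for t
    using specialized[of t]
    by (simp add: quot_def case_prod_unfold prod_dividef)
  moreover have "((\<lambda>t. quot (staircase n) t * (\<Sum>a\<in>I. h t (wt a))) \<longlongrightarrow>
      (\<Prod>(i, j)\<in>pairs n. of_int (staircase n i - staircase n j)) * of_nat (card I)) (at 0)"
  proof (intro tendsto_mult quot_lim)
    have "((\<lambda>t. \<Sum>a\<in>I. h t (wt a)) \<longlongrightarrow> (\<Sum>a\<in>I. h 0 (wt a))) (at 0)"
      unfolding h_def by (intro tendsto_intros)
    then show "((\<lambda>t. \<Sum>a\<in>I. h t (wt a)) \<longlongrightarrow> of_nat (card I)) (at 0)"
      by (simp add: h_def)
  qed
  ultimately have "(quot l \<longlongrightarrow>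
      (\<Prod>(i, j)\<in>pairs n. of_int (staircase n i - staircase n j)) * of_nat (card I)) (at 0)"
    by simp
  from tendsto_unique[OF _ this quot_lim[of l]] show ?thesis by (simp add: mult.commute)
qed

section \<open>Weight bases and the Casimir element\<close>

lemma sum_square_eq_diag_pairs:
  fixes f :: "nat \<Rightarrow> nat \<Rightarrow> 'a :: comm_monoid_add"
  shows "(\<Sum>i<n. \<Sum>j<n. f i j) = (\<Sum>i<n. f i i) + (\<Sum>(i, j)\<in>pairs n. f i j + f j i)"
proof (induction n)
  case 0
  show ?case by (simp add: pairs_def)
next
  case (Suc n)
  then show ?case by (simp add: sum_pairs_Suc sum.distrib ac_simps)
qed

text \<open>The elementary matrices act in a basis of weight vectors; \<open>x i j a b\<close> is the matrix entry of \<open>E\<^sub>i\<^sub>j\<close> in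
row \<open>a\<close> and column \<open>b\<close>. The Casimir element enters through its diagonal entries, which
determine its traces on the weight spaces.\<close>

locale gl_weight_matrices =
  fixes n :: nat and I :: "'a set" and x :: "nat \<Rightarrow> nat \<Rightarrow> 'a \<Rightarrow> 'a \<Rightarrow> complex"
    and wt :: "'a \<Rightarrow> nat \<Rightarrow> int" and c :: complex and s :: int
  assumes I: "finite I"
    and commutator: "\<And>i j k l a b. i < n \<Longrightarrow> j < n \<Longrightarrow> k < n \<Longrightarrow> l < n \<Longrightarrow> a \<in> I \<Longrightarrow> b \<in> I \<Longrightarrow>
      (\<Sum>d\<in>I. x i j a d * x k l d b) - (\<Sum>d\<in>I. x k l a d * x i j d b) =
      (if j = k then x i l a b else 0) - (if l = i then x k j a b else 0)"
    and diagonal: "\<And>i a b. i < n \<Longrightarrow> a \<in> I \<Longrightarrow> b \<in> I \<Longrightarrow>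
      x i i a b = (if a = b then of_int (wt a i) else 0)"
    and wt_support: "\<And>a k. a \<in> I \<Longrightarrow> n \<le> k \<Longrightarrow> wt a k = 0"
    and wt_total: "\<And>a. a \<in> I \<Longrightarrow> (\<Sum>i<n. wt a i) = s"
    and casimir: "\<And>a. a \<in> I \<Longrightarrow> (\<Sum>i<n. \<Sum>j<n. \<Sum>b\<in>I. x i j a b * x j i b a) = c"
begin

definition character :: laurent where
  "character = (\<Sum>a\<in>I. monomial (wt a) 1)"

text \<open>The generating series of the traces of \<open>E\<^sub>j\<^sub>i E\<^sub>i\<^sub>j\<close> on the weight spaces.\<close>

definition trace_series :: "nat \<Rightarrow> nat \<Rightarrow> laurent" where
  "trace_series i j = (\<Sum>a\<in>I. monomial (wt a) (\<Sum>b\<in>I. x j i a b * x i j b a))"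

lemma weight_shift:
  assumes ij: "i < n" "j < n" and ab: "a \<in> I" "b \<in> I" and nz: "x i j a b \<noteq> 0"
  shows "wt a = (unit_weight i - unit_weight j) + wt b"
proof
  fix k
  show "wt a k = ((unit_weight i - unit_weight j) + wt b) k"
  proof (cases "k < n")
    case False
    then show ?thesis using ij ab by (simp add: wt_support unit_weight_def)
  next
    case True
    have "(\<Sum>d\<in>I. x k k a d * x i j d b) = (\<Sum>d\<in>I. if d = a then of_int (wt a k) * x i j a b else 0)"
      using diagonal[OF True] ab by (intro sum.cong) auto
    moreover have "(\<Sum>d\<in>I. x i j a d * x k k d b) = (\<Sum>d\<in>I. if d = b then x i j a b * of_int (wt b k) else 0)"
      using diagonal[OF True] ab by (intro sum.cong) auto
    ultimately have "of_int (wt a k) * x i j a b - x i j a b * of_int (wt b k) =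
        (if k = i then x k j a b else 0) - (if j = k then x i k a b else 0)"
      using commutator[OF True True ij ab] I ab by (simp add: sum.delta)
    also have "\<dots> = of_int (unit_weight i k - unit_weight j k) * x i j a b"
      by (auto simp: unit_weight_def)
    finally have "of_int (wt a k - wt b k) * x i j a b = of_int (unit_weight i k - unit_weight j k) * x i j a b"
      by (simp add: algebra_simps)
    then have "wt a k - wt b k = unit_weight i k - unit_weight j k"
      using nz by (simp del: of_int_diff)
    then show ?thesis by simp
  qed
qed

lemma euler_character: "euler k character = (\<Sum>a\<in>I. monomial (wt a) (of_int (wt a k)))"
  by (simp add: character_def euler_sum euler_single)

text \<open>Cyclicity of the trace: \<open>tr(E\<^sub>i\<^sub>j E\<^sub>j\<^sub>i | V\<^sub>\<mu>) = tr(E\<^sub>j\<^sub>i E\<^sub>i\<^sub>j | V\<^sub>\<nu>)\<close> for \<open>\<nu> = \<mu> - e\<^sub>i + e\<^sub>j\<close>.\<close>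

lemma trace_series_swap:
  assumes ij: "i < n" "j < n"
  shows "X j * trace_series j i = X i * trace_series i j"
proof -
  have "X j * trace_series j i =
      (\<Sum>a\<in>I. \<Sum>b\<in>I. monomial (unit_weight j + wt a) (x i j a b * x j i b a))"
    by (simp add: trace_series_def sum_distrib_left mult_single single_sum)
  also have "\<dots> = (\<Sum>a\<in>I. \<Sum>b\<in>I. monomial (unit_weight i + wt b) (x j i b a * x i j a b))"
  proof (intro sum.cong refl)
    fix a b assume "a \<in> I" "b \<in> I"
    then show "monomial (unit_weight j + wt a) (x i j a b * x j i b a) =
        monomial (unit_weight i + wt b) (x j i b a * x i j a b)"
      using weight_shift[OF ij, of a b] by (cases "x i j a b = 0") (auto simp: mult.commute)
  qed
  also have "\<dots> = (\<Sum>b\<in>I. \<Sum>a\<in>I. monomial (unit_weight i + wt b) (x j i b a * x i j a b))"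
    by (rule sum.swap)
  also have "\<dots> = X i * trace_series i j"
    by (simp add: trace_series_def sum_distrib_left mult_single single_sum)
  finally show ?thesis .
qed

lemma trace_series_commutator:
  assumes ij: "i < n" "j < n"
  shows "trace_series j i - trace_series i j = euler i character - euler j character"
  unfolding trace_series_def euler_character sum_subtractf[symmetric]
proof (rule sum.cong[OF refl])
  fix a assume a: "a \<in> I"
  show "monomial (wt a) (\<Sum>b\<in>I. x i j a b * x j i b a) -
      monomial (wt a) (\<Sum>b\<in>I. x j i a b * x i j b a) =
      monomial (wt a) (of_int (wt a i)) - monomial (wt a) (of_int (wt a j))"
    using commutator[OF ij ij(2,1) a a] diagonal[OF ij(1) a a] diagonal[OF ij(2) a a]
    by (simp flip: single_diff)
qed

text \<open>Taking the trace of the Casimir element on each weight space gives Freudenthal's recursion, here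
as an equation between generating series.\<close>

lemma casimir_character:
  "monomial 0 c * character = laplace n character +
    (\<Sum>(i, j)\<in>pairs n. euler i character - euler j character + 2 * trace_series i j)"
proof -
  have diag: "trace_series i i = euler i (euler i character)" if "i < n" for i
    unfolding trace_series_def euler_character euler_sum euler_single
  proof (rule sum.cong[OF refl])
    fix a assume a: "a \<in> I"
    have "(\<Sum>b\<in>I. x i i a b * x i i b a) = (\<Sum>b\<in>I. if b = a then of_int (wt a i) * of_int (wt a i) else 0)"
      using diagonal[OF that] a by (intro sum.cong) auto
    also have "\<dots> = of_int (wt a i) * of_int (wt a i)" using a I by (simp add: sum.delta)
    finally show "monomial (wt a) (\<Sum>b\<in>I. x i i a b * x i i b a) =
        monomial (wt a) (of_int (wt a i) * of_int (wt a i))" by simp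
  qed
  have "monomial 0 c * character =
      (\<Sum>a\<in>I. monomial (wt a) (\<Sum>i<n. \<Sum>j<n. \<Sum>b\<in>I. x i j a b * x j i b a))"
    by (simp add: character_def sum_distrib_left mult_single casimir)
  also have "\<dots> = (\<Sum>i<n. \<Sum>j<n. trace_series j i)"
    unfolding trace_series_def single_sum
    by (subst sum.swap, intro sum.cong refl, subst sum.swap) simp
  also have "\<dots> = (\<Sum>i<n. trace_series i i) + (\<Sum>(i, j)\<in>pairs n. trace_series j i + trace_series i j)"
    by (rule sum_square_eq_diag_pairs)
  also have "(\<Sum>i<n. trace_series i i) = laplace n character"
    unfolding laplace_def by (intro sum.cong) (auto simp: diag)
  also have "(\<Sum>(i, j)\<in>pairs n. trace_series j i + trace_series i j) =
      (\<Sum>(i, j)\<in>pairs n. euler i character - euler j character + 2 * trace_series i j)"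
  proof (intro sum.cong refl, clarify)
    fix i j assume "(i, j) \<in> pairs n"
    then have "trace_series j i = (euler i character - euler j character) + trace_series i j"
      using trace_series_commutator[of i j] by (simp add: pairs_def diff_eq_eq)
    then show "trace_series j i + trace_series i j = euler i character - euler j character + 2 * trace_series i j"
      by simp
  qed
  finally show ?thesis .
qed

lemma laplace_denominator_character:
  "laplace n (weyl_denominator n * character) =
    monomial 0 (of_int (\<Sum>k<n. (staircase n k)\<^sup>2) + c + (of_nat n - 1) * of_int s) *
      (weyl_denominator n * character)"
proof -
  have "(X i - X j) * trace_series i j = X j * (euler i character - euler j character)"
    if "(i, j) \<in> pairs n" for i j
  proof -
    have "i < n" "j < n" using that by (auto simp: pairs_def)
    then show ?thesis
      by (simp only: left_diff_distrib right_diff_distrib trace_series_swap[of i j, symmetric]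
          flip: trace_series_commutator)
  qed
  moreover have "(\<Sum>k<n. euler k character) = monomial 0 (of_int s) * character"
    unfolding euler_character unfolding character_def
    by (subst sum.swap) (simp add: sum_distrib_left mult_single wt_total
        flip: single_sum of_int_sum del: single_of_int)
  moreover have "(of_nat n - 1 :: laurent) = monomial 0 (of_nat n - 1)"
    by (simp add: single_diff)
  ultimately show ?thesis
    using laplace_denominator_times_character[of n trace_series character
        "monomial 0 c" "monomial 0 (of_int s)"] casimir_character
    by (simp only: mult_single single_add add_0_left)
qed

end

section \<open>Modules on spaces of functions\<close>

text \<open>All representation spaces below are spaces of complex-valued functions. They form vector spaces in
the sense of the locale \<open>vector_space\<close>, whose theory of bases and coordinates is thus at hand.\<close>

definition fscale :: "complex \<Rightarrow> ('a \<Rightarrow> complex) \<Rightarrow> 'a \<Rightarrow> complex" where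
  "fscale c f = (\<lambda>i. c * f i)"

global_interpretation fs: vector_space "fscale :: complex \<Rightarrow> ('a \<Rightarrow> complex) \<Rightarrow> 'a \<Rightarrow> complex"
  by standard (auto simp: fscale_def fun_eq_iff algebra_simps)

lemma fscale_apply: "fscale c f a = c * f a"
  by (simp add: fscale_def)

lemma sum_fun_apply: "(\<Sum>i\<in>S. F i) a = (\<Sum>i\<in>S. F i a :: complex)"
  by (induction S rule: infinite_finite_induct) auto

definition lin :: "(('a \<Rightarrow> complex) \<Rightarrow> ('b \<Rightarrow> complex)) \<Rightarrow> bool" where
  "lin E \<longleftrightarrow> (\<forall>f g. E (f + g) = E f + E g) \<and> (\<forall>c f. E (fscale c f) = fscale c (E f))"

lemma lin_add: "lin E \<Longrightarrow> E (f + g) = E f + E g"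
  and lin_scale: "lin E \<Longrightarrow> E (fscale c f) = fscale c (E f)"
  by (auto simp: lin_def)

lemma lin_zero: "lin E \<Longrightarrow> E 0 = 0"
  using lin_scale[of E 0 0] by simp

lemma lin_sum: "lin E \<Longrightarrow> E (\<Sum>a\<in>A. F a) = (\<Sum>a\<in>A. E (F a))"
  by (induction A rule: infinite_finite_induct) (auto simp: lin_zero lin_add)

lemma lin_span:
  assumes E: "lin E" and S: "\<And>f. f \<in> S \<Longrightarrow> E f \<in> fs.span T" and f: "f \<in> fs.span S"
  shows "E f \<in> fs.span T"
  using f
proof (induction rule: fs.span_induct_alt)
  case base
  show ?case unfolding lin_zero[OF E] by (rule fs.span_zero)
next
  case (step c x y)
  then show ?case
    unfolding lin_add[OF E] lin_scale[OF E] using S[of x] by (intro fs.span_add fs.span_scale) simp_all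
qed

text \<open>A \<open>gl\<^sub>n\<close>-module given by the action of the elementary matrices on a space of functions, without a
choice of basis.\<close>

locale gl_operators =
  fixes n :: nat and E :: "nat \<Rightarrow> nat \<Rightarrow> ('a \<Rightarrow> complex) \<Rightarrow> ('a \<Rightarrow> complex)" and V :: "('a \<Rightarrow> complex) set"
  assumes linear: "\<And>i j. i < n \<Longrightarrow> j < n \<Longrightarrow> lin (E i j)"
    and subspace: "fs.subspace V"
    and closed: "\<And>i j f. i < n \<Longrightarrow> j < n \<Longrightarrow> f \<in> V \<Longrightarrow> E i j f \<in> V"
    and commutator: "\<And>i j k l f. i < n \<Longrightarrow> j < n \<Longrightarrow> k < n \<Longrightarrow> l < n \<Longrightarrow> f \<in> V \<Longrightarrow>
      E i j (E k l f) - E k l (E i j f) = (if j = k then E i l f else 0) - (if l = i then E k j f else 0)"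
begin

definition highest_vector :: "(nat \<Rightarrow> int) \<Rightarrow> ('a \<Rightarrow> complex) \<Rightarrow> bool" where
  "highest_vector lam v \<longleftrightarrow> v \<in> V \<and> v \<noteq> 0 \<and> (\<forall>i j. i < j \<and> j < n \<longrightarrow> E i j v = 0) \<and>
    (\<forall>i<n. E i i v = fscale (of_int (lam i)) v)"

end

lemma matrix_unit_mult:
  assumes "i < n" "j < n" "k < n" "l < n"
  shows "matrix_unit n i j * matrix_unit n k l = (if j = k then matrix_unit n i l else 0\<^sub>m n n)"
proof (rule eq_matI)
  fix r s assume "r < dim_row (if j = k then matrix_unit n i l else 0\<^sub>m n n)"
    and "s < dim_col (if j = k then matrix_unit n i l else 0\<^sub>m n n)"
  then have rs: "r < n" "s < n" by (auto simp: matrix_unit_def split: if_splits)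
  have "(matrix_unit n i j * matrix_unit n k l) $$ (r, s) =
      (\<Sum>u<n. (if r = i \<and> u = j then 1 else 0) * (if u = k \<and> s = l then 1 else 0))"
    using rs by (simp add: matrix_unit_def scalar_prod_def atLeast0LessThan)
  also have "\<dots> = (\<Sum>u<n. if u = j then (if r = i \<and> j = k \<and> s = l then 1 else 0) else 0)"
    by (intro sum.cong) auto
  also have "\<dots> = (if r = i \<and> j = k \<and> s = l then 1 else 0)" using assms by simp
  finally show "(matrix_unit n i j * matrix_unit n k l) $$ (r, s) =
      (if j = k then matrix_unit n i l else 0\<^sub>m n n) $$ (r, s)"
    using rs by (auto simp: matrix_unit_def)
qed (auto simp: matrix_unit_def)

lemma matrix_unit_carrier [simp]: "matrix_unit n i j \<in> carrier_mat n n"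
  by (simp add: matrix_unit_def)

text \<open>Extending linearly from the elementary matrices, the bracket relation for arbitrary matrices is a
bilinear consequence of the one for elementary matrices.\<close>

lemma gl_rep_of_coefficients:
  fixes x :: "nat \<Rightarrow> nat \<Rightarrow> nat \<Rightarrow> nat \<Rightarrow> complex"
  assumes comm: "\<And>i j k l a b. i < n \<Longrightarrow> j < n \<Longrightarrow> k < n \<Longrightarrow> l < n \<Longrightarrow> a < d \<Longrightarrow> b < d \<Longrightarrow>
      (\<Sum>u<d. x i j a u * x k l u b) - (\<Sum>u<d. x k l a u * x i j u b) =
      (if j = k then x i l a b else 0) - (if l = i then x k j a b else 0)"
  obtains \<rho> where "gl_rep n d \<rho>"
    and "\<And>i j. i < n \<Longrightarrow> j < n \<Longrightarrow> \<rho> (matrix_unit n i j) = mat d d (\<lambda>(a, b). x i j a b)"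
proof
  let ?N = "{..<n} \<times> {..<n}"
  define \<rho> where "\<rho> Y = mat d d (\<lambda>(a, b). \<Sum>(i, j)\<in>?N. Y $$ (i, j) * x i j a b)" for Y :: "complex mat"
  have \<rho>_entry: "\<rho> Y $$ (a, b) = (\<Sum>(i, j)\<in>?N. Y $$ (i, j) * x i j a b)" if "a < d" "b < d" for Y a b
    using that by (simp add: \<rho>_def)
  have dim: "\<rho> Y \<in> carrier_mat d d" for Y by (simp add: \<rho>_def)
  have mult: "(\<rho> Y * \<rho> Z) $$ (a, b) =
      (\<Sum>(i, j)\<in>?N. \<Sum>(k, l)\<in>?N. Y $$ (i, j) * Z $$ (k, l) * (\<Sum>u<d. x i j a u * x k l u b))"
    if ab: "a < d" "b < d" for Y Z a b
  proof -
    have "(\<rho> Y * \<rho> Z) $$ (a, b) = (\<Sum>u<d. \<rho> Y $$ (a, u) * \<rho> Z $$ (u, b))"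
      using ab dim[of Y] dim[of Z] by (simp add: scalar_prod_def atLeast0LessThan)
    also have "\<dots> = (\<Sum>u<d. (\<Sum>p\<in>?N. Y $$ p * x (fst p) (snd p) a u) * (\<Sum>q\<in>?N. Z $$ q * x (fst q) (snd q) u b))"
      using ab by (intro sum.cong) (auto simp: \<rho>_entry case_prod_unfold)
    also have "\<dots> = (\<Sum>p\<in>?N. \<Sum>q\<in>?N. \<Sum>u<d. (Y $$ p * x (fst p) (snd p) a u) * (Z $$ q * x (fst q) (snd q) u b))"
      unfolding sum_product by (subst sum.swap, intro sum.cong refl, subst sum.swap) simp
    finally show ?thesis by (simp add: case_prod_unfold sum_distrib_left mult_ac)
  qed
  have pair: "(\<Sum>(k, l)\<in>?N. f k l) = (\<Sum>k<n. \<Sum>l<n. f k l)" for f :: "nat \<Rightarrow> nat \<Rightarrow> complex"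
    by (simp add: sum.cartesian_product)
  have bracket: "\<rho> (Y * Z - Z * Y) = \<rho> Y * \<rho> Z - \<rho> Z * \<rho> Y"
    if Y: "Y \<in> carrier_mat n n" and Z: "Z \<in> carrier_mat n n" for Y Z
  proof (rule eq_matI)
    fix a b assume "a < dim_row (\<rho> Y * \<rho> Z - \<rho> Z * \<rho> Y)" "b < dim_col (\<rho> Y * \<rho> Z - \<rho> Z * \<rho> Y)"
    then have ab: "a < d" "b < d" using dim[of Y] dim[of Z] by auto
    have "(\<rho> Y * \<rho> Z - \<rho> Z * \<rho> Y) $$ (a, b) =
        (\<Sum>(i, j)\<in>?N. \<Sum>(k, l)\<in>?N. Y $$ (i, j) * Z $$ (k, l) * (\<Sum>u<d. x i j a u * x k l u b)) -
        (\<Sum>(k, l)\<in>?N. \<Sum>(i, j)\<in>?N. Z $$ (k, l) * Y $$ (i, j) * (\<Sum>u<d. x k l a u * x i j u b))"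
      unfolding mult[OF ab, symmetric] using ab dim[of Y] dim[of Z] by simp
    also have "(\<Sum>(k, l)\<in>?N. \<Sum>(i, j)\<in>?N. Z $$ (k, l) * Y $$ (i, j) * (\<Sum>u<d. x k l a u * x i j u b)) =
        (\<Sum>(i, j)\<in>?N. \<Sum>(k, l)\<in>?N. Y $$ (i, j) * Z $$ (k, l) * (\<Sum>u<d. x k l a u * x i j u b))"
      unfolding case_prod_unfold by (subst sum.swap) (simp add: mult_ac)
    also have "(\<Sum>(i, j)\<in>?N. \<Sum>(k, l)\<in>?N. Y $$ (i, j) * Z $$ (k, l) * (\<Sum>u<d. x i j a u * x k l u b)) -
        (\<Sum>(i, j)\<in>?N. \<Sum>(k, l)\<in>?N. Y $$ (i, j) * Z $$ (k, l) * (\<Sum>u<d. x k l a u * x i j u b)) =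
        (\<Sum>(i, j)\<in>?N. \<Sum>(k, l)\<in>?N. Y $$ (i, j) * Z $$ (k, l) *
          ((if j = k then x i l a b else 0) - (if l = i then x k j a b else 0)))"
      unfolding sum_subtractf[symmetric] case_prod_unfold
      unfolding right_diff_distrib[symmetric]
      by (intro sum.cong refl arg_cong2[of _ _ _ _ "(*)"] comm ab) auto
    also have "\<dots> = (\<Sum>i<n. \<Sum>j<n. \<Sum>k<n. \<Sum>l<n. (if k = j then Y $$ (i, j) * Z $$ (k, l) * x i l a b else 0)) -
        (\<Sum>i<n. \<Sum>j<n. \<Sum>k<n. \<Sum>l<n. (if l = i then Y $$ (i, j) * Z $$ (k, l) * x k j a b else 0))"
      unfolding pair sum_subtractf[symmetric] by (intro sum.cong refl) (auto simp: right_diff_distrib)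
    also have "(\<Sum>i<n. \<Sum>j<n. \<Sum>k<n. \<Sum>l<n. (if k = j then Y $$ (i, j) * Z $$ (k, l) * x i l a b else 0)) =
        (\<Sum>i<n. \<Sum>l<n. (\<Sum>j<n. Y $$ (i, j) * Z $$ (j, l)) * x i l a b)"
    proof -
      have "(\<Sum>k<n. \<Sum>l<n. (if k = j then Y $$ (i, j) * Z $$ (k, l) * x i l a b else 0)) =
          (\<Sum>l<n. Y $$ (i, j) * Z $$ (j, l) * x i l a b)" if "j < n" for i j
        using that by (subst sum.swap) (simp add: sum.delta)
      then have "(\<Sum>i<n. \<Sum>j<n. \<Sum>k<n. \<Sum>l<n. (if k = j then Y $$ (i, j) * Z $$ (k, l) * x i l a b else 0)) =
          (\<Sum>i<n. \<Sum>j<n. \<Sum>l<n. Y $$ (i, j) * Z $$ (j, l) * x i l a b)"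
        by simp
      also have "\<dots> = (\<Sum>i<n. \<Sum>l<n. \<Sum>j<n. Y $$ (i, j) * Z $$ (j, l) * x i l a b)"
        by (rule sum.cong[OF refl], rule sum.swap)
      finally show ?thesis by (simp add: sum_distrib_right)
    qed
    also have "(\<Sum>i<n. \<Sum>j<n. \<Sum>k<n. \<Sum>l<n. (if l = i then Y $$ (i, j) * Z $$ (k, l) * x k j a b else 0)) =
        (\<Sum>k<n. \<Sum>j<n. (\<Sum>i<n. Z $$ (k, i) * Y $$ (i, j)) * x k j a b)"
    proof -
      have "(\<Sum>i<n. \<Sum>j<n. \<Sum>k<n. \<Sum>l<n. (if l = i then Y $$ (i, j) * Z $$ (k, l) * x k j a b else 0)) =
          (\<Sum>i<n. \<Sum>j<n. \<Sum>k<n. Z $$ (k, i) * Y $$ (i, j) * x k j a b)"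
        by (simp add: sum.delta mult_ac)
      also have "\<dots> = (\<Sum>i<n. \<Sum>k<n. \<Sum>j<n. Z $$ (k, i) * Y $$ (i, j) * x k j a b)"
        by (rule sum.cong[OF refl], rule sum.swap)
      also have "\<dots> = (\<Sum>k<n. \<Sum>i<n. \<Sum>j<n. Z $$ (k, i) * Y $$ (i, j) * x k j a b)"
        by (rule sum.swap)
      also have "\<dots> = (\<Sum>k<n. \<Sum>j<n. \<Sum>i<n. Z $$ (k, i) * Y $$ (i, j) * x k j a b)"
        by (rule sum.cong[OF refl], rule sum.swap)
      finally show ?thesis by (simp add: sum_distrib_right)
    qed
    also have "(\<Sum>i<n. \<Sum>l<n. (\<Sum>j<n. Y $$ (i, j) * Z $$ (j, l)) * x i l a b) -
        (\<Sum>k<n. \<Sum>j<n. (\<Sum>i<n. Z $$ (k, i) * Y $$ (i, j)) * x k j a b) = \<rho> (Y * Z - Z * Y) $$ (a, b)"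
      unfolding \<rho>_entry[OF ab] pair sum_subtractf[symmetric]
      using Y Z by (intro sum.cong refl) (auto simp: scalar_prod_def atLeast0LessThan left_diff_distrib)
    finally show "\<rho> (Y * Z - Z * Y) $$ (a, b) = (\<rho> Y * \<rho> Z - \<rho> Z * \<rho> Y) $$ (a, b)" by simp
  qed (simp_all add: \<rho>_def)
  show "gl_rep n d \<rho>"
    unfolding gl_rep_def
  proof (intro conjI ballI allI)
    fix Y Z :: "complex mat" assume YZ: "Y \<in> carrier_mat n n" "Z \<in> carrier_mat n n"
    have "(\<Sum>(i, j)\<in>?N. (Y + Z) $$ (i, j) * x i j a b) =
        (\<Sum>(i, j)\<in>?N. Y $$ (i, j) * x i j a b) + (\<Sum>(i, j)\<in>?N. Z $$ (i, j) * x i j a b)" for a b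
      unfolding sum.distrib[symmetric] using YZ by (intro sum.cong refl) (auto simp: distrib_right)
    then show "\<rho> (Y + Z) = \<rho> Y + \<rho> Z" unfolding \<rho>_def by (intro eq_matI) simp_all
  next
    fix Y :: "complex mat" and c assume Y: "Y \<in> carrier_mat n n"
    have "(\<Sum>(i, j)\<in>?N. (c \<cdot>\<^sub>m Y) $$ (i, j) * x i j a b) = c * (\<Sum>(i, j)\<in>?N. Y $$ (i, j) * x i j a b)" for a b
      unfolding sum_distrib_left using Y by (intro sum.cong refl) (auto simp: mult.assoc)
    then show "\<rho> (c \<cdot>\<^sub>m Y) = c \<cdot>\<^sub>m \<rho> Y" unfolding \<rho>_def by (intro eq_matI) simp_all
  qed (simp_all only: dim bracket)
  show "\<rho> (matrix_unit n i j) = mat d d (\<lambda>(a, b). x i j a b)" if "i < n" "j < n" for i j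
  proof (rule eq_matI)
    fix a b assume "a < dim_row (mat d d (\<lambda>(a, b). x i j a b))" "b < dim_col (mat d d (\<lambda>(a, b). x i j a b))"
    then have ab: "a < d" "b < d" by auto
    have "\<rho> (matrix_unit n i j) $$ (a, b) = (\<Sum>p\<in>?N. if p = (i, j) then x i j a b else 0)"
      unfolding \<rho>_entry[OF ab] by (intro sum.cong) (auto simp: matrix_unit_def split: if_splits)
    then show "\<rho> (matrix_unit n i j) $$ (a, b) = mat d d (\<lambda>(a, b). x i j a b) $$ (a, b)"
      using that ab by (simp add: sum.delta)
  qed (auto simp: \<rho>_def)
qed

section \<open>Submodules and quotients\<close>

lemma independent_expand:
  assumes "finite B" "fs.independent B" "f \<in> fs.span B"
  shows "f = (\<Sum>b\<in>B. fscale (fs.representation B f b) b)"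
  using fs.sum_representation_eq[OF assms(2,3,1)] by simp

lemma representation_zero_outside:
  assumes "fs.independent B" "B0 \<subseteq> B" "f \<in> fs.span B0" "a \<notin> B0"
  shows "fs.representation B f a = 0"
  using fs.representation_extend[OF assms(1,3,2)] fs.representation_ne_zero[of B0 f a] assms(4) by auto

context gl_operators begin

text \<open>The submodule spanned by \<open>B0\<close> contributes nothing to the coordinates outside \<open>B0\<close>, so those behave as
coordinates on the quotient.\<close>

lemma subquotient_coefficients:
  assumes B: "finite B" "fs.independent B" "fs.span B = V" and B0: "B0 \<subseteq> B"
    and B0_closed: "\<And>i j b. i < n \<Longrightarrow> j < n \<Longrightarrow> b \<in> B0 \<Longrightarrow> E i j b \<in> fs.span B0"
    and ij: "i < n" "j < n" and f: "f \<in> V" and a: "a \<in> B - B0"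
  shows "fs.representation B (E i j f) a =
    (\<Sum>b\<in>B - B0. fs.representation B (E i j b) a * fs.representation B f b)"
proof -
  have bV: "b \<in> V" if "b \<in> B" for b using that B(3) fs.span_base by blast
  have "E i j f = (\<Sum>b\<in>B. fscale (fs.representation B f b) (E i j b))"
    by (subst independent_expand[OF B(1,2), of f])
      (use f B(3) linear[OF ij] in \<open>auto simp: lin_sum lin_scale\<close>)
  then have "fs.representation B (E i j f) a =
      (\<Sum>b\<in>B. fs.representation B f b * fs.representation B (E i j b) a)"
  proof -
    have "E i j b \<in> fs.span B" if "b \<in> B" for b using closed[OF ij bV[OF that]] B(3) by simp
    then show ?thesis
      unfolding \<open>E i j f = _\<close> using B(2)
      by (subst fs.representation_sum) (auto intro!: fs.span_scale sum.cong simp: fs.representation_scale)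
  qed
  also have "\<dots> = (\<Sum>b\<in>B - B0. fs.representation B f b * fs.representation B (E i j b) a)"
  proof (rule sum.mono_neutral_right)
    show "\<forall>b\<in>B - (B - B0). fs.representation B f b * fs.representation B (E i j b) a = 0"
      using representation_zero_outside[OF B(2) B0] B0_closed[OF ij] a by auto
  qed (use B in auto)
  finally show ?thesis by (simp add: mult.commute)
qed

lemma subquotient_commutator:
  assumes B: "finite B" "fs.independent B" "fs.span B = V" and B0: "B0 \<subseteq> B"
    and B0_closed: "\<And>i j b. i < n \<Longrightarrow> j < n \<Longrightarrow> b \<in> B0 \<Longrightarrow> E i j b \<in> fs.span B0"
    and ijkl: "i < n" "j < n" "k < n" "l < n" and a: "a \<in> B - B0" and b: "b \<in> B - B0"
  shows "(\<Sum>u\<in>B - B0. fs.representation B (E i j u) a * fs.representation B (E k l b) u) -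
      (\<Sum>u\<in>B - B0. fs.representation B (E k l u) a * fs.representation B (E i j b) u) =
    (if j = k then fs.representation B (E i l b) a else 0) - (if l = i then fs.representation B (E k j b) a else 0)"
proof -
  have bV: "b \<in> V" using b B(3) fs.span_base by blast
  have span: "E p q b \<in> fs.span B" "E p q (E r s b) \<in> fs.span B"
    if "p < n" "q < n" "r < n" "s < n" for p q r s
    using that closed bV B(3) by auto
  have "fs.representation B (E i j (E k l b)) a - fs.representation B (E k l (E i j b)) a =
      fs.representation B (E i j (E k l b) - E k l (E i j b)) a"
    using B(2) span ijkl by (simp add: fs.representation_diff)
  also have "\<dots> = fs.representation B ((if j = k then E i l b else 0) - (if l = i then E k j b else 0)) a"
    using commutator[OF ijkl bV] by simp
  also have "\<dots> = (if j = k then fs.representation B (E i l b) a else 0) -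
      (if l = i then fs.representation B (E k j b) a else 0)"
    using B(2) span ijkl
    by (simp add: fs.representation_diff fs.representation_zero fs.representation_neg fs.span_zero)
  finally show ?thesis
    using subquotient_coefficients[OF B B0 B0_closed ijkl(1,2) closed[OF ijkl(3,4) bV] a]
      subquotient_coefficients[OF B B0 B0_closed ijkl(3,4) closed[OF ijkl(1,2) bV] a]
    by simp
qed

text \<open>With \<open>B0 = {}\<close> this passes from operators to matrices; for a proper submodule it gives the quotient
module. Both are needed to cut a module down to a simple one.\<close>

lemma gl_rep_of_subquotient:
  assumes B: "finite B" "fs.independent B" "fs.span B = V" and B0: "B0 \<subseteq> B"
    and B0_closed: "\<And>i j b. i < n \<Longrightarrow> j < n \<Longrightarrow> b \<in> B0 \<Longrightarrow> E i j b \<in> fs.span B0"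
    and v: "highest_vector (\<lambda>i. int (part p (i + 1))) v" "v \<notin> fs.span B0"
  shows "\<exists>\<rho>. gl_rep n (card (B - B0)) \<rho> \<and> has_highest_weight n (card (B - B0)) \<rho> p"
proof -
  let ?J = "B - B0" and ?d = "card (B - B0)"
  obtain e where e: "bij_betw e {..<?d} ?J"
    using ex_bij_betw_nat_finite[of ?J] B(1) by (auto simp: atLeast0LessThan)
  then have eJ: "e r \<in> ?J" if "r < ?d" for r using that by (auto simp: bij_betw_def)
  define x where "x i j r s = fs.representation B (E i j (e s)) (e r)" for i j r s
  have reindex: "(\<Sum>u<?d. g (e u)) = (\<Sum>u\<in>?J. g u)" for g :: "('a \<Rightarrow> complex) \<Rightarrow> complex"
    using sum.reindex_bij_betw[OF e] by simp
  have comm: "(\<Sum>u<?d. x i j r u * x k l u s) - (\<Sum>u<?d. x k l r u * x i j u s) =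
      (if j = k then x i l r s else 0) - (if l = i then x k j r s else 0)"
    if ijkl: "i < n" "j < n" "k < n" "l < n" and rs: "r < ?d" "s < ?d" for i j k l r s
  proof -
    show "(\<Sum>u<?d. x i j r u * x k l u s) - (\<Sum>u<?d. x k l r u * x i j u s) =
        (if j = k then x i l r s else 0) - (if l = i then x k j r s else 0)"
      using subquotient_commutator[OF B B0 B0_closed ijkl eJ[OF rs(1)] eJ[OF rs(2)]]
      unfolding x_def reindex[of "\<lambda>u. fs.representation B (E i j u) (e r) * fs.representation B (E k l (e s)) u"]
        reindex[of "\<lambda>u. fs.representation B (E k l u) (e r) * fs.representation B (E i j (e s)) u"] .
  qed
  obtain \<rho> where \<rho>: "gl_rep n ?d \<rho>"
    and \<rho>_unit: "\<And>i j. i < n \<Longrightarrow> j < n \<Longrightarrow> \<rho> (matrix_unit n i j) = mat ?d ?d (\<lambda>(r, s). x i j r s)"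
    by (rule gl_rep_of_coefficients[OF comm]) (assumption+, rule that, assumption+)
  define u where "u = vec ?d (\<lambda>r. fs.representation B v (e r))"
  have vV: "v \<in> V" using v by (simp add: highest_vector_def)
  have act: "\<rho> (matrix_unit n i j) *\<^sub>v u = vec ?d (\<lambda>r. fs.representation B (E i j v) (e r))"
    if ij: "i < n" "j < n" for i j
  proof (rule eq_vecI)
    fix r assume "r < dim_vec (vec ?d (\<lambda>r. fs.representation B (E i j v) (e r)))"
    then have r: "r < ?d" by simp
    show "(\<rho> (matrix_unit n i j) *\<^sub>v u) $ r = vec ?d (\<lambda>r. fs.representation B (E i j v) (e r)) $ r"
      using r subquotient_coefficients[OF B B0 B0_closed ij vV eJ[OF r]]
        reindex[of "\<lambda>b. fs.representation B (E i j b) (e r) * fs.representation B v b"]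
      by (simp add: \<rho>_unit[OF ij] u_def x_def scalar_prod_def atLeast0LessThan)
  qed (simp add: \<rho>_unit[OF ij])
  have "has_highest_weight n ?d \<rho> p"
    unfolding has_highest_weight_def
  proof (intro bexI[of _ u] conjI allI impI)
    show "u \<in> carrier_vec ?d" by (simp add: u_def)
    show "u \<noteq> 0\<^sub>v ?d"
    proof
      assume u0: "u = 0\<^sub>v ?d"
      have "fs.representation B v (e r) = u $ r" if "r < ?d" for r
        using that by (simp add: u_def)
      then have "fs.representation B v (e r) = 0" if "r < ?d" for r
        using that by (simp add: u0)
      then have zero: "fs.representation B v b = 0" if "b \<in> ?J" for b
        using that e by (force simp: bij_betw_def image_iff)
      have "v = (\<Sum>b\<in>B. fscale (fs.representation B v b) b)"
        by (rule independent_expand[OF B(1,2)]) (use vV B in simp)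
      also have "\<dots> = (\<Sum>b\<in>B0. fscale (fs.representation B v b) b)"
        by (rule sum.mono_neutral_right) (use B B0 zero in auto)
      also have "\<dots> \<in> fs.span B0"
        by (intro fs.span_sum fs.span_scale fs.span_base)
      finally show False using v by simp
    qed
  next
    fix i j assume "i < j \<and> j < n"
    then show "\<rho> (matrix_unit n i j) *\<^sub>v u = 0\<^sub>v ?d"
      using act[of i j] v by (auto simp: highest_vector_def fs.representation_zero)
  next
    fix i assume "i < n"
    then show "\<rho> (matrix_unit n i i) *\<^sub>v u = of_nat (part p (i + 1)) \<cdot>\<^sub>v u"
      using act[of i i] v vV B by (auto simp: highest_vector_def u_def fs.representation_scale)
  qed
  with \<rho> show ?thesis by blast
qed

end

text \<open>The function model of \<open>\<complex>\<^sup>d\<close>, in which vectors of a fixed length form a subspace of one type.\<close>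

definition finite_functions :: "nat \<Rightarrow> (nat \<Rightarrow> complex) set" where
  "finite_functions d = {f. \<forall>a\<ge>d. f a = 0}"

definition matrix_operator :: "nat \<Rightarrow> complex mat \<Rightarrow> (nat \<Rightarrow> complex) \<Rightarrow> nat \<Rightarrow> complex" where
  "matrix_operator d M f = (\<lambda>a. if a < d then \<Sum>b<d. M $$ (a, b) * f b else 0)"

lemma subspace_finite_functions: "fs.subspace (finite_functions d)"
  by (auto simp: fs.subspace_def finite_functions_def fscale_apply)

lemma delta_basis:
  fixes A :: "'a set"
  assumes "finite A"
  defines "\<delta> \<equiv> \<lambda>a b. if b = a then 1 else (0::complex)"
  shows "fs.independent (\<delta> ` A)" "fs.span (\<delta> ` A) = {f. \<forall>a. a \<notin> A \<longrightarrow> f a = 0}" "card (\<delta> ` A) = card A"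
proof -
  have inj: "inj_on \<delta> A"
  proof (rule inj_onI)
    fix a b assume "\<delta> a = \<delta> b"
    from fun_cong[OF this, of a] show "a = b" by (auto simp: \<delta>_def split: if_splits)
  qed
  then show "card (\<delta> ` A) = card A" by (rule card_image)
  have val: "(\<Sum>v\<in>\<delta> ` A. fscale (u v) v) a = (if a \<in> A then u (\<delta> a) else 0)" for u a
  proof -
    have "(\<Sum>v\<in>\<delta> ` A. fscale (u v) v) a = (\<Sum>b\<in>A. if b = a then u (\<delta> a) else 0)"
      unfolding sum_fun_apply sum.reindex[OF inj] comp_def
      by (intro sum.cong refl) (auto simp: fscale_apply \<delta>_def)
    then show ?thesis using assms(1) by (simp add: sum.delta)
  qed
  show "fs.independent (\<delta> ` A)"
  proof (rule fs.independent_if_scalars_zero)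
    fix u x assume zero: "(\<Sum>v\<in>\<delta> ` A. fscale (u v) v) = 0" and "x \<in> \<delta> ` A"
    then obtain a where "a \<in> A" "x = \<delta> a" by blast
    then show "u x = 0" using val[of u a] fun_cong[OF zero, of a] by simp
  qed (use assms in simp)
  show "fs.span (\<delta> ` A) = {f. \<forall>a. a \<notin> A \<longrightarrow> f a = 0}"
  proof (intro equalityI subsetI)
    fix f :: "'a \<Rightarrow> complex" assume "f \<in> fs.span (\<delta> ` A)"
    then obtain u where "f = (\<Sum>v\<in>\<delta> ` A. fscale (u v) v)"
      using fs.span_finite[of "\<delta> ` A"] assms(1) by auto
    then show "f \<in> {f. \<forall>a. a \<notin> A \<longrightarrow> f a = 0}" using val by simp
  next
    fix f :: "'a \<Rightarrow> complex" assume f: "f \<in> {f. \<forall>a. a \<notin> A \<longrightarrow> f a = 0}"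
    have "f = (\<Sum>v\<in>\<delta> ` A. fscale (f (the_inv_into A \<delta> v)) v)"
    proof
      fix a
      show "f a = (\<Sum>v\<in>\<delta> ` A. fscale (f (the_inv_into A \<delta> v)) v) a"
        unfolding val using f the_inv_into_f_f[OF inj, of a] by (cases "a \<in> A") auto
    qed
    also have "\<dots> \<in> fs.span (\<delta> ` A)"
      by (intro fs.span_sum fs.span_scale fs.span_base)
    finally show "f \<in> fs.span (\<delta> ` A)" .
  qed
qed

lemma dim_finite_functions: "fs.dim (finite_functions d) = d"
proof -
  have "finite_functions d = {f. \<forall>a. a \<notin> {..<d} \<longrightarrow> f a = 0}"
    by (auto simp: finite_functions_def not_less)
  then show ?thesis
    using fs.dim_span_eq_card_independent[OF delta_basis(1)[of "{..<d}"]] delta_basis(2,3)[of "{..<d}"] by simp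
qed

lemma finite_functions_basis:
  assumes "fs.independent B" "B \<subseteq> finite_functions d" "finite_functions d \<subseteq> fs.span B"
  shows "finite B" "card B = d" "fs.span B = finite_functions d"
proof -
  have e: "finite_functions d = {f. \<forall>a. a \<notin> {..<d} \<longrightarrow> f a = 0}"
    by (auto simp: finite_functions_def not_less)
  show "card B = d"
    using fs.basis_card_eq_dim[OF assms(2,3,1)] by (simp add: dim_finite_functions)
  show "finite B"
    using fs.independent_span_bound[OF _ assms(1), of "(\<lambda>a b. if b = a then 1 else 0) ` {..<d}"]
      assms(2) delta_basis(2)[of "{..<d}"] e by simp
  show "fs.span B = finite_functions d"
    using fs.span_minimal[OF assms(2) subspace_finite_functions] assms(3) by blast
qed

lemma vec_matrix_operator:
  "M \<in> carrier_mat d d \<Longrightarrow> vec d (matrix_operator d M f) = M *\<^sub>v vec d f"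
  by (intro eq_vecI) (auto simp: matrix_operator_def scalar_prod_def atLeast0LessThan)

lemma vec_inj_finite_functions:
  "f \<in> finite_functions d \<Longrightarrow> g \<in> finite_functions d \<Longrightarrow> vec d f = vec d g \<Longrightarrow> f = g"
proof
  fix a assume "f \<in> finite_functions d" "g \<in> finite_functions d" and e: "vec d f = vec d g"
  moreover have "f a = g a" if "a < d" using arg_cong[OF e, of "\<lambda>v. v $ a"] that by simp
  ultimately show "f a = g a" by (cases "a < d") (auto simp: finite_functions_def)
qed

lemma vec_surj_finite_functions:
  assumes "w \<in> carrier_vec d"
  shows "\<exists>f\<in>finite_functions d. vec d f = w"
  by (rule bexI[of _ "\<lambda>a. if a < d then w $ a else 0"]) (use assms in \<open>auto simp: finite_functions_def\<close>)

lemma lin_matrix_operator: "lin (matrix_operator d M)"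
  by (auto simp: lin_def matrix_operator_def fun_eq_iff fscale_apply sum.distrib sum_distrib_left algebra_simps)

lemma matrix_operator_mult:
  assumes "M \<in> carrier_mat d d" "N \<in> carrier_mat d d"
  shows "matrix_operator d M (matrix_operator d N f) = matrix_operator d (M * N) f"
proof
  fix a
  show "matrix_operator d M (matrix_operator d N f) a = matrix_operator d (M * N) f a"
  proof (cases "a < d")
    case True
    have "(\<Sum>b<d. M $$ (a, b) * (\<Sum>c<d. N $$ (b, c) * f c)) = (\<Sum>c<d. \<Sum>b<d. M $$ (a, b) * N $$ (b, c) * f c)"
      by (subst sum.swap) (simp add: sum_distrib_left mult.assoc)
    then show ?thesis using True assms
      by (simp add: matrix_operator_def scalar_prod_def atLeast0LessThan sum_distrib_right)
  qed (simp add: matrix_operator_def)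
qed

lemma gl_rep_zero: "gl_rep n d \<rho> \<Longrightarrow> \<rho> (0\<^sub>m n n) = 0\<^sub>m d d"
proof -
  assume \<rho>: "gl_rep n d \<rho>"
  have "0 \<cdot>\<^sub>m 0\<^sub>m n n = (0\<^sub>m n n :: complex mat)" by (rule eq_matI) auto
  moreover have "\<rho> (0 \<cdot>\<^sub>m 0\<^sub>m n n) = 0 \<cdot>\<^sub>m \<rho> (0\<^sub>m n n)" and c: "\<rho> (0\<^sub>m n n) \<in> carrier_mat d d"
    using \<rho> unfolding gl_rep_def by (blast intro: zero_carrier_mat)+
  moreover have "0 \<cdot>\<^sub>m \<rho> (0\<^sub>m n n) = 0\<^sub>m d d" using c by (intro eq_matI) auto
  ultimately show ?thesis by simp
qed

section \<open>Simple modules from modules of least dimension\<close>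

abbreviation unit_operator :: "nat \<Rightarrow> nat \<Rightarrow> (complex mat \<Rightarrow> complex mat) \<Rightarrow> nat \<Rightarrow> nat \<Rightarrow> (nat \<Rightarrow> complex) \<Rightarrow> nat \<Rightarrow> complex" where
  "unit_operator n d \<rho> i j \<equiv> matrix_operator d (\<rho> (matrix_unit n i j))"

lemma gl_operators_of_gl_rep:
  assumes \<rho>: "gl_rep n d \<rho>"
  shows "gl_operators n (unit_operator n d \<rho>) (finite_functions d)"
proof
  fix i j k l and f :: "nat \<Rightarrow> complex"
  assume ijkl: "i < n" "j < n" "k < n" "l < n"
  have car: "\<rho> X \<in> carrier_mat d d" if "X \<in> carrier_mat n n" for X
    using \<rho> that by (auto simp: gl_rep_def)
  have add: "\<rho> (X + Y) = \<rho> X + \<rho> Y" if "X \<in> carrier_mat n n" "Y \<in> carrier_mat n n" for X Y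
    using \<rho> that by (auto simp: gl_rep_def)
  have scale: "\<rho> (c \<cdot>\<^sub>m X) = c \<cdot>\<^sub>m \<rho> X" if "X \<in> carrier_mat n n" for c X
    using \<rho> that by (auto simp: gl_rep_def)
  have bracket: "\<rho> (X * Y - Y * X) = \<rho> X * \<rho> Y - \<rho> Y * \<rho> X" if "X \<in> carrier_mat n n" "Y \<in> carrier_mat n n" for X Y
    using \<rho> that by (auto simp: gl_rep_def)
  have op_diff: "matrix_operator d (M - N) f = matrix_operator d M f - matrix_operator d N f"
    if "M \<in> carrier_mat d d" "N \<in> carrier_mat d d" for M N
    using that by (auto simp: matrix_operator_def fun_eq_iff left_diff_distrib sum_subtractf)
  have op_zero: "matrix_operator d (0\<^sub>m d d) f = 0"
    by (auto simp: matrix_operator_def fun_eq_iff)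
  have diff: "\<rho> (X - Y) = \<rho> X - \<rho> Y" if X: "X \<in> carrier_mat n n" and Y: "Y \<in> carrier_mat n n" for X Y
  proof -
    have "X - Y = X + (-1) \<cdot>\<^sub>m Y" using X Y by (intro eq_matI) auto
    then have "\<rho> (X - Y) = \<rho> X + (-1) \<cdot>\<^sub>m \<rho> Y" using X Y by (simp add: add scale)
    also have "\<dots> = \<rho> X - \<rho> Y" using car[OF X] car[OF Y] by (intro eq_matI) auto
    finally show ?thesis .
  qed
  show "lin (unit_operator n d \<rho> i j)" by (rule lin_matrix_operator)
  show "unit_operator n d \<rho> i j f \<in> finite_functions d"
    by (simp add: matrix_operator_def finite_functions_def)
  let ?u = "matrix_unit n"
  have cu: "\<rho> (?u p q) \<in> carrier_mat d d" for p q by (rule car) simp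
  have "unit_operator n d \<rho> i j (unit_operator n d \<rho> k l f) - unit_operator n d \<rho> k l (unit_operator n d \<rho> i j f) =
      matrix_operator d (\<rho> (?u i j) * \<rho> (?u k l) - \<rho> (?u k l) * \<rho> (?u i j)) f"
    using cu by (simp add: matrix_operator_mult op_diff mult_carrier_mat[OF cu cu])
  also have "\<rho> (?u i j) * \<rho> (?u k l) - \<rho> (?u k l) * \<rho> (?u i j) =
      \<rho> ((if j = k then ?u i l else 0\<^sub>m n n) - (if l = i then ?u k j else 0\<^sub>m n n))"
    by (simp only: bracket[symmetric] matrix_unit_carrier matrix_unit_mult ijkl)
  also have "\<dots> = (if j = k then \<rho> (?u i l) else 0\<^sub>m d d) - (if l = i then \<rho> (?u k j) else 0\<^sub>m d d)"
    by (subst diff) (auto simp: gl_rep_zero[OF \<rho>])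
  also have "matrix_operator d \<dots> f =
      (if j = k then unit_operator n d \<rho> i l f else 0) - (if l = i then unit_operator n d \<rho> k j f else 0)"
    using cu by (subst op_diff) (auto simp: op_zero)
  finally show "unit_operator n d \<rho> i j (unit_operator n d \<rho> k l f) - unit_operator n d \<rho> k l (unit_operator n d \<rho> i j f) =
      (if j = k then unit_operator n d \<rho> i l f else 0) - (if l = i then unit_operator n d \<rho> k j f else 0)" .
qed (rule subspace_finite_functions)

lemma highest_vector_of_highest_weight:
  assumes \<rho>: "gl_rep n d \<rho>" and hw: "has_highest_weight n d \<rho> p"
  obtains v where "gl_operators.highest_vector n (unit_operator n d \<rho>) (finite_functions d) (\<lambda>i. int (part p (i + 1))) v"
proof -
  interpret gl_operators n "unit_operator n d \<rho>" "finite_functions d"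
    by (rule gl_operators_of_gl_rep[OF \<rho>])
  have cu: "\<rho> (matrix_unit n i j) \<in> carrier_mat d d" for i j
    using \<rho> by (auto simp: gl_rep_def)
  obtain w where w: "w \<in> carrier_vec d" "w \<noteq> 0\<^sub>v d"
    and up: "\<And>i j. i < j \<Longrightarrow> j < n \<Longrightarrow> \<rho> (matrix_unit n i j) *\<^sub>v w = 0\<^sub>v d"
    and diag: "\<And>i. i < n \<Longrightarrow> \<rho> (matrix_unit n i i) *\<^sub>v w = of_nat (part p (i + 1)) \<cdot>\<^sub>v w"
    using hw unfolding has_highest_weight_def by blast
  obtain v where v: "v \<in> finite_functions d" and vw: "vec d v = w"
    using vec_surj_finite_functions[OF w(1)] by blast
  have zero: "0 \<in> finite_functions d" by (rule fs.subspace_0[OF subspace_finite_functions])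
  have op_mem: "unit_operator n d \<rho> i j f \<in> finite_functions d" for i j f
    by (simp add: matrix_operator_def finite_functions_def)
  have "highest_vector (\<lambda>i. int (part p (i + 1))) v"
    unfolding highest_vector_def
  proof (intro conjI allI impI)
    show "v \<noteq> 0"
    proof
      assume "v = 0"
      then have "w = 0\<^sub>v d" using vw by (auto simp: zero_fun_def intro!: eq_vecI)
      then show False using w by simp
    qed
  next
    fix i j assume "i < j \<and> j < n"
    then have "vec d (unit_operator n d \<rho> i j v) = vec d 0"
      using up[of i j] by (auto simp: vec_matrix_operator[OF cu] vw)
    then show "unit_operator n d \<rho> i j v = 0"
      by (rule vec_inj_finite_functions[OF op_mem zero])
  next
    fix i assume "i < n"
    then have "vec d (unit_operator n d \<rho> i i v) = vec d (fscale (of_nat (part p (i + 1))) v)"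
      using diag[of i] by (auto simp: vec_matrix_operator[OF cu] vw fscale_apply simp flip: vw intro!: eq_vecI)
    then show "unit_operator n d \<rho> i i v = fscale (of_int (int (part p (i + 1)))) v"
      using vec_inj_finite_functions[OF op_mem fs.subspace_scale[OF subspace_finite_functions v]] by simp
  qed (rule v)
  then show thesis by (rule that)
qed

text \<open>A module of least dimension among those with a highest weight vector of weight \<open>p\<close> is simple: for a
proper nonzero submodule, the vector either lies in it or has a nonzero image in the quotient, and
both have smaller dimension.\<close>

lemma simple_highest_weight_rep_exists:
  assumes "\<exists>d \<rho>. gl_rep n d \<rho> \<and> has_highest_weight n d \<rho> p"
  shows "\<exists>d \<rho>. simple_gl_rep n d \<rho> \<and> has_highest_weight n d \<rho> p"
proof -
  define d where "d = (LEAST d. \<exists>\<rho>. gl_rep n d \<rho> \<and> has_highest_weight n d \<rho> p)"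
  have "\<exists>\<rho>. gl_rep n d \<rho> \<and> has_highest_weight n d \<rho> p"
    unfolding d_def by (rule LeastI_ex[OF assms])
  then obtain \<rho> where \<rho>: "gl_rep n d \<rho>" and hw: "has_highest_weight n d \<rho> p" by blast
  have minimal: "d \<le> d'" if "\<exists>\<rho>. gl_rep n d' \<rho> \<and> has_highest_weight n d' \<rho> p" for d'
    unfolding d_def by (rule Least_le) (rule that)
  interpret gl_operators n "unit_operator n d \<rho>" "finite_functions d"
    by (rule gl_operators_of_gl_rep[OF \<rho>])
  obtain v where v: "highest_vector (\<lambda>i. int (part p (i + 1))) v"
    using highest_vector_of_highest_weight[OF \<rho> hw] by blast
  have cu: "\<rho> (matrix_unit n i j) \<in> carrier_mat d d" for i j
    using \<rho> by (auto simp: gl_rep_def)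
  have "d > 0"
  proof (rule ccontr)
    assume "\<not> d > 0"
    moreover have "v \<in> finite_functions d" "v \<noteq> 0" using v unfolding highest_vector_def by blast+
    ultimately show False by (auto simp: finite_functions_def fun_eq_iff)
  qed
  moreover have "W = {0\<^sub>v d} \<or> W = carrier_vec d"
    if W: "VectorSpace.subspace class_ring W (module_vec TYPE(complex) d)"
      and inv: "\<And>X w. X \<in> carrier_mat n n \<Longrightarrow> w \<in> W \<Longrightarrow> \<rho> X *\<^sub>v w \<in> W" for W
  proof (rule ccontr)
    assume nontrivial: "\<not> (W = {0\<^sub>v d} \<or> W = carrier_vec d)"
    have W_sub: "W \<subseteq> carrier_vec d" and W_zero: "0\<^sub>v d \<in> W"
      using W unfolding VectorSpace.subspace_def submodule_def by (auto simp: module_vec_simps)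
    have W_add: "x + y \<in> W" if "x \<in> W" "y \<in> W" for x y
      using W that unfolding VectorSpace.subspace_def submodule_def by (auto simp: module_vec_simps)
    have W_scale: "c \<cdot>\<^sub>v x \<in> W" if "x \<in> W" for c x
      using W that unfolding VectorSpace.subspace_def submodule_def by (auto simp: module_vec_simps)
    define U where "U = {f \<in> finite_functions d. vec d f \<in> W}"
    have U_sub: "U \<subseteq> finite_functions d" by (auto simp: U_def)
    have U: "fs.subspace U"
      unfolding fs.subspace_def
    proof (intro conjI ballI allI)
      show "0 \<in> U"
        using W_zero fs.subspace_0[OF subspace_finite_functions] by (simp add: U_def zero_fun_def zero_vec_def)
    next
      fix f g assume "f \<in> U" "g \<in> U"
      moreover have "vec d (f + g) = vec d f + vec d g" by (intro eq_vecI) auto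
      ultimately show "f + g \<in> U"
        using W_add fs.subspace_add[OF subspace_finite_functions] by (simp add: U_def)
    next
      fix c f assume "f \<in> U"
      moreover have "vec d (fscale c f) = c \<cdot>\<^sub>v vec d f" by (intro eq_vecI) (auto simp: fscale_apply)
      ultimately show "fscale c f \<in> U"
        using W_scale fs.subspace_scale[OF subspace_finite_functions] by (simp add: U_def)
    qed
    have U_inv: "unit_operator n d \<rho> i j f \<in> U" if "i < n" "j < n" "f \<in> U" for i j f
      using that closed inv[of "matrix_unit n i j"] by (simp add: U_def vec_matrix_operator[OF cu])
    obtain B0 where B0: "B0 \<subseteq> U" "fs.independent B0" "U \<subseteq> fs.span B0"
      using fs.maximal_independent_subset_extend[of "{}" U] fs.independent_empty by auto
    have B0_span: "fs.span B0 = U" using fs.span_minimal[OF B0(1) U] B0(3) by blast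
    obtain B where B: "B0 \<subseteq> B" "B \<subseteq> finite_functions d" "fs.independent B" "finite_functions d \<subseteq> fs.span B"
      using fs.maximal_independent_subset_extend[of B0 "finite_functions d"] B0 U_sub by blast
    note Bf = finite_functions_basis[OF B(3,2,4)]
    have fin: "finite B0" using B(1) Bf(1) by (rule finite_subset)
    have "B0 \<noteq> {}"
    proof
      assume "B0 = {}"
      then have "U = {0}" using B0_span by simp
      have "W = {0\<^sub>v d}"
      proof (intro equalityI subsetI)
        fix w assume w: "w \<in> W"
        then obtain f where "f \<in> finite_functions d" "vec d f = w"
          using vec_surj_finite_functions W_sub by blast
        then have "f \<in> U" using w by (simp add: U_def)
        then show "w \<in> {0\<^sub>v d}" using \<open>U = {0}\<close> \<open>vec d f = w\<close> by (auto simp: zero_fun_def zero_vec_def)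
      qed (use W_zero in simp)
      then show False using nontrivial by simp
    qed
    have "B0 \<noteq> B"
    proof
      assume "B0 = B"
      then have "U = finite_functions d" using B0_span Bf(3) by simp
      then have "carrier_vec d \<subseteq> W"
        using vec_surj_finite_functions by (force simp: U_def)
      then show False using nontrivial W_sub by simp
    qed
    have "card B0 < d" using psubset_card_mono[OF Bf(1)] B(1) \<open>B0 \<noteq> B\<close> Bf(2) by blast
    have "card (B - B0) < d"
      using card_Diff_subset[OF fin B(1)] Bf(2) \<open>B0 \<noteq> {}\<close> fin \<open>d > 0\<close> by (simp add: card_gt_0_iff)
    have B0_inv: "unit_operator n d \<rho> i j b \<in> fs.span B0" if "i < n" "j < n" "b \<in> B0" for i j b
      using U_inv that B0(1) B0_span by auto
    show False
    proof (cases "v \<in> U")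
      case True
      interpret U: gl_operators n "unit_operator n d \<rho>" U
      proof
        fix i j k l f assume "i < n" "j < n" "k < n" "l < n" "f \<in> U"
        then show "unit_operator n d \<rho> i j (unit_operator n d \<rho> k l f) - unit_operator n d \<rho> k l (unit_operator n d \<rho> i j f) =
          (if j = k then unit_operator n d \<rho> i l f else 0) - (if l = i then unit_operator n d \<rho> k j f else 0)"
          using U_sub by (intro commutator) auto
      qed (use U U_inv in \<open>auto intro: lin_matrix_operator\<close>)
      have "U.highest_vector (\<lambda>i. int (part p (i + 1))) v"
        using v True by (simp add: U.highest_vector_def highest_vector_def)
      moreover have "v \<notin> fs.span {}" using v by (simp add: highest_vector_def)
      ultimately have "\<exists>\<rho>. gl_rep n (card (B0 - {})) \<rho> \<and> has_highest_weight n (card (B0 - {})) \<rho> p"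
        by (intro U.gl_rep_of_subquotient[OF fin B0(2) B0_span]) auto
      then show False using minimal[of "card B0"] \<open>card B0 < d\<close> by simp
    next
      case False
      then have "\<exists>\<rho>. gl_rep n (card (B - B0)) \<rho> \<and> has_highest_weight n (card (B - B0)) \<rho> p"
        using B0_inv B0_span by (intro gl_rep_of_subquotient[OF Bf(1) B(3) Bf(3) B(1) _ v]) auto
      then show False using minimal[of "card (B - B0)"] \<open>card (B - B0) < d\<close> by simp
    qed
  qed
  ultimately have "simple_gl_rep n d \<rho>" using \<rho> unfolding simple_gl_rep_def by blast
  with hw show ?thesis by blast
qed

section \<open>Irreducible highest weight modules\<close>

text \<open>Evaluating sums of functions pointwise would make the simplifier expand vectors under \<open>span\<close> and
under the operators, where they have to stay abstract.\<close>

lemmas fun_apply_simps = plus_fun_apply zero_fun_apply minus_apply uminus_apply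

declare fun_apply_simps [simp del]

text \<open>Irreducibility makes the vectors generated from \<open>v\<close> fill the module; the finite set \<open>F\<close> bounds its
dimension.\<close>

locale irreducible_highest_weight = gl_operators n E V
  for n and E :: "nat \<Rightarrow> nat \<Rightarrow> ('a \<Rightarrow> complex) \<Rightarrow> ('a \<Rightarrow> complex)" and V +
  fixes lam :: "nat \<Rightarrow> int" and v :: "'a \<Rightarrow> complex" and F :: "('a \<Rightarrow> complex) set"
  assumes finite_dim: "finite F" "V \<subseteq> fs.span F"
    and irreducible: "\<And>U. fs.subspace U \<Longrightarrow> U \<subseteq> V \<Longrightarrow>
      (\<And>i j f. i < n \<Longrightarrow> j < n \<Longrightarrow> f \<in> U \<Longrightarrow> E i j f \<in> U) \<Longrightarrow> U = {0} \<or> U = V"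
    and highest: "highest_vector lam v"
    and lam_support: "\<And>k. n \<le> k \<Longrightarrow> lam k = 0"
begin

lemma v: "v \<in> V" "v \<noteq> 0"
  and v_raise: "i < j \<Longrightarrow> j < n \<Longrightarrow> E i j v = 0"
  and v_weight: "i < n \<Longrightarrow> E i i v = fscale (of_int (lam i)) v"
  using highest by (auto simp: highest_vector_def)

lemma commute:
  assumes "i < n" "j < n" "k < n" "l < n" "f \<in> V"
  shows "E i j (E k l f) = E k l (E i j f) + ((if j = k then E i l f else 0) - (if l = i then E k j f else 0))"
  using commutator[OF assms] by (simp add: algebra_simps)

text \<open>The vectors obtained from \<open>v\<close> by \<open>k\<close> lowering operators, with their weights.\<close>

inductive lowered :: "nat \<Rightarrow> ('a \<Rightarrow> complex) \<Rightarrow> (nat \<Rightarrow> int) \<Rightarrow> bool" where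
  start: "lowered 0 v lam"
| lower: "lowered k w \<mu> \<Longrightarrow> j < i \<Longrightarrow> i < n \<Longrightarrow>
    lowered (Suc k) (E i j w) (\<mu> + (unit_weight i - unit_weight j))"

lemma lowered_in_V: "lowered k w \<mu> \<Longrightarrow> w \<in> V"
  by (induction rule: lowered.induct) (auto intro: v closed)

lemma lowered_weight:
  "lowered k w \<mu> \<Longrightarrow> a < n \<Longrightarrow> E a a w = fscale (of_int (\<mu> a)) w"
proof (induction rule: lowered.induct)
  case start
  then show ?case by (rule v_weight)
next
  case (lower k w \<mu> j i)
  have w: "w \<in> V" using lower.hyps by (auto intro: lowered_in_V)
  have j: "j < n" using lower.hyps by simp
  have "E a a (E i j w) = fscale (of_int (\<mu> a)) (E i j w) +
      ((if a = i then E i j w else 0) - (if j = a then E i j w else 0))"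
    using commute[OF lower.prems lower.prems lower.hyps(3) j w] lower.IH[OF lower.prems]
      lin_scale[OF linear[OF lower.hyps(3) j]] by auto
  also have "\<dots> = fscale (of_int ((\<mu> + (unit_weight i - unit_weight j)) a)) (E i j w)"
    using lower.hyps by (auto simp: fun_eq_iff fscale_apply fun_apply_simps unit_weight_def algebra_simps)
  finally show ?case .
qed

lemma sum_unit_weight: "(\<Sum>i<k. unit_weight m i) = (if m < k then 1 else 0)"
  by (simp add: unit_weight_def sum.delta)

lemma lowered_partial_sum:
  "lowered k w \<mu> \<Longrightarrow> (\<Sum>i<r. \<mu> i) \<le> (\<Sum>i<r. lam i)"
  by (induction rule: lowered.induct) (auto simp: fun_apply_simps sum.distrib sum_subtractf sum_unit_weight)

lemma lowered_total: "lowered k w \<mu> \<Longrightarrow> (\<Sum>i<n. \<mu> i) = (\<Sum>i<n. lam i)"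
  by (induction rule: lowered.induct) (auto simp: fun_apply_simps sum.distrib sum_subtractf sum_unit_weight)

lemma lowered_support: "lowered k w \<mu> \<Longrightarrow> n \<le> r \<Longrightarrow> \<mu> r = 0"
  by (induction rule: lowered.induct) (auto simp: fun_apply_simps lam_support unit_weight_def)

lemma lowered_height: "lowered k w \<mu> \<Longrightarrow> height n \<mu> \<le> height n lam - int k"
proof (induction rule: lowered.induct)
  case (lower k w \<mu> j i)
  have s: "(\<Sum>q<n. (int n - int q) * unit_weight m q) = int n - int m" if "m < n" for m
    using that by (simp add: unit_weight_def if_distrib sum.delta cong: if_cong)
  have "height n (\<mu> + (unit_weight i - unit_weight j)) = height n \<mu> + (int j - int i)"
    using lower.hyps s[of i] s[of j]
    by (simp add: height_def fun_apply_simps distrib_left right_diff_distrib sum.distrib sum_subtractf)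
  then show ?case using lower by simp
qed simp

text \<open>Every lowering step decreases the height, so the highest weight occurs only for the empty word.
This is the multiplicity one property.\<close>

lemma lowered_highest: "lowered k w lam \<Longrightarrow> w = v"
  using lowered_height[of k w lam] by (auto elim: lowered.cases)

definition words :: "nat \<Rightarrow> ('a \<Rightarrow> complex) set" where
  "words k = {w. \<exists>k' \<mu>. k' \<le> k \<and> lowered k' w \<mu>}"

lemma words_mono: "k \<le> k' \<Longrightarrow> words k \<subseteq> words k'"
  unfolding words_def by (blast intro: le_trans)

lemma lower_words:
  assumes "j < i" "i < n" "f \<in> fs.span (words k)"
  shows "E i j f \<in> fs.span (words (Suc k))"
proof (rule lin_span[OF _ _ assms(3)])
  fix w assume "w \<in> words k"
  then obtain k' \<mu> where "k' \<le> k" "lowered k' w \<mu>" by (auto simp: words_def)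
  then have "Suc k' \<le> Suc k" "lowered (Suc k') (E i j w) (\<mu> + (unit_weight i - unit_weight j))"
    using assms by (auto intro: lowered.lower)
  then have "E i j w \<in> words (Suc k)" unfolding words_def by blast
  then show "E i j w \<in> fs.span (words (Suc k))" by (rule fs.span_base)
qed (use assms linear in auto)

text \<open>Moving a raising operator past the lowering operators of a word one at a time leaves commutators,
which act on a shorter word; induction on the length shows that raising operators never increase
the length. This replaces the Poincare-Birkhoff-Witt theorem.\<close>

lemma raise_words:
  "lowered k w \<mu> \<Longrightarrow> i \<le> j \<Longrightarrow> j < n \<Longrightarrow> E i j w \<in> fs.span (words k)"
proof (induction arbitrary: i j rule: lowered.induct)
  case start
  have "v \<in> fs.span (words 0)" by (intro fs.span_base) (auto simp: words_def intro: lowered.start)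
  then show ?case using start v_weight[of i] v_raise[of i j]
    by (cases "i = j") (auto intro: fs.span_scale fs.span_zero)
next
  case (lower k w \<mu> b a)
  have w: "w \<in> V" and i: "i < n" and b: "b < n"
    using lower by (auto intro: lowered_in_V)
  have mono: "fs.span (words k) \<subseteq> fs.span (words (Suc k))"
    by (intro fs.span_mono words_mono) simp
  have any: "E p q w \<in> fs.span (words (Suc k))" if "p < n" "q < n" for p q
  proof (cases "p \<le> q")
    case True
    then show ?thesis using lower.IH[of p q] that mono by blast
  next
    case False
    have "w \<in> fs.span (words k)" using lower.hyps(1) by (intro fs.span_base) (auto simp: words_def)
    then show ?thesis using False that by (intro lower_words) auto
  qed
  have "E a b (E i j w) \<in> fs.span (words (Suc k))"
    using lower by (intro lower_words) auto
  then show ?case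
    using any lower i b by (subst commute[OF i _ _ _ w]) (auto intro!: fs.span_add fs.span_diff fs.span_zero)
qed

definition all_words :: "('a \<Rightarrow> complex) set" where
  "all_words = {w. \<exists>k \<mu>. lowered k w \<mu>}"

lemma span_all_words: "fs.span all_words = V"
proof -
  have sub: "fs.span (words k) \<subseteq> fs.span all_words" for k
    by (rule fs.span_mono) (auto simp: words_def all_words_def)
  have inV: "fs.span all_words \<subseteq> V"
    by (rule fs.span_minimal[OF _ subspace]) (auto simp: all_words_def intro: lowered_in_V)
  have "fs.span all_words = {0} \<or> fs.span all_words = V"
  proof (rule irreducible[OF fs.subspace_span inV])
    fix i j f assume ij: "i < n" "j < n" and f: "f \<in> fs.span all_words"
    show "E i j f \<in> fs.span all_words"
    proof (rule lin_span[OF linear[OF ij] _ f])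
      fix w assume "w \<in> all_words"
      then obtain k \<mu> where w: "lowered k w \<mu>" by (auto simp: all_words_def)
      show "E i j w \<in> fs.span all_words"
      proof (cases "i \<le> j")
        case True
        then show ?thesis using raise_words[OF w _ ij(2)] sub by blast
      next
        case False
        then have "lowered (Suc k) (E i j w) (\<mu> + (unit_weight i - unit_weight j))"
          using w ij by (auto intro: lowered.lower)
        then have "E i j w \<in> all_words" unfolding all_words_def by blast
        then show ?thesis by (rule fs.span_base)
      qed
    qed
  qed
  moreover have "v \<in> fs.span all_words"
    by (intro fs.span_base) (auto simp: all_words_def intro: lowered.start)
  ultimately show ?thesis using v by auto
qed

definition casimir :: "('a \<Rightarrow> complex) \<Rightarrow> 'a \<Rightarrow> complex" where
  "casimir f = (\<Sum>i<n. \<Sum>j<n. E i j (E j i f))"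

definition casimir_value :: int where
  "casimir_value = (\<Sum>i<n. (lam i)\<^sup>2) + (\<Sum>(i, j)\<in>pairs n. lam i - lam j)"

text \<open>The commutators of \<open>E\<^sub>k\<^sub>l\<close> with the two factors of \<open>E\<^sub>i\<^sub>j E\<^sub>j\<^sub>i\<close> give four single sums, which cancel in
pairs.\<close>

lemma casimir_commute:
  assumes kl: "k < n" "l < n" and f: "f \<in> V"
  shows "casimir (E k l f) = E k l (casimir f)"
proof -
  have step: "E i j (E j i (E k l f)) = E k l (E i j (E j i f)) +
      ((if i = k then E i j (E j l f) else 0) - (if l = j then E i j (E k i f) else 0)) +
      ((if j = k then E i l (E j i f) else 0) - (if l = i then E k j (E j i f) else 0))"
    if ij: "i < n" "j < n" for i j
  proof -
    have "E i j (E j i (E k l f)) = E i j (E k l (E j i f)) +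
        ((if i = k then E i j (E j l f) else 0) - (if l = j then E i j (E k i f) else 0))"
    proof -
      have diff: "E i j (g - h) = E i j g - E i j h" for g h
        using lin_add[OF linear[OF ij], of "g - h" h] by (simp add: algebra_simps)
      show ?thesis
        unfolding commute[OF ij(2,1) kl f] lin_add[OF linear[OF ij]] diff
        using lin_zero[OF linear[OF ij]] by simp
    qed
    also have "E i j (E k l (E j i f)) = E k l (E i j (E j i f)) +
        ((if j = k then E i l (E j i f) else 0) - (if l = i then E k j (E j i f) else 0))"
      by (rule commute[OF ij kl closed[OF ij(2,1) f]])
    finally show ?thesis by (simp add: algebra_simps)
  qed
  have "casimir (E k l f) = E k l (casimir f) +
      (\<Sum>i<n. \<Sum>j<n. (if i = k then E i j (E j l f) else 0)) - (\<Sum>i<n. \<Sum>j<n. (if l = j then E i j (E k i f) else 0)) +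
      (\<Sum>i<n. \<Sum>j<n. (if j = k then E i l (E j i f) else 0)) - (\<Sum>i<n. \<Sum>j<n. (if l = i then E k j (E j i f) else 0))"
    unfolding casimir_def lin_sum[OF linear[OF kl]] sum.distrib[symmetric] sum_subtractf[symmetric]
    by (intro sum.cong refl) (simp add: step algebra_simps)
  moreover have "(\<Sum>i<n. \<Sum>j<n. (if i = k then E i j (E j l f) else 0)) = (\<Sum>j<n. E k j (E j l f))"
    using kl by (subst sum.swap) (simp add: sum.delta)
  moreover have "(\<Sum>i<n. \<Sum>j<n. (if l = j then E i j (E k i f) else 0)) = (\<Sum>i<n. E i l (E k i f))"
    using kl by (simp add: sum.delta')
  moreover have "(\<Sum>i<n. \<Sum>j<n. (if j = k then E i l (E j i f) else 0)) = (\<Sum>i<n. E i l (E k i f))"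
    using kl by (simp add: sum.delta)
  moreover have "(\<Sum>i<n. \<Sum>j<n. (if l = i then E k j (E j i f) else 0)) = (\<Sum>j<n. E k j (E j l f))"
    using kl by (subst sum.swap) (simp add: sum.delta')
  ultimately show ?thesis by simp
qed

lemma fscale_sum: "(\<Sum>a\<in>A. fscale (c a) f) = fscale (\<Sum>a\<in>A. c a) f"
  by (simp add: fs.scale_sum_left)

text \<open>For \<open>i < j\<close> the factor \<open>E\<^sub>i\<^sub>j\<close> kills \<open>v\<close>, and \<open>E\<^sub>i\<^sub>j E\<^sub>j\<^sub>i v\<close> reduces to the commutator
\<open>(E\<^sub>i\<^sub>i - E\<^sub>j\<^sub>j) v\<close>.\<close>

lemma casimir_highest: "casimir v = fscale (of_int casimir_value) v"
proof -
  have diag: "E i i (E i i v) = fscale (of_int ((lam i)\<^sup>2)) v" if "i < n" for i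
    using v_weight[OF that] lin_scale[OF linear[OF that that]]
    by (simp add: power2_eq_square)
  have off: "E i j (E j i v) + E j i (E i j v) = fscale (of_int (lam i - lam j)) v" if "(i, j) \<in> pairs n" for i j
  proof -
    have ij: "i < j" "i < n" "j < n" using that by (auto simp: pairs_def)
    have "E j i (E i j v) = 0" using v_raise ij lin_zero[OF linear[OF ij(3,2)]] by simp
    then show ?thesis
      using commute[OF ij(2,3,3,2) v(1)] v_weight ij by (simp add: fs.scale_left_diff_distrib)
  qed
  have "casimir v = (\<Sum>i<n. E i i (E i i v)) + (\<Sum>(i, j)\<in>pairs n. E i j (E j i v) + E j i (E i j v))"
    unfolding casimir_def by (rule sum_square_eq_diag_pairs)
  also have "(\<Sum>i<n. E i i (E i i v)) = fscale (\<Sum>i<n. of_int ((lam i)\<^sup>2)) v"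
    unfolding fscale_sum[symmetric] by (intro sum.cong) (auto simp: diag simp del: of_int_power)
  also have "(\<Sum>(i, j)\<in>pairs n. E i j (E j i v) + E j i (E i j v)) = fscale (\<Sum>(i, j)\<in>pairs n. of_int (lam i - lam j)) v"
    unfolding fscale_sum[symmetric] case_prod_unfold
    by (intro sum.cong refl) (use off in \<open>auto simp del: of_int_diff\<close>)
  finally show ?thesis
    by (simp add: casimir_value_def case_prod_unfold fs.scale_left_distrib)
qed

lemma casimir_lowered: "lowered k w \<mu> \<Longrightarrow> casimir w = fscale (of_int casimir_value) w"
proof (induction rule: lowered.induct)
  case start
  show ?case by (rule casimir_highest)
next
  case (lower k w \<mu> j i)
  then show ?case
    using casimir_commute[of i j w] lowered_in_V[of k w \<mu>] lin_scale[OF linear, of i j] by simp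
qed

text \<open>A basis of lowered vectors containing \<open>v\<close> consists of weight vectors, contains the highest weight
exactly once, and diagonalizes the Casimir element. The radius of the sphere is \<open>|\<lambda> + \<rho>|\<close>, because
the sum of \<open>\<lambda>\<^sub>i - \<lambda>\<^sub>j\<close> over \<open>i < j\<close>, plus \<open>(n - 1) \<Sum> \<lambda>\<^sub>i\<close>, is \<open>2 \<Sum> \<lambda>\<^sub>i \<rho>\<^sub>i\<close>.\<close>

theorem irreducible_dimension:
  assumes decreasing: "\<And>i j. i < j \<Longrightarrow> j < n \<Longrightarrow> lam j \<le> lam i"
  shows "of_nat (fs.dim V) * (\<Prod>(i, j)\<in>pairs n. of_int (staircase n i - staircase n j)) =
    (\<Prod>(i, j)\<in>pairs n. of_int ((lam i + staircase n i) - (lam j + staircase n j)) :: complex)"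
proof -
  \<comment> \<open>Starting the basis with v makes the highest weight vector one of its members.\<close>
  have "{v} \<subseteq> all_words" "fs.independent {v}"
    using v by (auto simp: all_words_def intro: lowered.start)
  then obtain B where vB: "{v} \<subseteq> B" and BL: "B \<subseteq> all_words" and B_ind: "fs.independent B"
    and "all_words \<subseteq> fs.span B"
    using fs.maximal_independent_subset_extend by metis
  then have B_span: "fs.span B = V"
    using span_all_words fs.span_mono[OF BL] fs.span_minimal[OF _ fs.subspace_span, of all_words B] by auto
  have BV: "B \<subseteq> V" using B_span fs.span_superset by blast
  have B_fin: "finite B"
    using fs.independent_span_bound[OF finite_dim(1) B_ind] BV finite_dim(2) by blast
  have card_B: "card B = fs.dim V"
    using fs.basis_card_eq_dim[OF BV _ B_ind] B_span by simp
  note B = B_fin B_ind B_span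
  define wt where "wt b = (SOME \<mu>. \<exists>k. lowered k b \<mu>)" for b
  have wt: "\<exists>k. lowered k b (wt b)" if "b \<in> B" for b
  proof -
    have "\<exists>\<mu> k. lowered k b \<mu>" using that BL unfolding all_words_def by blast
    then show ?thesis unfolding wt_def by (rule someI_ex)
  qed
  define x where "x i j a b = fs.representation B (E i j b) a" for i j a b
  have expand: "fs.representation B (E i j f) a = (\<Sum>b\<in>B. x i j a b * fs.representation B f b)"
    if "i < n" "j < n" "f \<in> V" "a \<in> B" for i j f a
    using subquotient_coefficients[OF B, of "{}" i j f a] that by (simp add: x_def)
  interpret gl_weight_matrices n B x wt "of_int casimir_value" "\<Sum>i<n. lam i"
  proof
    fix i j k l a b assume "i < n" "j < n" "k < n" "l < n" "a \<in> B" "b \<in> B"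
    then show "(\<Sum>d\<in>B. x i j a d * x k l d b) - (\<Sum>d\<in>B. x k l a d * x i j d b) =
        (if j = k then x i l a b else 0) - (if l = i then x k j a b else 0)"
      using subquotient_commutator[OF B, of "{}" i j k l a b] by (simp add: x_def)
  next
    fix i a b assume i: "i < n" and ab: "a \<in> B" "b \<in> B"
    obtain k where "lowered k b (wt b)" using wt[OF ab(2)] by blast
    then show "x i i a b = (if a = b then of_int (wt a i) else 0)"
      using lowered_weight[of k b "wt b" i] i ab B_ind
      by (simp add: x_def fs.representation_scale fs.span_base fs.representation_basis)
  next
    fix a assume a: "a \<in> B"
    then obtain k where low: "lowered k a (wt a)" using wt by blast
    have aV: "a \<in> V" using a BV by blast
    have mem: "E i j (E j i a) \<in> fs.span B" if "i < n" "j < n" for i j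
      using that closed aV B_span by simp
    have "(\<Sum>i<n. \<Sum>j<n. \<Sum>b\<in>B. x i j a b * x j i b a) = (\<Sum>i<n. \<Sum>j<n. fs.representation B (E i j (E j i a)) a)"
      using expand closed aV a by (intro sum.cong refl) (auto simp: x_def)
    also have "\<dots> = (\<Sum>i<n. fs.representation B (\<Sum>j<n. E i j (E j i a)) a)"
      by (intro sum.cong refl, subst fs.representation_sum[OF B_ind]) (auto intro: mem)
    also have "\<dots> = fs.representation B (casimir a) a"
      unfolding casimir_def by (subst fs.representation_sum[OF B_ind]) (auto intro!: mem fs.span_sum)
    also have "\<dots> = of_int casimir_value"
      using casimir_lowered[OF low] a B_ind
      by (simp add: fs.representation_scale fs.span_base fs.representation_basis)
    finally show "(\<Sum>i<n. \<Sum>j<n. \<Sum>b\<in>B. x i j a b * x j i b a) = of_int casimir_value" .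
  qed (use B_fin wt lowered_support lowered_total in blast)+
  have wt_v: "wt v = lam"
  proof
    fix a
    obtain k where low: "lowered k v (wt v)" using wt vB by blast
    show "wt v a = lam a"
    proof (cases "a < n")
      case True
      have "fscale (of_int (lam a)) v = fscale (of_int (wt v a)) v"
        using lowered_weight[OF low True] unfolding v_weight[OF True] .
      then show ?thesis using v(2) by auto
    next
      case False
      then show ?thesis using lowered_support[OF low, of a] lam_support[of a] by simp
    qed
  qed
  define l where "l = lam + staircase n"
  have norm_l: "(\<Sum>k<n. (staircase n k)\<^sup>2) + casimir_value + (int n - 1) * (\<Sum>i<n. lam i) = (\<Sum>k<n. (l k)\<^sup>2)"
  proof -
    have "(\<Sum>(i, j)\<in>pairs n. lam i - lam j) + (\<Sum>(i, j)\<in>pairs n. lam i + lam j) = 2 * (\<Sum>(i, j)\<in>pairs n. lam i)"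
      unfolding sum.distrib[symmetric] sum_distrib_left by (intro sum.cong) auto
    also have "(\<Sum>(i, j)\<in>pairs n. lam i) = (\<Sum>i<n. \<Sum>j\<in>{i<..<n}. lam i)"
      unfolding pairs_Sigma by (subst sum.Sigma) auto
    also have "\<dots> = (\<Sum>i<n. staircase n i * lam i)"
      by (intro sum.cong) (auto simp: staircase_def)
    finally have "(\<Sum>(i, j)\<in>pairs n. lam i - lam j) + (int n - 1) * (\<Sum>i<n. lam i) = 2 * (\<Sum>i<n. staircase n i * lam i)"
      using sum_pairs_add[of lam n] by simp
    then show ?thesis
      by (simp add: casimir_value_def l_def fun_apply_simps power2_sum sum.distrib sum_distrib_left mult_ac)
  qed
  have char: "weyl_denominator n * (\<Sum>a\<in>B. monomial (wt a) 1) = alternant n l"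
  proof (rule weyl_character_formula[of B v n wt l])
    show "l j < l i" if "i < j" "j < n" for i j
      using decreasing[OF that] that by (simp add: l_def fun_apply_simps staircase_def)
    show "l k = 0" if "n \<le> k" for k
      using lam_support[OF that] that by (simp add: l_def fun_apply_simps staircase_def)
    show "wt v = l - staircase n" by (simp add: wt_v l_def fun_apply_simps)
    show "a = v" if "a \<in> B" "wt a = l - staircase n" for a
      using wt[OF that(1)] that(2) lowered_highest by (auto simp: l_def fun_apply_simps)
    show "(\<Sum>i<k. wt a i) \<le> (\<Sum>i<k. l i - staircase n i)" if "a \<in> B" "k \<le> n" for a k
      using wt[OF that(1)] lowered_partial_sum by (auto simp: l_def fun_apply_simps)
    show "(\<Sum>i<n. wt a i) = (\<Sum>i<n. l i - staircase n i)" if "a \<in> B" for a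
      using wt_total[OF that] by (simp add: l_def fun_apply_simps)
    have "of_int (\<Sum>k<n. (l k)\<^sup>2) = (of_int (\<Sum>k<n. (staircase n k)\<^sup>2) + of_int casimir_value +
        (of_nat n - 1) * of_int (\<Sum>i<n. lam i) :: complex)"
      unfolding norm_l[symmetric] by simp
    then show "laplace n (weyl_denominator n * (\<Sum>a\<in>B. monomial (wt a) 1)) =
        monomial 0 (of_int (\<Sum>k<n. (l k)\<^sup>2)) * (weyl_denominator n * (\<Sum>a\<in>B. monomial (wt a) 1))"
      using laplace_denominator_character unfolding character_def by simp
  qed (use B_fin vB wt_support in auto)
  show ?thesis
    using weyl_dimension_formula[OF B_fin char] by (simp add: card_B l_def fun_apply_simps)
qed

end

section \<open>Highest weight vectors in the exterior algebra\<close>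

declare fun_apply_simps [simp]

text \<open>Fermionic modes are numbered, and functions on sets of occupied modes are acted on with the
Jordan-Wigner sign, which counts the occupied modes below the given one.\<close>

definition jw_sign :: "nat \<Rightarrow> nat set \<Rightarrow> complex" where
  "jw_sign q S = (-1) ^ card {r \<in> S. r < q}"

definition annihilate :: "nat \<Rightarrow> (nat set \<Rightarrow> complex) \<Rightarrow> nat set \<Rightarrow> complex" where
  "annihilate q f S = (if q \<in> S then 0 else jw_sign q S * f (insert q S))"

definition create :: "nat \<Rightarrow> (nat set \<Rightarrow> complex) \<Rightarrow> nat set \<Rightarrow> complex" where
  "create q f S = (if q \<in> S then jw_sign q S * f (S - {q}) else 0)"

lemma jw_sign_square: "jw_sign q S * jw_sign q S = 1"
  by (simp add: jw_sign_def flip: power_mult_distrib)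

lemma jw_sign_square_left: "jw_sign q S * (jw_sign q S * c) = c"
  using jw_sign_square[of q S] by (simp flip: mult.assoc)

lemma jw_sign_insert: "r \<notin> S \<Longrightarrow> jw_sign q (insert r S) = (if r < q then - jw_sign q S else jw_sign q S)"
proof -
  assume r: "r \<notin> S"
  have fin: "finite {x \<in> S. x < q}" by (rule finite_subset[of _ "{..<q}"]) auto
  have "{x \<in> insert r S. x < q} = (if r < q then insert r {x \<in> S. x < q} else {x \<in> S. x < q})" by auto
  then show ?thesis using r fin by (simp add: jw_sign_def)
qed

lemma jw_sign_delete: "r \<in> S \<Longrightarrow> jw_sign q (S - {r}) = (if r < q then - jw_sign q S else jw_sign q S)"
  using jw_sign_insert[of r "S - {r}" q] by (auto simp: insert_absorb split: if_splits)

lemma car_annihilate_create: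
  "annihilate q (create r f) S + create r (annihilate q f) S = (if q = r then f S else 0)"
proof (cases "q = r")
  case True
  then show ?thesis
    by (cases "q \<in> S")
      (simp_all add: annihilate_def create_def jw_sign_insert jw_sign_delete jw_sign_square_left insert_absorb)
next
  case False
  then have "insert q (S - {r}) = insert q S - {r}" by auto
  with False show ?thesis
    by (auto simp: annihilate_def create_def jw_sign_insert jw_sign_delete)
qed

lemma car_annihilate_annihilate: "annihilate q (annihilate r f) S = - annihilate r (annihilate q f) S"
  by (cases q r rule: linorder_cases)
    (auto simp: annihilate_def jw_sign_insert insert_commute)

lemma car_create_create: "create q (create r f) S = - create r (create q f) S"
proof -
  have "S - {q} - {r} = S - {r} - {q}" by auto
  then show ?thesis
    by (cases q r rule: linorder_cases) (auto simp: create_def jw_sign_delete)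
qed

lemma lin_annihilate: "lin (annihilate q)" and lin_create: "lin (create q)"
  by (auto simp: lin_def annihilate_def create_def fun_eq_iff fscale_apply algebra_simps)

text \<open>The canonical anticommutation relations make the products \<open>a\<^sub>p\<^sup>\<dagger> a\<^sub>q\<close> obey the relations of the
elementary matrices.\<close>

lemma bilinear_commutator:
  "create a (annihilate b (create c (annihilate d f))) - create c (annihilate d (create a (annihilate b f))) =
    (if b = c then create a (annihilate d f) else 0) - (if d = a then create c (annihilate b f) else 0)"
proof -
  have ac: "annihilate q (create r g) = (if q = r then g else 0) - create r (annihilate q g)" for q r g
  proof
    fix S
    show "annihilate q (create r g) S = ((if q = r then g else 0) - create r (annihilate q g)) S"
      using car_annihilate_create[of q r g S] by (cases "q = r") (simp_all add: algebra_simps eq_neg_iff_add_eq_0)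
  qed
  have diff: "create q (g - h) = create q g - create q h" for q g h
    using lin_add[OF lin_create, of q "g - h" h] by (simp add: algebra_simps)
  have zero: "create q 0 = 0" for q by (rule lin_zero[OF lin_create])
  have swap: "create a (create c (annihilate b (annihilate d f))) =
      create c (create a (annihilate d (annihilate b f)))"
  proof -
    have neg: "create q (- g) = - create q g" for q g
      using diff[of q 0 g] zero by simp
    have "annihilate b (annihilate d f) = - annihilate d (annihilate b f)"
      by (rule ext, subst uminus_apply, rule car_annihilate_annihilate)
    moreover have "create a (create c g) = - create c (create a g)" for g
      by (rule ext, subst uminus_apply, rule car_create_create)
    ultimately show ?thesis by (simp add: neg)
  qed
  show ?thesis
    unfolding ac diff swap by (auto simp: zero)
qed

text \<open>Mode \<open>i * N + s\<close> stands for the pair of a row \<open>i\<close> and a column \<open>s < N\<close>, so this is the action of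
\<open>gl\<^sub>n\<close> on the exterior algebra of \<open>\<complex>\<^sup>n \<otimes> \<complex>\<^sup>N\<close>.\<close>

definition fock_operator :: "nat \<Rightarrow> nat \<Rightarrow> nat \<Rightarrow> (nat set \<Rightarrow> complex) \<Rightarrow> nat set \<Rightarrow> complex" where
  "fock_operator N i j f = (\<Sum>s<N. create (i * N + s) (annihilate (j * N + s) f))"

lemma lin_fock_operator: "lin (fock_operator N i j)"
  unfolding lin_def fock_operator_def
  by (simp add: lin_add[OF lin_annihilate] lin_add[OF lin_create] lin_scale[OF lin_annihilate]
      lin_scale[OF lin_create] sum.distrib fs.scale_sum_right)

lemma mode_eq_iff:
  assumes "s < N" "t < N"
  shows "i * N + s = j * N + t \<longleftrightarrow> i = j \<and> s = (t::nat)"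
proof
  assume e: "i * N + s = j * N + t"
  have "(i * N + s) div N = i" "(j * N + t) div N = j" using assms by simp_all
  then show "i = j \<and> s = t" using e by simp
qed simp

lemma fock_commutator:
  "fock_operator N i j (fock_operator N k l f) - fock_operator N k l (fock_operator N i j f) =
    (if j = k then fock_operator N i l f else 0) - (if l = i then fock_operator N k j f else 0)"
proof -
  have "fock_operator N i j (fock_operator N k l f) - fock_operator N k l (fock_operator N i j f) =
      (\<Sum>s<N. \<Sum>t<N. create (i * N + s) (annihilate (j * N + s) (create (k * N + t) (annihilate (l * N + t) f)))) -
      (\<Sum>t<N. \<Sum>s<N. create (k * N + t) (annihilate (l * N + t) (create (i * N + s) (annihilate (j * N + s) f))))"
    by (simp add: fock_operator_def lin_sum[OF lin_annihilate] lin_sum[OF lin_create])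
  also have "(\<Sum>t<N. \<Sum>s<N. create (k * N + t) (annihilate (l * N + t) (create (i * N + s) (annihilate (j * N + s) f)))) =
      (\<Sum>s<N. \<Sum>t<N. create (k * N + t) (annihilate (l * N + t) (create (i * N + s) (annihilate (j * N + s) f))))"
    by (rule sum.swap)
  also have "(\<Sum>s<N. \<Sum>t<N. create (i * N + s) (annihilate (j * N + s) (create (k * N + t) (annihilate (l * N + t) f)))) -
      (\<Sum>s<N. \<Sum>t<N. create (k * N + t) (annihilate (l * N + t) (create (i * N + s) (annihilate (j * N + s) f)))) =
      (\<Sum>s<N. \<Sum>t<N. (if t = s then if j = k then create (i * N + s) (annihilate (l * N + s) f) else 0 else 0) -
        (if t = s then if l = i then create (k * N + s) (annihilate (j * N + s) f) else 0 else 0))"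
    unfolding sum_subtractf[symmetric] bilinear_commutator
    by (intro sum.cong refl) (auto simp: mode_eq_iff)
  also have "\<dots> = (if j = k then fock_operator N i l f else 0) - (if l = i then fock_operator N k j f else 0)"
    unfolding sum_subtractf by (simp add: sum.delta fock_operator_def)
  finally show ?thesis .
qed

definition fock_space :: "nat \<Rightarrow> (nat set \<Rightarrow> complex) set" where
  "fock_space M = {f. \<forall>S. S \<notin> Pow {..<M} \<longrightarrow> f S = 0}"

lemma gl_operators_fock: "gl_operators n (fock_operator N) (fock_space (n * N))"
proof
  show "fs.subspace (fock_space (n * N))"
    by (auto simp: fs.subspace_def fock_space_def fscale_apply)
next
  fix i j f assume ij: "i < n" "j < n" and f: "f \<in> fock_space (n * N)"
  have mode: "q * N + s < n * N" if "q < n" "s < N" for q s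
    using that mult_le_mono1[of "Suc q" n N] by simp
  have "create (i * N + s) (annihilate (j * N + s) f) S = 0" if "S \<notin> Pow {..<n * N}" "s < N" for S s
  proof -
    have "insert (j * N + s) (S - {i * N + s}) \<notin> Pow {..<n * N}"
      using that mode[OF ij(1) that(2)] by auto
    then show ?thesis using f by (auto simp: create_def annihilate_def fock_space_def)
  qed
  then show "fock_operator N i j f \<in> fock_space (n * N)"
    by (auto simp: fock_space_def fock_operator_def sum_fun_apply)
qed (simp_all add: lin_fock_operator fock_commutator)

lemma create_annihilate_same: "create q (annihilate q f) S = (if q \<in> S then f S else 0)"
  by (auto simp: create_def annihilate_def jw_sign_delete jw_sign_square_left insert_absorb)

lemma part_antimono:
  assumes "is_partition p" "1 \<le> i" "i \<le> j"
  shows "part p j \<le> part p i"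
proof (cases "i = j \<or> length p < j")
  case False
  then have "i - 1 < j - 1" "j - 1 < length p" using assms by auto
  then show ?thesis
    using assms False sorted_wrt_nth_less[of "(\<ge>)" p "i - 1" "j - 1"] by (auto simp: is_partition_def part_def)
qed (auto simp: part_def)

text \<open>In the exterior algebra of \<open>\<complex>\<^sup>n \<otimes> \<complex>\<^sup>N\<close> the basis vector indexed by the Young diagram itself is a
highest weight vector: \<open>E\<^sub>i\<^sub>j\<close> with \<open>i < j\<close> tries to move a cell of row \<open>j\<close> to row \<open>i\<close> in its column, which
is already occupied, and \<open>E\<^sub>i\<^sub>i\<close> counts the cells of row \<open>i\<close>.\<close>

theorem highest_weight_rep_exists:
  assumes p: "is_partition p"
  shows "\<exists>d \<rho>. gl_rep n d \<rho> \<and> has_highest_weight n d \<rho> p"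
proof -
  define N where "N = part p 1"
  interpret gl_operators n "fock_operator N" "fock_space (n * N)" by (rule gl_operators_fock)
  let ?\<delta> = "\<lambda>S T. if T = S then 1 else (0::complex)"
  define S0 where "S0 = {i * N + s | i s. i < n \<and> s < part p (i + 1)}"
  have part_le: "part p (i + 1) \<le> N" for i using part_antimono[OF p, of 1 "i + 1"] by (simp add: N_def)
  have S0_iff: "i * N + s \<in> S0 \<longleftrightarrow> s < part p (i + 1)" if "i < n" "s < N" for i s
  proof
    assume "i * N + s \<in> S0"
    then obtain i' s' where e: "i * N + s = i' * N + s'" and "s' < part p (i' + 1)" by (auto simp: S0_def)
    then show "s < part p (i + 1)" using mode_eq_iff[of s N s' i i'] that part_le[of i'] by auto
  qed (use that in \<open>auto simp: S0_def\<close>)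
  have S0_sub: "S0 \<in> Pow {..<n * N}"
  proof -
    have "i * N + s < n * N" if "i < n" "s < part p (i + 1)" for i s
      using that part_le[of i] mult_le_mono1[of "Suc i" n N] by simp
    then show ?thesis by (auto simp: S0_def)
  qed
  define v where "v = ?\<delta> S0"
  have "highest_vector (\<lambda>i. int (part p (i + 1))) v"
    unfolding highest_vector_def
  proof (intro conjI allI impI)
    show "v \<in> fock_space (n * N)" using S0_sub by (auto simp: v_def fock_space_def)
    show "v \<noteq> 0" by (auto simp: v_def fun_eq_iff)
  next
    fix i j assume ij: "i < j \<and> j < n"
    have "create (i * N + s) (annihilate (j * N + s) v) S = 0" if s: "s < N" for s S
    proof (rule ccontr)
      assume "create (i * N + s) (annihilate (j * N + s) v) S \<noteq> 0"
      then have "insert (j * N + s) (S - {i * N + s}) = S0"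
        by (auto simp: create_def annihilate_def v_def split: if_splits)
      moreover have "i * N + s \<noteq> j * N + s" using s ij by simp
      ultimately have "j * N + s \<in> S0" "i * N + s \<notin> S0" by auto
      then show False using S0_iff s ij part_antimono[OF p, of "i + 1" "j + 1"] by simp
    qed
    then show "fock_operator N i j v = 0"
      by (auto simp: fock_operator_def fun_eq_iff sum_fun_apply)
  next
    fix i assume i: "i < n"
    show "fock_operator N i i v = fscale (of_int (int (part p (i + 1)))) v"
    proof
      fix S
      have "fock_operator N i i v S = (\<Sum>s<N. if i * N + s \<in> S then v S else 0)"
        by (simp add: fock_operator_def sum_fun_apply create_annihilate_same)
      also have "\<dots> = (\<Sum>s<N. if s < part p (i + 1) then v S else 0)"
        by (intro sum.cong) (auto simp: v_def S0_iff[OF i, simplified])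
      also have "\<dots> = (\<Sum>s<part p (i + 1). v S)"
        using part_le[of i] by (intro sum.mono_neutral_cong_right) auto
      finally show "fock_operator N i i v S = fscale (of_int (int (part p (i + 1)))) v S"
        by (simp add: fscale_apply)
    qed
  qed
  moreover have "finite (?\<delta> ` Pow {..<n * N})" by simp
  moreover have "fs.span (?\<delta> ` Pow {..<n * N}) = fock_space (n * N)"
    by (subst delta_basis(2)) (auto simp: fock_space_def)
  moreover have "v \<notin> fs.span {}"
  proof -
    have "v S0 \<noteq> 0" by (simp add: v_def)
    then show ?thesis by auto
  qed
  ultimately have "\<exists>\<rho>. gl_rep n (card (?\<delta> ` Pow {..<n * N} - {})) \<rho> \<and>
      has_highest_weight n (card (?\<delta> ` Pow {..<n * N} - {})) \<rho> p"
    by (intro gl_rep_of_subquotient delta_basis(1)) auto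
  then show ?thesis by blast
qed

section \<open>The hook content formula\<close>

lemma initial_segment:
  fixes D :: "nat set"
  assumes "finite D" "\<And>i. i \<in> D \<Longrightarrow> 1 \<le> i" "\<And>i j. i \<in> D \<Longrightarrow> 1 \<le> j \<Longrightarrow> j \<le> i \<Longrightarrow> j \<in> D"
  shows "D = {1..card D}"
proof (cases "D = {}")
  case False
  define M where "M = Max D"
  have "M \<in> D" unfolding M_def using assms(1) False by (rule Max_in)
  have "D = {1..M}"
  proof (intro equalityI subsetI)
    fix i assume "i \<in> D"
    then show "i \<in> {1..M}" using assms(2) Max_ge[OF assms(1)] by (simp add: M_def)
  next
    fix i assume "i \<in> {1..M}"
    then show "i \<in> D" using assms(3)[OF \<open>M \<in> D\<close>] by simp
  qed
  moreover from arg_cong[OF this, of card] have "card D = M" by simp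
  ultimately show ?thesis by simp
qed simp

definition column :: "nat list \<Rightarrow> nat \<Rightarrow> nat" where
  "column p j = card {i. 1 \<le> i \<and> j \<le> part p i}"

lemma column_segment:
  assumes p: "is_partition p" and j: "1 \<le> j"
  shows "{i. 1 \<le> i \<and> j \<le> part p i} = {1..column p j}"
  unfolding column_def
proof (rule initial_segment)
  show "finite {i. 1 \<le> i \<and> j \<le> part p i}"
    by (rule finite_subset[of _ "{1..length p}"]) (use j in \<open>auto simp: part_def split: if_splits\<close>)
  fix i k assume "i \<in> {i. 1 \<le> i \<and> j \<le> part p i}" "1 \<le> k" "k \<le> i"
  then show "k \<in> {i. 1 \<le> i \<and> j \<le> part p i}" using part_antimono[OF p, of k i] by simp
qed simp

lemma le_column_iff:
  assumes "is_partition p" "1 \<le> i" "1 \<le> j"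
  shows "i \<le> column p j \<longleftrightarrow> j \<le> part p i"
  using column_segment[OF assms(1,3)] assms(2) by (auto simp: set_eq_iff)

lemma column_antimono:
  assumes "is_partition p" "1 \<le> i" "i \<le> j"
  shows "column p j \<le> column p i"
proof (cases "column p j")
  case (Suc r)
  then show ?thesis
    using le_column_iff[of p "column p j" j] le_column_iff[of p "column p j" i] assms by simp
qed simp

lemma part_length_eq_column: "part_length p = column p 1"
proof -
  have "{i. part p i \<noteq> 0} = {i. 1 \<le> i \<and> 1 \<le> part p i}" by (auto simp: part_def split: if_splits)
  then show ?thesis by (simp add: part_length_def column_def)
qed

lemma part_eq_0: "is_partition p \<Longrightarrow> part_length p < i \<Longrightarrow> part p i = 0"
  using le_column_iff[of p i 1] by (auto simp: part_length_eq_column)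

definition cells :: "nat list \<Rightarrow> (nat \<times> nat) set" where
  "cells p = {(i, j). 1 \<le> i \<and> 1 \<le> j \<and> j \<le> part p i}"

definition hook_length :: "nat list \<Rightarrow> nat \<times> nat \<Rightarrow> int" where
  "hook_length p = (\<lambda>(i, j). int (part p i) - int j + int (column p j) - int i + 1)"

definition cell_content :: "nat \<times> nat \<Rightarrow> int" where
  "cell_content = (\<lambda>(i, j). int j - int i)"

lemma cells_eq_Sigma:
  assumes "is_partition p" "part_length p \<le> n"
  shows "cells p = Sigma {1..n} (\<lambda>i. {1..part p i})"
proof -
  have "i \<le> n" if "1 \<le> i" "1 \<le> part p i" for i
    using part_eq_0[OF assms(1), of i] that assms(2) by (cases "i \<le> n") auto
  then show ?thesis by (fastforce simp: cells_def)
qed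

lemma finite_cells: "is_partition p \<Longrightarrow> finite (cells p)"
  using cells_eq_Sigma[of p "part_length p"] by simp

lemma hook_length_pos: "is_partition p \<Longrightarrow> u \<in> cells p \<Longrightarrow> 1 \<le> hook_length p u"
  using le_column_iff[of p "fst u" "snd u"] by (auto simp: cells_def hook_length_def)

text \<open>The entries of \<open>\<lambda> + \<rho>\<close>, with rows counted from \<open>0\<close>.\<close>

definition shifted_part :: "nat \<Rightarrow> nat list \<Rightarrow> nat \<Rightarrow> int" where
  "shifted_part n p i = int (part p (i + 1)) + int (n - 1 - i)"

lemma shifted_part_less:
  assumes "is_partition p" "i < j" "j < n"
  shows "shifted_part n p j < shifted_part n p i"
  using part_antimono[OF assms(1), of "i + 1" "j + 1"] assms(2,3) by (simp add: shifted_part_def)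

text \<open>The hook lengths of a row and the differences of its shifted part with the later ones are disjoint
and together exhaust the interval from \<open>1\<close> to the shifted part. For a difference with row \<open>j\<close> and a
hook in column \<open>c\<close> to agree, the numbers \<open>column p c - j\<close> and \<open>c - part p (j + 1)\<close> would have to be
equal, but one is positive exactly if the other is not.\<close>

lemma row_hook_product:
  assumes p: "is_partition p" and len: "part_length p \<le> n" and i: "i < n"
  shows "(\<Prod>j\<in>{i<..<n}. shifted_part n p i - shifted_part n p j) * (\<Prod>c\<in>{1..part p (i + 1)}. hook_length p (i + 1, c)) =
    fact (nat (shifted_part n p i))"
proof -
  let ?l = "shifted_part n p" and ?h = "\<lambda>c. hook_length p (i + 1, c)"
  define A where "A = (\<lambda>j. ?l i - ?l j) ` {i<..<n}"
  define H where "H = ?h ` {1..part p (i + 1)}"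
  have injA: "inj_on (\<lambda>j. ?l i - ?l j) {i<..<n}"
  proof (rule inj_onI)
    fix j k assume "j \<in> {i<..<n}" "k \<in> {i<..<n}" "?l i - ?l j = ?l i - ?l k"
    then show "j = k" using shifted_part_less[OF p, of j k n] shifted_part_less[OF p, of k j n]
      by (cases j k rule: linorder_cases) auto
  qed
  have h_less: "?h d < ?h c" if "1 \<le> c" "c < d" for c d
    using column_antimono[OF p, of c d] that by (simp add: hook_length_def)
  have injH: "inj_on ?h {1..part p (i + 1)}"
  proof (rule inj_onI)
    fix c d assume "c \<in> {1..part p (i + 1)}" "d \<in> {1..part p (i + 1)}" "?h c = ?h d"
    then show "c = d" using h_less[of c d] h_less[of d c] by (cases c d rule: linorder_cases) auto
  qed
  have A_sub: "A \<subseteq> {1..?l i}"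
  proof
    fix x assume "x \<in> A"
    then obtain j where "i < j" "j < n" and x: "x = ?l i - ?l j" by (auto simp: A_def)
    then have "?l j < ?l i" by (intro shifted_part_less[OF p])
    moreover have "0 \<le> ?l j" by (simp add: shifted_part_def)
    ultimately show "x \<in> {1..?l i}" by (simp add: x)
  qed
  have H_sub: "H \<subseteq> {1..?l i}"
  proof
    fix x assume "x \<in> H"
    then obtain c where c: "1 \<le> c" "c \<le> part p (i + 1)" and x: "x = ?h c" by (auto simp: H_def)
    have "1 \<le> x" using hook_length_pos[OF p, of "(i + 1, c)"] c x by (simp add: cells_def)
    moreover have "column p c \<le> n"
      using column_antimono[OF p, of 1 c] c len by (simp add: part_length_eq_column)
    then have "x \<le> ?l i" using c i by (simp add: x hook_length_def shifted_part_def)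
    ultimately show "x \<in> {1..?l i}" by simp
  qed
  have disj: "A \<inter> H = {}"
  proof (rule ccontr)
    assume "A \<inter> H \<noteq> {}"
    then obtain j c where j: "i < j" "j < n" and c: "1 \<le> c" and e: "?l i - ?l j = ?h c"
      by (auto simp: A_def H_def)
    have e': "int (column p c) - int j = int c - int (part p (j + 1))"
      using e j by (simp add: shifted_part_def hook_length_def)
    show False using le_column_iff[OF p, of "j + 1" c] c e' by (cases "c \<le> part p (j + 1)") auto
  qed
  have "card (A \<union> H) = card {1..?l i}"
  proof -
    have "card (A \<union> H) = card A + card H" using disj by (intro card_Un_disjoint) (auto simp: A_def H_def)
    also have "\<dots> = (n - 1 - i) + part p (i + 1)"
      unfolding A_def H_def by (simp only: card_image[OF injA] card_image[OF injH]) (use i in simp)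
    finally show ?thesis using i by (simp add: shifted_part_def nat_add_distrib)
  qed
  then have union: "A \<union> H = {1..?l i}"
    using A_sub H_sub by (intro card_subset_eq) auto
  have "(\<Prod>j\<in>{i<..<n}. ?l i - ?l j) * (\<Prod>c\<in>{1..part p (i + 1)}. ?h c) = \<Prod>A * \<Prod>H"
    unfolding A_def H_def by (simp only: prod.reindex[OF injA] prod.reindex[OF injH] comp_def id_def)
  also have "\<dots> = \<Prod>{1..?l i}"
    unfolding union[symmetric] using disj by (intro prod.union_disjoint[symmetric]) (auto simp: A_def H_def)
  also have "\<dots> = (\<Prod>k\<in>{1..nat (?l i)}. int k)"
    by (rule prod.reindex_bij_witness[of _ int nat]) auto
  also have "\<dots> = fact (nat (?l i))" by (simp add: fact_prod)
  finally show ?thesis .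
qed

lemma fact_add_prod: "(fact (a + k) :: int) = fact a * (\<Prod>c\<in>{1..k}. int a + int c)"
proof (induction k)
  case (Suc k)
  have "{1..Suc k} = insert (Suc k) {1..k}" by auto
  then show ?case using Suc by (simp add: algebra_simps)
qed simp

text \<open>Row by row, \<open>fact (l i)\<close> splits as \<open>fact (n - 1 - i)\<close> times the factors \<open>n + c(u)\<close> of that row. The
empty partition accounts for the denominator.\<close>

lemma weyl_product_eq_content_product:
  assumes p: "is_partition p" and len: "part_length p \<le> n"
  shows "(\<Prod>(i, j)\<in>pairs n. shifted_part n p i - shifted_part n p j) * (\<Prod>u\<in>cells p. hook_length p u) =
    (\<Prod>(i, j)\<in>pairs n. staircase n i - staircase n j) * (\<Prod>u\<in>cells p. int n + cell_content u)"
proof -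
  have pairs: "(\<Prod>(i, j)\<in>pairs n. f i j) = (\<Prod>i<n. \<Prod>j\<in>{i<..<n}. f i j)" for f :: "nat \<Rightarrow> nat \<Rightarrow> int"
    unfolding pairs_Sigma by (subst prod.Sigma) auto
  have cells: "(\<Prod>u\<in>cells p. g u) = (\<Prod>i<n. \<Prod>c\<in>{1..part p (i + 1)}. g (i + 1, c))" for g :: "nat \<times> nat \<Rightarrow> int"
  proof -
    have "(\<Prod>u\<in>cells p. g u) = (\<Prod>i\<in>{1..n}. \<Prod>c\<in>{1..part p i}. g (i, c))"
      unfolding cells_eq_Sigma[OF p len] by (subst prod.Sigma) auto
    also have "\<dots> = (\<Prod>i<n. \<Prod>c\<in>{1..part p (i + 1)}. g (i + 1, c))"
      by (rule prod.reindex_bij_witness[of _ "\<lambda>i. i + 1" "\<lambda>i. i - 1"]) auto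
    finally show ?thesis .
  qed
  have "part [] i = 0" for i by (simp add: part_def)
  then have empty: "is_partition []" "part_length [] \<le> n" "shifted_part n [] i = int (n - 1 - i)" for i
    by (simp_all add: is_partition_def part_length_def shifted_part_def)
  have stair: "(\<Prod>j\<in>{i<..<n}. staircase n i - staircase n j) = fact (n - 1 - i)" if "i < n" for i
  proof -
    have "(\<Prod>j\<in>{i<..<n}. staircase n i - staircase n j) = (\<Prod>j\<in>{i<..<n}. shifted_part n [] i - shifted_part n [] j)"
      using that by (intro prod.cong) (auto simp: staircase_def empty)
    also have "\<dots> = fact (nat (shifted_part n [] i))"
      using row_hook_product[OF empty(1,2) that] by (simp add: part_def)
    finally show ?thesis by (simp only: empty nat_int)
  qed
  have "(\<Prod>j\<in>{i<..<n}. shifted_part n p i - shifted_part n p j) * (\<Prod>c\<in>{1..part p (i + 1)}. hook_length p (i + 1, c)) =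
      (\<Prod>j\<in>{i<..<n}. staircase n i - staircase n j) * (\<Prod>c\<in>{1..part p (i + 1)}. int n + cell_content (i + 1, c))"
    if i: "i < n" for i
  proof -
    have "nat (shifted_part n p i) = (n - 1 - i) + part p (i + 1)" by (simp add: shifted_part_def)
    moreover have "int (n - 1 - i) + int c = int n + cell_content (i + 1, c)" for c
      using i by (simp add: cell_content_def)
    ultimately show ?thesis
      unfolding row_hook_product[OF p len i] stair[OF i] by (simp only: fact_add_prod)
  qed
  then show ?thesis
    unfolding pairs cells prod.distrib[symmetric] by (intro prod.cong) auto
qed

text \<open>To apply irreducibility, a subspace of functions invariant under the elementary matrices has to be
turned into a subspace of vectors invariant under every matrix; the latter is reached by adding the
entries of the matrix one at a time.\<close>

lemma simple_gl_rep_dimension: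
  assumes \<rho>: "simple_gl_rep n d \<rho>" and hw: "has_highest_weight n d \<rho> p"
    and p: "is_partition p" and len: "part_length p \<le> n"
  shows "int d * (\<Prod>(i, j)\<in>pairs n. staircase n i - staircase n j) =
    (\<Prod>(i, j)\<in>pairs n. shifted_part n p i - shifted_part n p j)"
proof -
  have rep: "gl_rep n d \<rho>" using \<rho> by (simp add: simple_gl_rep_def)
  have irr: "W = {0\<^sub>v d} \<or> W = carrier_vec d"
    if "VectorSpace.subspace class_ring W (module_vec TYPE(complex) d)"
      "\<And>X w. X \<in> carrier_mat n n \<Longrightarrow> w \<in> W \<Longrightarrow> \<rho> X *\<^sub>v w \<in> W" for W
    using \<rho> that unfolding simple_gl_rep_def by blast
  interpret gl_operators n "unit_operator n d \<rho>" "finite_functions d"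
    by (rule gl_operators_of_gl_rep[OF rep])
  obtain v where v: "highest_vector (\<lambda>i. int (part p (i + 1))) v"
    using highest_vector_of_highest_weight[OF rep hw] by blast
  have car: "\<rho> Y \<in> carrier_mat d d" if "Y \<in> carrier_mat n n" for Y
    using rep that by (auto simp: gl_rep_def)
  have cu: "\<rho> (matrix_unit n i j) \<in> carrier_mat d d" for i j by (rule car) simp
  let ?\<delta> = "(\<lambda>a b. if b = a then 1 else (0::complex)) ` {..<d}"
  interpret irreducible_highest_weight n "unit_operator n d \<rho>" "finite_functions d"
    "\<lambda>i. int (part p (i + 1))" v ?\<delta>
  proof
    show "finite ?\<delta>" by simp
    show "finite_functions d \<subseteq> fs.span ?\<delta>"
      unfolding delta_basis(2)[OF finite_lessThan] by (auto simp: finite_functions_def)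
    show "highest_vector (\<lambda>i. int (part p (i + 1))) v" by (rule v)
    show "int (part p (k + 1)) = 0" if "n \<le> k" for k
      using part_eq_0[OF p, of "k + 1"] len that by simp
  next
    fix U assume U: "fs.subspace U" "U \<subseteq> finite_functions d"
      and inv: "\<And>i j f. i < n \<Longrightarrow> j < n \<Longrightarrow> f \<in> U \<Longrightarrow> unit_operator n d \<rho> i j f \<in> U"
    define W where "W = vec d ` U"
    have vec_add: "vec d f + vec d g = vec d (f + g)" for f g :: "nat \<Rightarrow> complex" by (intro eq_vecI) auto
    have vec_scale: "c \<cdot>\<^sub>v vec d f = vec d (fscale c f)" for c f by (intro eq_vecI) (auto simp: fscale_apply)
    have vec_zero: "vec d 0 = 0\<^sub>v d" by (intro eq_vecI) auto
    have W_add: "x + y \<in> W" if "x \<in> W" "y \<in> W" for x y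
      using that fs.subspace_add[OF U(1)] by (auto simp: W_def vec_add)
    have W_scale: "c \<cdot>\<^sub>v x \<in> W" if "x \<in> W" for c x
      using that fs.subspace_scale[OF U(1)] by (auto simp: W_def vec_scale)
    have W_zero: "0\<^sub>v d \<in> W" using fs.subspace_0[OF U(1)] vec_zero by (metis W_def imageI)
    have W_car: "W \<subseteq> carrier_vec d" by (auto simp: W_def)
    have W_unit: "\<rho> (matrix_unit n i j) *\<^sub>v w \<in> W" if "i < n" "j < n" "w \<in> W" for i j w
      using that inv by (auto simp: W_def simp flip: vec_matrix_operator[OF cu])
    have "\<rho> Y *\<^sub>v w \<in> W" if Y: "Y \<in> carrier_mat n n" and w: "w \<in> W" for Y w
    proof -
      have wc: "w \<in> carrier_vec d" using w W_car by blast
      define trunc where "trunc S = mat n n (\<lambda>q. if q \<in> S then Y $$ q else 0)" for S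
      have "finite S \<Longrightarrow> S \<subseteq> {..<n} \<times> {..<n} \<Longrightarrow> \<rho> (trunc S) *\<^sub>v w \<in> W" for S
      proof (induction S rule: finite_induct)
        case empty
        have "trunc {} = 0\<^sub>m n n" by (intro eq_matI) (auto simp: trunc_def)
        moreover have "0\<^sub>m d d *\<^sub>v w = 0\<^sub>v d" using wc by (intro eq_vecI) auto
        ultimately show ?case using gl_rep_zero[OF rep] W_zero by simp
      next
        case (insert q S)
        obtain i j where q: "q = (i, j)" by (cases q)
        have ij: "i < n" "j < n" using insert.prems q by auto
        have "trunc (insert q S) = trunc S + Y $$ q \<cdot>\<^sub>m matrix_unit n i j"
          using insert.hyps q by (intro eq_matI) (auto simp: trunc_def matrix_unit_def)
        moreover have "\<rho> (trunc S + Y $$ q \<cdot>\<^sub>m matrix_unit n i j) = \<rho> (trunc S) + Y $$ q \<cdot>\<^sub>m \<rho> (matrix_unit n i j)"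
          using rep by (simp add: gl_rep_def trunc_def)
        moreover have smult_mult: "(c \<cdot>\<^sub>m \<rho> (matrix_unit n i j)) *\<^sub>v w = c \<cdot>\<^sub>v (\<rho> (matrix_unit n i j) *\<^sub>v w)" for c
          using cu[of i j] wc by (intro eq_vecI) (auto simp: scalar_prod_def sum_distrib_left mult.assoc)
        moreover have "\<rho> (trunc S) \<in> carrier_mat d d" by (rule car) (simp add: trunc_def)
        ultimately have "\<rho> (trunc (insert q S)) *\<^sub>v w = \<rho> (trunc S) *\<^sub>v w + Y $$ q \<cdot>\<^sub>v (\<rho> (matrix_unit n i j) *\<^sub>v w)"
          using cu wc smult_mult by (simp add: add_mult_distrib_mat_vec[of _ d d])
        then show ?case using insert W_add W_scale W_unit[OF ij w] by simp
      qed
      from this[of "{..<n} \<times> {..<n}"] have "\<rho> (trunc ({..<n} \<times> {..<n})) *\<^sub>v w \<in> W" by simp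
      moreover have "trunc ({..<n} \<times> {..<n}) = Y" using Y by (intro eq_matI) (auto simp: trunc_def)
      ultimately show ?thesis by simp
    qed
    moreover have "VectorSpace.subspace class_ring W (module_vec TYPE(complex) d)"
      unfolding VectorSpace.subspace_def submodule_def
      using vec_vs vec_module W_add W_scale W_zero W_car by (auto simp: module_vec_simps)
    ultimately have "W = {0\<^sub>v d} \<or> W = carrier_vec d" by (rule irr[rotated])
    then show "U = {0} \<or> U = finite_functions d"
    proof
      assume W: "W = {0\<^sub>v d}"
      have "f = 0" if "f \<in> U" for f
      proof (rule vec_inj_finite_functions)
        show "f \<in> finite_functions d" using that U by blast
        show "0 \<in> finite_functions d" by (rule fs.subspace_0[OF subspace_finite_functions])
        have "vec d f \<in> W" using that by (simp add: W_def)
        then show "vec d f = vec d 0" unfolding W vec_zero by simp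
      qed
      then show ?thesis using fs.subspace_0[OF U(1)] by auto
    next
      assume W: "W = carrier_vec d"
      have "f \<in> U" if f: "f \<in> finite_functions d" for f
      proof -
        have "vec d f \<in> W" by (simp add: W)
        then obtain g where "g \<in> U" "vec d f = vec d g" by (auto simp: W_def)
        then show ?thesis using vec_inj_finite_functions[OF f, of g] U by auto
      qed
      then show ?thesis using U by blast
    qed
  qed
  have "of_nat (fs.dim (finite_functions d)) * (\<Prod>(i, j)\<in>pairs n. of_int (staircase n i - staircase n j)) =
      (\<Prod>(i, j)\<in>pairs n. of_int ((int (part p (i + 1)) + staircase n i) - (int (part p (j + 1)) + staircase n j)) :: complex)"
    using part_antimono[OF p] by (intro irreducible_dimension) simp
  also have "\<dots> = (\<Prod>(i, j)\<in>pairs n. of_int (shifted_part n p i - shifted_part n p j))"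
    by (intro prod.cong) (auto simp: pairs_def shifted_part_def staircase_def)
  finally have "of_int (int d * (\<Prod>(i, j)\<in>pairs n. staircase n i - staircase n j)) =
      (of_int (\<Prod>(i, j)\<in>pairs n. shifted_part n p i - shifted_part n p j) :: complex)"
    unfolding dim_finite_functions by (simp add: case_prod_unfold)
  then show ?thesis by (simp only: of_int_eq_iff)
qed

text \<open>Existence of a simple module and the dimension formula for all of them together determine the
dimension. If \<open>p\<close> has more than \<open>n\<close> rows, the product vanishes because of the first cell of row
\<open>n + 1\<close>, whose content is \<open>- n\<close>.\<close>

theorem hook_content_formula:
  assumes p: "is_partition p"
  shows "int (dim_F n p) * (\<Prod>u\<in>cells p. hook_length p u) = (\<Prod>u\<in>cells p. int n + cell_content u)"
proof (cases "part_length p \<le> n")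
  case True
  let ?S = "\<Prod>(i, j)\<in>pairs n. staircase n i - staircase n j"
  let ?L = "\<Prod>(i, j)\<in>pairs n. shifted_part n p i - shifted_part n p j"
  have S0: "?S \<noteq> 0"
    unfolding prod_zero_iff[OF finite_pairs] by (auto simp: pairs_def staircase_def)
  obtain d \<rho> where d: "simple_gl_rep n d \<rho>" "has_highest_weight n d \<rho> p"
    using simple_highest_weight_rep_exists[OF highest_weight_rep_exists[OF p]] by blast
  note dim = simple_gl_rep_dimension[OF d p True]
  have "(THE d. \<exists>\<rho>. simple_gl_rep n d \<rho> \<and> has_highest_weight n d \<rho> p) = d"
  proof (rule the_equality)
    show "\<exists>\<rho>. simple_gl_rep n d \<rho> \<and> has_highest_weight n d \<rho> p" using d by blast
  next
    fix d' assume "\<exists>\<rho>. simple_gl_rep n d' \<rho> \<and> has_highest_weight n d' \<rho> p"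
    then have "int d' * ?S = ?L" using simple_gl_rep_dimension[OF _ _ p True] by blast
    then show "d' = d" using dim S0 by (metis mult_cancel_right of_nat_eq_iff)
  qed
  then have "int (dim_F n p) * ?S = ?L" using True dim by (simp add: dim_F_def)
  note dim_F = this
  have "(int (dim_F n p) * (\<Prod>u\<in>cells p. hook_length p u)) * ?S =
      (int (dim_F n p) * ?S) * (\<Prod>u\<in>cells p. hook_length p u)"
    by (simp only: mult_ac)
  also have "\<dots> = (\<Prod>u\<in>cells p. int n + cell_content u) * ?S"
    unfolding dim_F weyl_product_eq_content_product[OF p True] by (simp only: mult_ac)
  finally have "(int (dim_F n p) * (\<Prod>u\<in>cells p. hook_length p u)) * ?S =
      (\<Prod>u\<in>cells p. int n + cell_content u) * ?S" .
  then show ?thesis using S0 by simp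
next
  case False
  then have "(n + 1, 1) \<in> cells p"
    using le_column_iff[OF p, of "n + 1" 1] by (simp add: cells_def part_length_eq_column)
  then have "(\<Prod>u\<in>cells p. int n + cell_content u) = 0"
    using finite_cells[OF p] by (intro prod_zero) (auto simp: cell_content_def intro!: bexI[of _ "(n + 1, 1)"])
  then show ?thesis using False by (simp add: dim_F_def)
qed

section \<open>Conjugate partitions and contents\<close>

lemma length_conjugate: "length (conjugate_part p) = part p 1"
  by (simp add: conjugate_part_def)

lemma nth_conjugate: "k < part p 1 \<Longrightarrow> conjugate_part p ! k = column p (k + 1)"
  by (simp add: conjugate_part_def column_def del: upt_Suc)

lemma part_conjugate:
  assumes p: "is_partition p" and j: "1 \<le> j"
  shows "part (conjugate_part p) j = column p j"
proof (cases "j \<le> part p 1")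
  case True
  then show ?thesis
    using j nth_conjugate[of "j - 1" p] by (simp add: part_def[of "conjugate_part p"] length_conjugate)
next
  case False
  then have "column p j = 0" using le_column_iff[OF p, of 1 j] j by simp
  then show ?thesis using False by (simp add: part_def[of "conjugate_part p"] length_conjugate)
qed

lemma is_partition_conjugate:
  assumes p: "is_partition p"
  shows "is_partition (conjugate_part p)"
  unfolding is_partition_def sorted_wrt_iff_nth_less
proof (intro allI impI)
  fix i j assume "i < j" "j < length (conjugate_part p)"
  then show "conjugate_part p ! j \<le> conjugate_part p ! i"
    using column_antimono[OF p, of "i + 1" "j + 1"] by (simp add: length_conjugate nth_conjugate)
qed

lemma column_conjugate:
  assumes p: "is_partition p" and i: "1 \<le> i"
  shows "column (conjugate_part p) i = part p i"
proof -
  have "{j. 1 \<le> j \<and> i \<le> part (conjugate_part p) j} = {1..part p i}"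
    using part_conjugate[OF p] le_column_iff[OF p i] by auto
  then show ?thesis by (simp add: column_def)
qed

lemma cells_conjugate: "is_partition p \<Longrightarrow> cells (conjugate_part p) = prod.swap ` cells p"
  using part_conjugate le_column_iff by (auto simp: cells_def image_iff)

lemma prod_cells_conjugate:
  "is_partition p \<Longrightarrow> (\<Prod>u\<in>cells (conjugate_part p). g u) = (\<Prod>u\<in>cells p. g (prod.swap u))"
  unfolding cells_conjugate by (subst prod.reindex) (auto simp: inj_on_def)

lemma hook_product_conjugate:
  assumes p: "is_partition p"
  shows "(\<Prod>u\<in>cells (conjugate_part p). hook_length (conjugate_part p) u) = (\<Prod>u\<in>cells p. hook_length p u)"
  unfolding prod_cells_conjugate[OF p]
  using part_conjugate[OF p] column_conjugate[OF p]
  by (intro prod.cong) (auto simp: hook_length_def cells_def)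

text \<open>Transposition preserves hook lengths and negates contents, so the common hook product cancels.\<close>

lemma dim_F_eq_iff:
  assumes p: "is_partition p"
  shows "dim_F n p = dim_F (m + n) (conjugate_part p) \<longleftrightarrow>
    (\<Prod>u\<in>cells p. int n + cell_content u) = (\<Prod>u\<in>cells p. int n + (int m - cell_content u))"
proof -
  let ?H = "\<Prod>u\<in>cells p. hook_length p u"
  have H: "?H \<noteq> 0"
    using hook_length_pos[OF p] finite_cells[OF p] by (force simp: prod_zero_iff)
  have 1: "int (dim_F n p) * ?H = (\<Prod>u\<in>cells p. int n + cell_content u)"
    by (rule hook_content_formula[OF p])
  have "int (dim_F (m + n) (conjugate_part p)) * ?H =
      (\<Prod>u\<in>cells p. int (m + n) + cell_content (prod.swap u))"
    using hook_content_formula[OF is_partition_conjugate[OF p], of "m + n"]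
    unfolding hook_product_conjugate[OF p] unfolding prod_cells_conjugate[OF p] .
  also have "\<dots> = (\<Prod>u\<in>cells p. int n + (int m - cell_content u))"
    by (intro prod.cong) (auto simp: cell_content_def)
  finally have 2: "int (dim_F (m + n) (conjugate_part p)) * ?H = (\<Prod>u\<in>cells p. int n + (int m - cell_content u))" .
  show ?thesis unfolding 1[symmetric] 2[symmetric] using H by simp
qed

text \<open>Agreement at all large integers forces equality of polynomials, hence of the multisets of roots.\<close>

lemma linear_products_equal_iff:
  fixes f g :: "'a \<Rightarrow> int"
  assumes A: "finite A"
  shows "(\<forall>n\<ge>k. (\<Prod>a\<in>A. int n + f a) = (\<Prod>a\<in>A. int n + g a)) \<longleftrightarrow>
    (\<forall>c. card {a \<in> A. f a = c} = card {a \<in> A. g a = c})"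
proof -
  define P where "P h = (\<Prod>a\<in>A. [:h a, 1:])" for h :: "'a \<Rightarrow> int"
  have eval: "poly (P h) (int n) = (\<Prod>a\<in>A. int n + h a)" for h n
    by (simp add: P_def poly_prod add.commute)
  have roots: "proots (P h) = image_mset (\<lambda>a. - h a) (mset_set A)" for h
    unfolding P_def using A by (subst proots_prod) (auto simp: sum_unfold_sum_mset)
  have count: "count (image_mset h (mset_set A)) c = card {a \<in> A. h a = c}" for h :: "'a \<Rightarrow> int" and c
  proof -
    have "{a \<in> A. c = h a} = {a \<in> A. h a = c}" by auto
    then show ?thesis using A by (simp add: count_image_mset')
  qed
  have "(\<forall>n\<ge>k. (\<Prod>a\<in>A. int n + f a) = (\<Prod>a\<in>A. int n + g a)) \<longleftrightarrow>
      image_mset f (mset_set A) = image_mset g (mset_set A)"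
  proof
    assume eq: "\<forall>n\<ge>k. (\<Prod>a\<in>A. int n + f a) = (\<Prod>a\<in>A. int n + g a)"
    have "P f = P g"
    proof (rule ccontr)
      assume "P f \<noteq> P g"
      then have "finite {x. poly (P f - P g) x = 0}" by (intro poly_roots_finite) simp
      moreover have "int ` {k..} \<subseteq> {x. poly (P f - P g) x = 0}" using eq by (auto simp: eval)
      ultimately have "finite (int ` {k..})" by (rule finite_subset[rotated])
      then show False by (simp add: finite_image_iff infinite_Ici)
    qed
    then have "image_mset uminus (image_mset (\<lambda>a. - f a) (mset_set A)) =
        image_mset uminus (image_mset (\<lambda>a. - g a) (mset_set A))"
      by (simp only: roots[symmetric])
    then show "image_mset f (mset_set A) = image_mset g (mset_set A)"
      by (simp add: multiset.map_comp comp_def)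
  next
    assume eq: "image_mset f (mset_set A) = image_mset g (mset_set A)"
    have "(\<Prod>a\<in>A. int n + h a) = prod_mset (image_mset (\<lambda>x. int n + x) (image_mset h (mset_set A)))" for n h
      by (simp add: prod_unfold_prod_mset multiset.map_comp comp_def)
    then show "\<forall>n\<ge>k. (\<Prod>a\<in>A. int n + f a) = (\<Prod>a\<in>A. int n + g a)" by (simp add: eq)
  qed
  also have "\<dots> \<longleftrightarrow> (\<forall>c. card {a \<in> A. f a = c} = card {a \<in> A. g a = c})"
    by (simp add: multiset_eq_iff count)
  finally show ?thesis .
qed

text \<open>For the row lengths \<open>f\<close> and \<open>k \<ge> 0\<close> these are the indices \<open>i\<close> with Frobenius coordinate \<open>\<alpha>\<^sub>i \<ge> k\<close>; for the
column lengths, those with \<open>\<beta>\<^sub>i \<ge> k\<close>.\<close>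

definition diagonal_arms :: "(nat \<Rightarrow> nat) \<Rightarrow> int \<Rightarrow> nat set" where
  "diagonal_arms f k = {i. 1 \<le> i \<and> k \<le> int (f i) - int i}"

lemma arm_segment:
  assumes "\<And>i j. 1 \<le> i \<Longrightarrow> i \<le> j \<Longrightarrow> f j \<le> f i" "0 \<le> k"
  shows "diagonal_arms f k = {1..card (diagonal_arms f k)}"
proof (rule initial_segment)
  show "finite (diagonal_arms f k)"
  proof (rule finite_subset)
    show "diagonal_arms f k \<subseteq> {..f 1}"
      using assms(1)[of 1] assms(2) by (fastforce simp: diagonal_arms_def)
  qed simp
next
  fix i j assume "i \<in> diagonal_arms f k" "1 \<le> j" "j \<le> i"
  then show "j \<in> diagonal_arms f k" using assms(1)[of j i] by (simp add: diagonal_arms_def)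
qed (simp add: diagonal_arms_def)

text \<open>A diagonal of content \<open>k\<close> meets exactly the rows whose arm at the main diagonal is at least \<open>k\<close>.\<close>

lemma card_content_nonneg:
  assumes p: "is_partition p" and k: "0 \<le> k"
  shows "card {u \<in> cells p. cell_content u = k} = card (diagonal_arms (part p) k)"
proof (rule bij_betw_same_card)
  show "bij_betw fst {u \<in> cells p. cell_content u = k} (diagonal_arms (part p) k)"
    by (rule bij_betwI[where g = "\<lambda>i. (i, i + nat k)"])
      (use k in \<open>auto simp: cells_def cell_content_def diagonal_arms_def\<close>)
qed

lemma card_content_nonpos:
  assumes p: "is_partition p" and k: "0 \<le> k"
  shows "card {u \<in> cells p. cell_content u = - k} = card (diagonal_arms (column p) k)"
proof (rule bij_betw_same_card)
  have "(i, j) \<in> cells p \<longleftrightarrow> 1 \<le> i \<and> 1 \<le> j \<and> i \<le> column p j" for i j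
    by (auto simp: cells_def le_column_iff[OF p])
  then show "bij_betw snd {u \<in> cells p. cell_content u = - k} (diagonal_arms (column p) k)"
    by (intro bij_betwI[where g = "\<lambda>j. (j + nat k, j)"])
      (use k in \<open>auto simp: cell_content_def diagonal_arms_def\<close>)
qed

text \<open>Indices up to the Frobenius rank are those with \<open>(i, i)\<close> in the diagram, and the two coordinates of
the conjugate are those of \<open>p\<close> exchanged.\<close>

lemma asymmetric_conjugate_iff:
  assumes p: "is_partition p"
  shows "asymmetric_part (int m) (conjugate_part p) \<longleftrightarrow>
    (\<forall>i\<ge>1. i \<le> part p i \<longrightarrow> part p i = column p i + m)"
proof -
  let ?q = "conjugate_part p"
  have q: "is_partition ?q" by (rule is_partition_conjugate[OF p])
  define D where "D = {k. 1 \<le> k \<and> k \<le> part ?q k}"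
  have fin: "finite D"
    by (rule finite_subset[of _ "{..part ?q 1}"]) (use part_antimono[OF q, of 1] in \<open>auto simp: D_def intro: order_trans\<close>)
  have seg: "D = {1..card D}"
  proof (rule initial_segment[OF fin])
    fix i j assume "i \<in> D" "1 \<le> j" "j \<le> i"
    then show "j \<in> D" using part_antimono[OF q, of j i] by (simp add: D_def)
  qed (simp add: D_def)
  then obtain r where r: "D = {1..r}" by blast
  have rank: "frobenius_rank ?q = r"
  proof -
    have "{0} \<union> {k. 1 \<le> k \<and> k \<le> part ?q k} = {0..r}"
      unfolding D_def[symmetric] r by auto
    moreover have "Max {0..r} = r" by (intro Max_eqI) auto
    ultimately show ?thesis unfolding frobenius_rank_def by simp
  qed
  have "i \<in> {1..frobenius_rank ?q} \<longleftrightarrow> 1 \<le> i \<and> i \<le> part p i" for i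
  proof -
    have "i \<in> {1..frobenius_rank ?q} \<longleftrightarrow> i \<in> D" unfolding rank r ..
    also have "\<dots> \<longleftrightarrow> 1 \<le> i \<and> i \<le> column p i" using part_conjugate[OF p] by (auto simp: D_def)
    also have "\<dots> \<longleftrightarrow> 1 \<le> i \<and> i \<le> part p i" using le_column_iff[OF p, of i i] by auto
    finally show ?thesis .
  qed
  moreover have "frobenius_beta ?q i = frobenius_alpha ?q i + int m \<longleftrightarrow> part p i = column p i + m" if "1 \<le> i" for i
    using part_conjugate[OF is_partition_conjugate[OF p] that] column_conjugate[OF p that] part_conjugate[OF p that]
    by (auto simp: frobenius_beta_def frobenius_alpha_def)
  ultimately show ?thesis unfolding asymmetric_part_def by blast
qed

text \<open>The contents \<open>m + k\<close> and \<open>- k\<close>, for \<open>k \<ge> 0\<close>, count initial segments of indices defined by \<open>\<alpha>\<^sub>i \<ge> m + k\<close>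
and \<open>\<beta>\<^sub>i \<ge> k\<close>. Equal counts mean equal segments, and letting \<open>k\<close> vary gives \<open>\<alpha>\<^sub>i = \<beta>\<^sub>i + m\<close>. Conversely
the contents strictly between \<open>0\<close> and \<open>m\<close> also occur equally often, once per diagonal cell, since then every
\<open>\<alpha>\<^sub>i\<close> is at least \<open>m\<close>.\<close>

lemma content_symmetric_iff:
  assumes p: "is_partition p"
  shows "(\<forall>c. card {u \<in> cells p. cell_content u = c} = card {u \<in> cells p. int m - cell_content u = c}) \<longleftrightarrow>
    (\<forall>i\<ge>1. i \<le> part p i \<longrightarrow> part p i = column p i + m)"
proof -
  define N where "N c = card {u \<in> cells p. cell_content u = c}" for c
  have N_reflect: "card {u \<in> cells p. int m - cell_content u = c} = N (int m - c)" for c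
  proof -
    have "int m - x = c \<longleftrightarrow> x = int m - c" for x by auto
    then show ?thesis by (simp add: N_def)
  qed
  have N_nonneg: "N k = card (diagonal_arms (part p) k)" and N_nonpos: "N (- k) = card (diagonal_arms (column p) k)"
    if "0 \<le> k" for k
    using card_content_nonneg[OF p that] card_content_nonpos[OF p that] by (simp_all add: N_def)
  have diag: "i \<le> column p i \<longleftrightarrow> i \<le> part p i" if "1 \<le> i" for i
    using le_column_iff[OF p that that] .
  have "(\<forall>c. N c = N (int m - c)) \<longleftrightarrow> (\<forall>i\<ge>1. i \<le> part p i \<longrightarrow> part p i = column p i + m)"
  proof
    assume sym: "\<forall>c. N c = N (int m - c)"
    have arms: "int m + k \<le> int (part p i) - int i \<longleftrightarrow> k \<le> int (column p i) - int i"
      if "1 \<le> i" "0 \<le> k" for i k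
    proof -
      have "card (diagonal_arms (part p) (int m + k)) = card (diagonal_arms (column p) k)"
        using sym[rule_format, of "int m + k"] N_nonneg[of "int m + k"] N_nonpos[of k] that by simp
      then have "diagonal_arms (part p) (int m + k) = diagonal_arms (column p) k"
        using arm_segment[of "part p" "int m + k"] arm_segment[of "column p" k] that
          part_antimono[OF p] column_antimono[OF p] by simp
      then show ?thesis using that by (auto simp: diagonal_arms_def set_eq_iff)
    qed
    show "\<forall>i\<ge>1. i \<le> part p i \<longrightarrow> part p i = column p i + m"
    proof (intro allI impI)
      fix i assume i: "1 \<le> i" "i \<le> part p i"
      have lower: "int m + (int (column p i) - int i) \<le> int (part p i) - int i"
        using arms[of i "int (column p i) - int i"] diag[OF i(1)] i by simp
      moreover have "int (part p i) - int i - int m \<le> int (column p i) - int i"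
        using arms[of i "int (part p i) - int i - int m"] lower diag[OF i(1)] i by simp
      ultimately show "part p i = column p i + m" by simp
    qed
  next
    assume asym: "\<forall>i\<ge>1. i \<le> part p i \<longrightarrow> part p i = column p i + m"
    have large: "N (int m + k) = N (- k)" if "0 \<le> k" for k
    proof -
      have "diagonal_arms (part p) (int m + k) = diagonal_arms (column p) k"
      proof (intro equalityI subsetI)
        fix i assume "i \<in> diagonal_arms (part p) (int m + k)"
        then show "i \<in> diagonal_arms (column p) k"
          using asym[rule_format, of i] that by (auto simp: diagonal_arms_def)
      next
        fix i assume "i \<in> diagonal_arms (column p) k"
        then show "i \<in> diagonal_arms (part p) (int m + k)"
          using asym[rule_format, of i] diag[of i] that by (auto simp: diagonal_arms_def)
      qed
      then show ?thesis using N_nonneg[of "int m + k"] N_nonpos[OF that] that by simp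
    qed
    have small: "N c = N 0" if "0 \<le> c" "c \<le> int m" for c
    proof -
      have "diagonal_arms (part p) c = diagonal_arms (part p) 0"
      proof (intro equalityI subsetI)
        fix i assume "i \<in> diagonal_arms (part p) 0"
        then show "i \<in> diagonal_arms (part p) c"
          using asym[rule_format, of i] diag[of i] that by (auto simp: diagonal_arms_def)
      qed (use that in \<open>auto simp: diagonal_arms_def\<close>)
      then show ?thesis using N_nonneg[OF that(1)] N_nonneg[of 0] by simp
    qed
    show "\<forall>c. N c = N (int m - c)"
    proof
      fix c
      consider "c \<le> 0" | "0 \<le> c" "c \<le> int m" | "int m \<le> c" by linarith
      then show "N c = N (int m - c)"
      proof cases
        case 1
        then show ?thesis using large[of "- c"] by simp
      next
        case 2
        then show ?thesis using small[of c] small[of "int m - c"] by simp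
      next
        case 3
        then show ?thesis using large[of "c - int m"] by simp
      qed
    qed
  qed
  then show ?thesis by (simp add: N_reflect N_def[symmetric])
qed

theorem theorem3p9:
  fixes m :: nat and lam :: "nat list"
  assumes "is_partition lam"
  shows "(\<forall>n::nat. n \<ge> 1 \<and> n \<ge> part_length lam \<longrightarrow>
            dim_F n lam = dim_F (m + n) (conjugate_part lam))
         \<longleftrightarrow> asymmetric_part (int m) (conjugate_part lam)"
proof -
  define k where "k = max 1 (part_length lam)"
  have "(\<forall>n::nat. n \<ge> 1 \<and> n \<ge> part_length lam \<longrightarrow> dim_F n lam = dim_F (m + n) (conjugate_part lam)) \<longleftrightarrow>
      (\<forall>n\<ge>k. (\<Prod>u\<in>cells lam. int n + cell_content u) = (\<Prod>u\<in>cells lam. int n + (int m - cell_content u)))"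
    by (simp add: dim_F_eq_iff[OF assms] k_def)
  also have "\<dots> \<longleftrightarrow> asymmetric_part (int m) (conjugate_part lam)"
    unfolding linear_products_equal_iff[OF finite_cells[OF assms]]
      content_symmetric_iff[OF assms] asymmetric_conjugate_iff[OF assms] ..
  finally show ?thesis .
qed

end
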